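(* Let $\lambda,\mu\in[0,1]$ and $\rho\in(0,1)$ be constants with $F(\lambda,\mu,\rho,1)>1+\epsilon$ for some constant $\epsilon>0$. Let $\pi_*$ be the law of a pair $(\mathbb X,\mathbb Y)$ of real random variables with $\mathbb E[\mathbb X]=\mathbb E[\mathbb Y]=0$, $\mathbb E[\mathbb X^2]=\mathbb E[\mathbb Y^2]=1$, $\mathbb E[\mathbb X\mathbb Y]=\rho$ and $\mathbb E[\mathbb X^4],\mathbb E[\mathbb Y^4]\le C$ for an absolute constant $C$. Let $\delta=\delta(\lambda,\mu,\rho)\in(0,0.1)$ be a constant with $A_+>1+\delta$, and let $\ell=\ell_n$ satisfy $\ell=O_\delta(\log n)$ and $(1+\delta)^\ell\ge n^2$. Then there is a sufficiently large constant $R=O_{\lambda,\mu,\rho,\delta}(1)$, satisfying $\mathbb E_{\mathbb P}[(\Phi^{\mathcal J}_{u,v})^2]\le R$ and $\mathbb E_{\mathbb P}[(\Phi^{\mathcal J}_{u,v})^2x_u^2x_v^2]\le R$ for all distinct $u,v\in[n]$, such that for an arbitrary choice of $w\in[n]$ the estimator $\widehat x\in\mathbb R^n$ given by $$\widehat x_u=\Phi^{\mathcal J}_{w,u}\cdot\mathbf 1_{\{|\Phi^{\mathcal J}_{w,u}|\le R^4\}},\qquad 1\le u\le n,$$ satisfies $$\mathbb E_{\mathbb P}\Big[\frac{|\langle\widehat x,x\rangle|}{\|\widehat x\|\,\|x\|}\Big]\ge\Omega(1)\qquad(n\to\infty).$$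
   Context: **The function $F$ and $A_+$.** $F(\lambda,\mu,\rho,\gamma)=\max\Big\{\frac{\lambda^2}{\gamma},\frac{\mu^2}{\gamma},\frac{\lambda^2\rho^2}{\gamma-\lambda^2+\lambda^2\rho^2}+\frac{\mu^2\rho^2}{\gamma-\mu^2+\mu^2\rho^2}\Big\}$ and $A_+=\frac12\Big(\lambda^2+\mu^2+\sqrt{\lambda^4+\mu^4-(2-4\rho^4)\lambda^2\mu^2}\Big)$. (Under the hypotheses of the claim $A_+>1$, so such a $\delta$ exists.) **Model (correlated spiked Wigner).** The pairs $(x_i,y_i)_{1\le i\le n}$ are i.i.d. from $\pi_*$, $x=(x_i)$, $y=(y_i)\in\mathbb R^n$. $\boldsymbol W,\boldsymbol Z$ are independent (of each other and of $(x,y)$) $n\times n$ Wigner matrices: symmetric, with independent entries for $i\le j$ distributed as centered normals of variance $1+\mathbf 1_{i=j}$. $\mathbb P$ is the (joint) law under which $\boldsymbol X=\frac{\lambda}{\sqrt n}xx^\top+\boldsymbol W$, $\boldsymbol Y=\frac{\mu}{\sqrt n}yy^\top+\boldsymbol Z$. **Decorated graphs.** A decorated graph $H$ is a simple graph with a map $E(H)\to\{\bullet,\circ\}$; $E_\bullet(H),E_\circ(H)$ are the sets of edges with decoration $\bullet,\circ$; $V_\bullet(H),V_\circ(H)$ are the sets of vertices incident to at least one edge of $E_\bullet(H)$, resp. $E_\circ(H)$; $\mathsf{diff}(H)=V_\bullet(H)\cap V_\circ(H)$; $\mathsf L(H)$ is the set of leaves (degree-one vertices). Isomorphisms of decorated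 graphs preserve edges and decorations; $[H]$ is the isomorphism class, $|\mathsf{Aut}(H)|$ the number of automorphisms. $\mathsf K_n$ is the complete graph on $[n]$; $S\subset\mathsf K_n$ ranges over decorated subgraphs. **Statistic.** $\mathcal J=\mathcal J(\ell)$ is the collection of isomorphism classes of decorated paths $H$ of length $\ell$ (i.e. with $\ell$ edges) such that $\mathsf L(H)\subset V_\bullet(H)$. Set $\Xi(H)=\lambda^{|E_\bullet(H)|}\mu^{|E_\circ(H)|}\rho^{|\mathsf{diff}(H)|}$, $\beta_{\mathcal J}=\sum_{[H]\in\mathcal J}\frac{\Xi(H)^2}{|\mathsf{Aut}(H)|}$, $f_S(\boldsymbol X,\boldsymbol Y)=\prod_{(i,j)\in E_\bullet(S)}\boldsymbol X_{i,j}\prod_{(i,j)\in E_\circ(S)}\boldsymbol Y_{i,j}$ and, for $u,v\in[n]$, $$\Phi^{\mathcal J}_{u,v}=\frac1{n^{\frac\ell2-1}\beta_{\mathcal J}}\sum_{[H]\in\mathcal J}\Xi(H)\sum_{\substack{S\subset\mathsf K_n:\,S\cong H\\ \mathsf L(S)=\{u,v\}}}f_S(\boldsymbol X,\boldsymbol Y)$$ (an empty sum, hence $0$, if $u=v$). The ratio $|\langle\widehat x,x\rangle|/(\|\widehat x\|\|x\|)$ is read as $0$ when its denominator vanishes. *)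

theory Defs
  imports "HOL-Probability.Probability"
begin

definition F_fun :: "real \<Rightarrow> real \<Rightarrow> real \<Rightarrow> real \<Rightarrow> real" where
  "F_fun lam \<mu> \<rho> \<gamma> = Max {lam\<^sup>2 / \<gamma>, \<mu>\<^sup>2 / \<gamma>,
     lam\<^sup>2 * \<rho>\<^sup>2 / (\<gamma> - lam\<^sup>2 + lam\<^sup>2 * \<rho>\<^sup>2) + \<mu>\<^sup>2 * \<rho>\<^sup>2 / (\<gamma> - \<mu>\<^sup>2 + \<mu>\<^sup>2 * \<rho>\<^sup>2)}"

definition A_plus :: "real \<Rightarrow> real \<Rightarrow> real \<Rightarrow> real" where
  "A_plus lam \<mu> \<rho> =
     (lam\<^sup>2 + \<mu>\<^sup>2 + sqrt (lam ^ 4 + \<mu> ^ 4 - (2 - 4 * \<rho> ^ 4) * lam\<^sup>2 * \<mu>\<^sup>2)) / 2"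

datatype decoration = Bullet | Circ

text \<open>The decoration is a partial map on vertex sets whose domain is the edge set, so two decorated
  graphs are equal iff they have the same vertices, edges and decorations.\<close>

record 'v dgraph =
  verts :: "'v set"
  deco :: "'v set \<Rightarrow> decoration option"

definition edges :: "'v dgraph \<Rightarrow> 'v set set" where
  "edges H = dom (deco H)"

definition edges_of :: "decoration \<Rightarrow> 'v dgraph \<Rightarrow> 'v set set" where
  "edges_of d H = {e. deco H e = Some d}"

definition verts_of :: "decoration \<Rightarrow> 'v dgraph \<Rightarrow> 'v set" where
  "verts_of d H = \<Union> (edges_of d H)"

definition diff_verts :: "'v dgraph \<Rightarrow> 'v set" where
  "diff_verts H = verts_of Bullet H \<inter> verts_of Circ H"

definition leaves :: "'v dgraph \<Rightarrow> 'v set" where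
  "leaves H = {v \<in> verts H. card {e \<in> edges H. v \<in> e} = 1}"

definition decorated_graph :: "'v dgraph \<Rightarrow> bool" where
  "decorated_graph H \<longleftrightarrow>
     finite (verts H) \<and> (\<forall>e\<in>edges H. e \<subseteq> verts H \<and> card e = 2)"

definition is_dgraph_iso :: "('v \<Rightarrow> 'w) \<Rightarrow> 'v dgraph \<Rightarrow> 'w dgraph \<Rightarrow> bool" where
  "is_dgraph_iso \<phi> G H \<longleftrightarrow> bij_betw \<phi> (verts G) (verts H) \<and>
     (\<forall>u\<in>verts G. \<forall>v\<in>verts G. deco H {\<phi> u, \<phi> v} = deco G {u, v})"

definition dgraph_iso :: "'v dgraph \<Rightarrow> 'w dgraph \<Rightarrow> bool" where
  "dgraph_iso G H \<longleftrightarrow> decorated_graph G \<and> decorated_graph H \<and> (\<exists>\<phi>. is_dgraph_iso \<phi> G H)"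

definition Aut :: "'v dgraph \<Rightarrow> ('v \<Rightarrow> 'v) set" where
  "Aut H = {\<phi> \<in> verts H \<rightarrow>\<^sub>E verts H. is_dgraph_iso \<phi> H H}"

definition decorated_path :: "nat \<Rightarrow> 'v dgraph \<Rightarrow> bool" where
  "decorated_path l H \<longleftrightarrow> decorated_graph H \<and>
     (\<exists>vs. length vs = Suc l \<and> distinct vs \<and> verts H = set vs \<and>
           edges H = {{vs ! i, vs ! Suc i} | i. i < l})"

definition decorated_subgraphs_K :: "nat \<Rightarrow> nat dgraph set" where
  "decorated_subgraphs_K n = {S. decorated_graph S \<and> verts S \<subseteq> {1..n}}"

text \<open>Isomorphism classes are taken among graphs on natural numbers; every finite graph is isomorphic
  to one of these.\<close>

definition JJ :: "nat \<Rightarrow> nat dgraph set set" where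
  "JJ l = {H. decorated_path l H \<and> leaves H \<subseteq> verts_of Bullet H} // {(G, H). dgraph_iso G H}"

definition class_rep :: "nat dgraph set \<Rightarrow> nat dgraph" where
  "class_rep c = (SOME H. H \<in> c)"

definition Xi :: "real \<Rightarrow> real \<Rightarrow> real \<Rightarrow> 'v dgraph \<Rightarrow> real" where
  "Xi lam \<mu> \<rho> H =
     lam ^ card (edges_of Bullet H) * \<mu> ^ card (edges_of Circ H) * \<rho> ^ card (diff_verts H)"

definition beta_J :: "real \<Rightarrow> real \<Rightarrow> real \<Rightarrow> nat \<Rightarrow> real" where
  "beta_J lam \<mu> \<rho> l =
     (\<Sum>c\<in>JJ l. (Xi lam \<mu> \<rho> (class_rep c))\<^sup>2 / real (card (Aut (class_rep c))))"

text \<open>An edge \<open>e = {i, j}\<close> with \<open>i < j\<close> is read as the entry at \<open>(i, j)\<close>; the matrices below are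
  symmetric.\<close>

definition f_stat :: "nat dgraph \<Rightarrow> (nat \<Rightarrow> nat \<Rightarrow> real) \<Rightarrow> (nat \<Rightarrow> nat \<Rightarrow> real) \<Rightarrow> real" where
  "f_stat S X Y =
     (\<Prod>e\<in>edges_of Bullet S. X (Min e) (Max e)) * (\<Prod>e\<in>edges_of Circ S. Y (Min e) (Max e))"

definition Phi_J :: "real \<Rightarrow> real \<Rightarrow> real \<Rightarrow> nat \<Rightarrow> nat \<Rightarrow>
    (nat \<Rightarrow> nat \<Rightarrow> real) \<Rightarrow> (nat \<Rightarrow> nat \<Rightarrow> real) \<Rightarrow> nat \<Rightarrow> nat \<Rightarrow> real" where
  "Phi_J lam \<mu> \<rho> n l X Y u v =
     1 / (real n powr (real l / 2 - 1) * beta_J lam \<mu> \<rho> l) *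
     (\<Sum>c\<in>JJ l. Xi lam \<mu> \<rho> (class_rep c) *
        (\<Sum>S | S \<in> decorated_subgraphs_K n \<and> dgraph_iso S (class_rep c) \<and> leaves S = {u, v}.
           f_stat S X Y))"

definition x_hat :: "real \<Rightarrow> real \<Rightarrow> real \<Rightarrow> nat \<Rightarrow> nat \<Rightarrow> real \<Rightarrow> nat \<Rightarrow>
    (nat \<Rightarrow> nat \<Rightarrow> real) \<Rightarrow> (nat \<Rightarrow> nat \<Rightarrow> real) \<Rightarrow> nat \<Rightarrow> real" where
  "x_hat lam \<mu> \<rho> n l R w X Y u =
     (let p = Phi_J lam \<mu> \<rho> n l X Y w u in if \<bar>p\<bar> \<le> R ^ 4 then p else 0)"

text \<open>A vector of dimension \<open>n\<close> is a function read on \<open>{1..n}\<close>. The value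
  is \<open>0\<close> when a norm vanishes.\<close>

definition abs_cosine :: "nat \<Rightarrow> (nat \<Rightarrow> real) \<Rightarrow> (nat \<Rightarrow> real) \<Rightarrow> real" where
  "abs_cosine n a b = \<bar>\<Sum>i\<in>{1..n}. a i * b i\<bar> / (L2_set a {1..n} * L2_set b {1..n})"

definition correlated_prior :: "real \<Rightarrow> real \<Rightarrow> (real \<times> real) measure \<Rightarrow> bool" where
  "correlated_prior \<rho> C \<pi> \<longleftrightarrow> prob_space \<pi> \<and> sets \<pi> = sets borel \<and>
     integrable \<pi> (\<lambda>p. fst p ^ 4) \<and> integrable \<pi> (\<lambda>p. snd p ^ 4) \<and>
     (\<integral>p. fst p \<partial>\<pi>) = 0 \<and> (\<integral>p. snd p \<partial>\<pi>) = 0 \<and>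
     (\<integral>p. (fst p)\<^sup>2 \<partial>\<pi>) = 1 \<and> (\<integral>p. (snd p)\<^sup>2 \<partial>\<pi>) = 1 \<and>
     (\<integral>p. fst p * snd p \<partial>\<pi>) = \<rho> \<and>
     (\<integral>p. fst p ^ 4 \<partial>\<pi>) \<le> C \<and> (\<integral>p. snd p ^ 4 \<partial>\<pi>) \<le> C"

text \<open>Law of the entries on and above the diagonal; note that \<open>normal_density\<close> takes the standard
  deviation.\<close>

definition wigner_law :: "nat \<Rightarrow> (nat \<times> nat \<Rightarrow> real) measure" where
  "wigner_law n = (\<Pi>\<^sub>M (i, j) \<in> {(i, j). 1 \<le> i \<and> i \<le> j \<and> j \<le> n}.
     density lborel (\<lambda>t. ennreal (normal_density 0 (sqrt (1 + of_bool (i = j))) t)))"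

type_synonym sample = "(nat \<Rightarrow> real \<times> real) \<times> (nat \<times> nat \<Rightarrow> real) \<times> (nat \<times> nat \<Rightarrow> real)"

text \<open>A sample consists of the pairs \<open>(x\<^sub>i, y\<^sub>i)\<close> and the upper triangles of \<open>W\<close> and \<open>Z\<close>.\<close>

definition PP :: "(real \<times> real) measure \<Rightarrow> nat \<Rightarrow> sample measure" where
  "PP \<pi> n = (\<Pi>\<^sub>M i\<in>{1..n}. \<pi>) \<Otimes>\<^sub>M (wigner_law n \<Otimes>\<^sub>M wigner_law n)"

definition x_vec :: "sample \<Rightarrow> nat \<Rightarrow> real" where
  "x_vec \<omega> i = fst (fst \<omega> i)"

definition y_vec :: "sample \<Rightarrow> nat \<Rightarrow> real" where
  "y_vec \<omega> i = snd (fst \<omega> i)"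

definition W_mat :: "sample \<Rightarrow> nat \<Rightarrow> nat \<Rightarrow> real" where
  "W_mat \<omega> i j = fst (snd \<omega>) (min i j, max i j)"

definition Z_mat :: "sample \<Rightarrow> nat \<Rightarrow> nat \<Rightarrow> real" where
  "Z_mat \<omega> i j = snd (snd \<omega>) (min i j, max i j)"

definition X_mat :: "real \<Rightarrow> nat \<Rightarrow> sample \<Rightarrow> nat \<Rightarrow> nat \<Rightarrow> real" where
  "X_mat lam n \<omega> i j = lam / sqrt (real n) * x_vec \<omega> i * x_vec \<omega> j + W_mat \<omega> i j"

definition Y_mat :: "real \<Rightarrow> nat \<Rightarrow> sample \<Rightarrow> nat \<Rightarrow> nat \<Rightarrow> real" where
  "Y_mat \<mu> n \<omega> i j = \<mu> / sqrt (real n) * y_vec \<omega> i * y_vec \<omega> j + Z_mat \<omega> i j"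

end

theory Submission
  imports Defs
begin

text \<open>
  A path with leaves \<open>u\<close>, \<open>v\<close> is a vertex sequence from \<open>u\<close> to \<open>v\<close> with a word of decorations that starts
  and ends with \<open>Bullet\<close>. Up to a factor of at most 4, \<open>\<beta>\<close> is the sum of the squared word weights, which is
  of order \<open>A\<^sub>+ ^ l\<close> because \<open>A\<^sub>+\<close> is the Perron eigenvalue of the transfer matrix of the words.

  For the second moment, fix one path and let the second one run over all walks, keeping track of the
  common edges whose noise variables are matched. After normalisation a step to a fresh vertex carries
  one factor of the transfer matrix, a landing on the fixed path costs \<open>1 / n\<close>, and a run of \<open>k\<close> matched
  edges costs \<open>A\<^sub>+ ^ (-k)\<close> relative to \<open>k\<close> fresh steps. Since \<open>A\<^sub>+ > 1\<close> and \<open>l\<^sup>2 / n\<close> is bounded, a potential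
  function shows that the sum over all walks is \<open>O(A\<^sub>+ ^ l)\<close>, uniformly in the fixed path. At each vertex
  at most four coordinates of the prior are multiplied, so fourth moments suffice.

  By a first moment computation \<open>E[\<Phi> x\<^sub>w x\<^sub>u]\<close> is bounded below, and the truncation at \<open>R ^ 4\<close> loses only
  \<open>R powr (-3)\<close>. Hence \<open>E[\<langle>xhat, x\<rangle> x\<^sub>w]\<close> is at least of order \<open>n\<close>, while \<open>\<parallel>xhat\<parallel> \<le> R ^ 4 sqrt n\<close>; the inequality of
  arithmetic and geometric means then bounds the expected cosine from below.
\<close>

subsection \<open>Decorated paths\<close>

text \<open>A change of decoration costs \<open>\<rho>\<close> twice, once in the coefficient
  \<open>Xi\<close> and once in the mixed moment of the prior; hence the entries
  \<open>\<rho>\<^sup>2\<close> of the transfer matrix, whose larger eigenvalue is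
  \<open>A_plus\<close>. The obstacle in the second moment is that two paths may meet, part and meet
  again in any order, the second one running either way along the first. The bound is deliberately
  asymmetric: the fixed path carries its full squared weight. Summing these squares gives one factor
  \<open>beta_J\<close>, the walk sum is at most of the same order, and both cancel against the
  normalisation. The statistic at \<open>w\<close>, \<open>u\<close> estimates the product of the
  entries of \<open>x\<close> at \<open>w\<close> and \<open>u\<close>, which is why the inner
  product is tested against \<open>x_vec \<omega> w\<close>. \<open>R\<close> and the final lower
  bound precede the prior and \<open>l\<close> in the quantifiers, so every constant is kept
  explicit.\<close>

lemma UNIV_decoration: "UNIV = {Bullet, Circ}"
  using decoration.exhaust by blast

lemma finite_decoration [simp]: "finite (A :: decoration set)"
proof (rule finite_subset)
  show "A \<subseteq> {Bullet, Circ}" using UNIV_decoration by (metis subset_UNIV)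
qed simp

definition dpath :: "nat \<Rightarrow> 'v list \<Rightarrow> decoration list \<Rightarrow> bool" where
  "dpath l s w \<longleftrightarrow> length s = Suc l \<and> distinct s \<and> length w = l"

text \<open>\<open>map_of\<close> keeps the first of several bindings of a key. For a
  \<open>dpath\<close> the edges are distinct, so each edge receives the letter at its own
  position.\<close>

definition path_graph :: "'v list \<Rightarrow> decoration list \<Rightarrow> 'v dgraph" where
  "path_graph s w =
     \<lparr>verts = set s, deco = map_of (zip (map (\<lambda>i. {s ! i, s ! Suc i}) [0..<length w]) w)\<rparr>"

lemma verts_path_graph [simp]: "verts (path_graph s w) = set s"
  by (simp add: path_graph_def)

lemma nth_eq_dpath: "dpath l s w \<Longrightarrow> i \<le> l \<Longrightarrow> j \<le> l \<Longrightarrow> s ! i = s ! j \<longleftrightarrow> i = j"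
  by (simp add: dpath_def nth_eq_iff_index_eq)

lemma path_edge_eq_iff:
  assumes "dpath l s w" "i < l" "j < l"
  shows "{s ! i, s ! Suc i} = {s ! j, s ! Suc j} \<longleftrightarrow> i = j"
  using assms by (auto simp: doubleton_eq_iff nth_eq_dpath)

lemma deco_path_graph:
  assumes "dpath l s w" "i < l"
  shows "deco (path_graph s w) {s ! i, s ! Suc i} = Some (w ! i)"
proof -
  let ?es = "map (\<lambda>i. {s ! i, s ! Suc i}) [0..<length w]"
  have len: "length w = l" using assms by (simp add: dpath_def)
  have "distinct ?es"
    using path_edge_eq_iff[OF assms(1)] len by (auto simp: distinct_map inj_on_def)
  then have "map_of (zip ?es w) (?es ! i) = Some (w ! i)"
    using assms(2) len by (intro map_of_zip_nth) auto
  then show ?thesis using assms(2) len by (simp add: path_graph_def)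
qed

lemma edges_path_graph:
  assumes "dpath l s w"
  shows "edges (path_graph s w) = (\<lambda>i. {s ! i, s ! Suc i}) ` {..<l}"
  using assms by (auto simp: edges_def path_graph_def dpath_def)

lemma deco_path_graph_eq_Some_iff:
  assumes "dpath l s w"
  shows "deco (path_graph s w) e = Some d \<longleftrightarrow> (\<exists>i<l. e = {s ! i, s ! Suc i} \<and> w ! i = d)"
proof
  assume e: "deco (path_graph s w) e = Some d"
  then have "e \<in> edges (path_graph s w)" by (auto simp: edges_def)
  then obtain i where i: "i < l" "e = {s ! i, s ! Suc i}"
    using edges_path_graph[OF assms] by auto
  then show "\<exists>i<l. e = {s ! i, s ! Suc i} \<and> w ! i = d"
    using e deco_path_graph[OF assms i(1)] by auto
qed (use deco_path_graph[OF assms] in auto)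

lemma edges_of_path_graph:
  assumes "dpath l s w"
  shows "edges_of d (path_graph s w) = (\<lambda>i. {s ! i, s ! Suc i}) ` {i. i < l \<and> w ! i = d}"
  using deco_path_graph_eq_Some_iff[OF assms] by (auto simp: edges_of_def)

lemma inj_on_path_edges:
  assumes "dpath l s w"
  shows "inj_on (\<lambda>i. {s ! i, s ! Suc i}) {..<l}"
  using path_edge_eq_iff[OF assms] by (auto simp: inj_on_def)

lemma decorated_graph_path_graph:
  assumes "dpath l s w"
  shows "decorated_graph (path_graph s w)"
proof -
  have "card {s ! i, s ! Suc i} = 2" if "i < l" for i
    using nth_eq_dpath[OF assms, of i "Suc i"] that by simp
  then show ?thesis
    using assms by (auto simp: decorated_graph_def edges_path_graph[OF assms] dpath_def)
qed

lemma decorated_path_path_graph: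
  assumes "dpath l s w"
  shows "decorated_path l (path_graph s w)"
  unfolding decorated_path_def
  using decorated_graph_path_graph[OF assms] edges_path_graph[OF assms] assms
  by (auto simp: dpath_def intro!: exI[of _ s])

text \<open>The word is read off the graph along the vertex sequence. This normal form replaces
  graphs by pairs of a sequence and a word.\<close>

lemma decorated_path_iff:
  "decorated_path l H \<longleftrightarrow> (\<exists>s w. dpath l s w \<and> H = path_graph s w)"
proof
  assume "decorated_path l H"
  then obtain s where dg: "decorated_graph H" and s: "length s = Suc l" "distinct s" "verts H = set s"
      "edges H = {{s ! i, s ! Suc i} | i. i < l}"
    by (auto simp: decorated_path_def)
  define w where "w = map (\<lambda>i. the (deco H {s ! i, s ! Suc i})) [0..<l]"
  have p: "dpath l s w" using s by (simp add: dpath_def w_def)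
  have "deco H e = deco (path_graph s w) e" for e
  proof (cases "e \<in> edges H")
    case True
    then obtain i where i: "i < l" "e = {s ! i, s ! Suc i}" using s by auto
    have "deco H e = Some (w ! i)" using True i by (auto simp: edges_def w_def)
    then show ?thesis using deco_path_graph[OF p i(1)] i by simp
  next
    case False
    then have "e \<notin> edges (path_graph s w)" using edges_path_graph[OF p] s by auto
    then show ?thesis using False by (simp add: edges_def domIff)
  qed
  then have "H = path_graph s w" using s by (intro dgraph.equality) auto
  then show "\<exists>s w. dpath l s w \<and> H = path_graph s w" using p by blast
qed (use decorated_path_path_graph in auto)

text \<open>The edges at position \<open>j\<close> are those with index \<open>j - 1\<close> and
  \<open>j\<close>; both exist except at the two ends, where one is left.\<close>

lemma leaves_path_graph:
  assumes "dpath l s w" "0 < l"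
  shows "leaves (path_graph s w) = {s ! 0, s ! l}"
proof -
  have deg: "card {e \<in> edges (path_graph s w). s ! j \<in> e} = card {i. i < l \<and> (i = j \<or> Suc i = j)}"
    if "j \<le> l" for j
  proof -
    have "{e \<in> edges (path_graph s w). s ! j \<in> e} =
        (\<lambda>i. {s ! i, s ! Suc i}) ` {i. i < l \<and> (i = j \<or> Suc i = j)}"
      using that by (auto simp: edges_path_graph[OF assms(1)] nth_eq_dpath[OF assms(1)])
    moreover have "inj_on (\<lambda>i. {s ! i, s ! Suc i}) {i. i < l \<and> (i = j \<or> Suc i = j)}"
      by (rule inj_on_subset[OF inj_on_path_edges[OF assms(1)]]) auto
    ultimately show ?thesis by (simp add: card_image)
  qed
  have "card {i. i < l \<and> (i = j \<or> Suc i = j)} = 1 \<longleftrightarrow> j = 0 \<or> j = l" if "j \<le> l" for j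
  proof -
    consider "j = 0" | "j = l" "j \<noteq> 0" | "0 < j" "j < l" using \<open>j \<le> l\<close> by linarith
    then show ?thesis
    proof cases
      case 1
      then have "{i. i < l \<and> (i = j \<or> Suc i = j)} = {0}" using assms by auto
      then show ?thesis using 1 by simp
    next
      case 2
      then have "{i. i < l \<and> (i = j \<or> Suc i = j)} = {l - 1}" by auto
      then show ?thesis using 2 by simp
    next
      case 3
      then have "{i. i < l \<and> (i = j \<or> Suc i = j)} = {j - 1, j}" by auto
      then show ?thesis using 3 by simp
    qed
  qed
  then have "card {e \<in> edges (path_graph s w). s ! j \<in> e} = 1 \<longleftrightarrow> j = 0 \<or> j = l" if "j \<le> l" for j
    using deg that by simp
  moreover have "x \<in> set s \<longleftrightarrow> (\<exists>j\<le>l. x = s ! j)" for x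
    using assms by (auto simp: dpath_def in_set_conv_nth less_Suc_eq_le)
  ultimately show ?thesis by (auto simp: leaves_def)
qed

lemma nth_in_verts_of_path_graph:
  assumes "dpath l s w" "j \<le> l"
  shows "s ! j \<in> verts_of d (path_graph s w) \<longleftrightarrow>
    (j < l \<and> w ! j = d) \<or> (0 < j \<and> w ! (j - 1) = d)"
proof -
  have "s ! j \<in> verts_of d (path_graph s w) \<longleftrightarrow> (\<exists>i<l. w ! i = d \<and> (i = j \<or> Suc i = j))"
    using nth_eq_dpath[OF assms(1)] assms(2) Suc_le_eq less_imp_le
    by (auto simp: verts_of_def edges_of_path_graph[OF assms(1)])
  also have "\<dots> \<longleftrightarrow> (j < l \<and> w ! j = d) \<or> (0 < j \<and> w ! (j - 1) = d)"
    using assms(2) by (cases j) (auto dest: Suc_le_lessD)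
  finally show ?thesis .
qed

lemma leaves_subset_Bullet_iff:
  assumes "dpath l s w" "0 < l"
  shows "leaves (path_graph s w) \<subseteq> verts_of Bullet (path_graph s w) \<longleftrightarrow>
    w ! 0 = Bullet \<and> w ! (l - 1) = Bullet"
  using nth_in_verts_of_path_graph[OF assms(1), of 0 Bullet]
    nth_in_verts_of_path_graph[OF assms(1), of l Bullet] assms(2)
  by (simp add: leaves_path_graph[OF assms])

definition edge_weight :: "real \<Rightarrow> real \<Rightarrow> decoration \<Rightarrow> real" where
  "edge_weight lam \<mu> d = (case d of Bullet \<Rightarrow> lam | Circ \<Rightarrow> \<mu>)"

definition change :: "real \<Rightarrow> decoration list \<Rightarrow> nat \<Rightarrow> real" where
  "change \<rho> w i = (if w ! (i - 1) = w ! i then 1 else \<rho>)"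

definition word_weight :: "real \<Rightarrow> real \<Rightarrow> real \<Rightarrow> decoration list \<Rightarrow> real" where
  "word_weight lam \<mu> \<rho> w = (\<Prod>i<length w. edge_weight lam \<mu> (w ! i)) * (\<Prod>i\<in>{1..<length w}. change \<rho> w i)"

lemma Xi_path_graph:
  assumes "dpath l s w"
  shows "Xi lam \<mu> \<rho> (path_graph s w) = word_weight lam \<mu> \<rho> w"
proof -
  have len: "length w = l" using assms by (simp add: dpath_def)
  have card_of: "card (edges_of d (path_graph s w)) = card {i. i < l \<and> w ! i = d}" for d
    unfolding edges_of_path_graph[OF assms]
    by (intro card_image inj_on_subset[OF inj_on_path_edges[OF assms]]) auto
  have "(\<Prod>i<l. edge_weight lam \<mu> (w ! i)) =
      (\<Prod>i<l. (if w ! i = Bullet then lam else 1) * (if w ! i = Circ then \<mu> else 1))"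
  proof (intro prod.cong refl)
    fix i show "edge_weight lam \<mu> (w ! i) = (if w ! i = Bullet then lam else 1) * (if w ! i = Circ then \<mu> else 1)"
      by (cases "w ! i") (simp_all add: edge_weight_def)
  qed
  also have "\<dots> = (\<Prod>i\<in>{i. i < l \<and> w ! i = Bullet}. lam) * (\<Prod>i\<in>{i. i < l \<and> w ! i = Circ}. \<mu>)"
  proof -
    have "(\<Prod>i<l. if w ! i = d then c else 1) = (\<Prod>i\<in>{i. i < l \<and> w ! i = d}. c)" for d and c :: real
      using prod.inter_filter[of "{..<l}" "\<lambda>_. c" "\<lambda>i. w ! i = d"] by simp
    then show ?thesis by (simp add: prod.distrib)
  qed
  finally have 1: "(\<Prod>i<l. edge_weight lam \<mu> (w ! i)) =
      lam ^ card (edges_of Bullet (path_graph s w)) * \<mu> ^ card (edges_of Circ (path_graph s w))"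
    by (simp add: card_of)
  \<comment> \<open>A vertex is in \<open>diff_verts\<close> exactly when it is interior and its two
    edges carry different letters, so \<open>\<rho>\<close> is counted once per change inside the
    word.\<close>
  have "x \<in> set s" if "x \<in> verts_of d (path_graph s w)" for x d
    using that decorated_graph_path_graph[OF assms]
    by (auto simp: decorated_graph_def verts_of_def edges_of_def edges_def)
  then have "diff_verts (path_graph s w) = {x \<in> set s. x \<in> diff_verts (path_graph s w)}"
    by (auto simp: diff_verts_def)
  also have "\<dots> = (\<lambda>j. s ! j) ` {j. j \<le> l \<and> s ! j \<in> diff_verts (path_graph s w)}"
    using assms by (auto simp: dpath_def in_set_conv_nth less_Suc_eq_le)
  also have "{j. j \<le> l \<and> s ! j \<in> diff_verts (path_graph s w)} = {j \<in> {1..<l}. w ! (j - 1) \<noteq> w ! j}"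
    by (auto simp: diff_verts_def nth_in_verts_of_path_graph[OF assms]) (metis decoration.exhaust)+
  finally have "card (diff_verts (path_graph s w)) = card {j \<in> {1..<l}. w ! (j - 1) \<noteq> w ! j}"
    by (simp add: card_image inj_on_def nth_eq_dpath[OF assms])
  moreover have "(\<Prod>i\<in>{1..<l}. change \<rho> w i) = (\<Prod>i\<in>{j \<in> {1..<l}. w ! (j - 1) \<noteq> w ! j}. \<rho>)"
    by (subst prod.inter_filter) (auto intro!: prod.cong simp: change_def)
  ultimately have 2: "(\<Prod>i\<in>{1..<l}. change \<rho> w i) = \<rho> ^ card (diff_verts (path_graph s w))"
    by simp
  show ?thesis unfolding Xi_def word_weight_def len 1 2 ..
qed

subsection \<open>Isomorphism classes of decorated paths\<close>

lemma option_eqI: "(\<And>d. x = Some d \<longleftrightarrow> y = Some d) \<Longrightarrow> x = y"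
  by (cases x; cases y) auto

lemma dpath_map:
  assumes "dpath l s w" "inj_on \<phi> (set s)"
  shows "dpath l (map \<phi> s) w"
  using assms by (simp add: dpath_def distinct_map)

text \<open>\<open>is_dgraph_iso\<close> controls \<open>deco H\<close> only on pairs of vertices.
  Well-formedness of \<open>H\<close> makes every edge such a pair, which excludes further edges and
  determines \<open>H\<close> completely.\<close>

lemma iso_image_path_graph:
  assumes s: "dpath l s w" and H: "decorated_graph H" and iso: "is_dgraph_iso \<phi> (path_graph s w) H"
  shows "H = path_graph (map \<phi> s) w" "dpath l (map \<phi> s) w"
proof -
  have bij: "bij_betw \<phi> (set s) (verts H)"
    and dec: "\<And>a b. a \<in> set s \<Longrightarrow> b \<in> set s \<Longrightarrow> deco H {\<phi> a, \<phi> b} = deco (path_graph s w) {a, b}"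
    using iso by (auto simp: is_dgraph_iso_def)
  show p: "dpath l (map \<phi> s) w" using s bij by (intro dpath_map) (auto simp: bij_betw_def)
  have "deco H e = deco (path_graph (map \<phi> s) w) e" for e
  proof (rule option.expand)
    show "(deco H e = None) = (deco (path_graph (map \<phi> s) w) e = None)"
    proof
      assume *: "deco (path_graph (map \<phi> s) w) e = None"
      show "deco H e = None"
      proof (rule ccontr)
        assume "deco H e \<noteq> None"
        then have "e \<in> edges H" by (auto simp: edges_def)
        then have e: "e \<subseteq> verts H" "card e = 2" using H by (auto simp: decorated_graph_def)
        then obtain x y where xy: "e = {x, y}" "x \<in> verts H" "y \<in> verts H"
          by (auto simp: card_2_iff)
        moreover have "verts H = \<phi> ` set s" using bij by (simp add: bij_betw_def)
        ultimately obtain a b where "a \<in> set s" "x = \<phi> a" "b \<in> set s" "y = \<phi> b"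
          by auto
        then have ab: "a \<in> set s" "b \<in> set s" "e = {\<phi> a, \<phi> b}" using xy(1) by simp_all
        obtain d where "deco (path_graph s w) {a, b} = Some d"
          using dec[OF ab(1,2)] ab(3) \<open>deco H e \<noteq> None\<close> by auto
        then obtain i where i: "i < l" "{a, b} = {s ! i, s ! Suc i}"
          using deco_path_graph_eq_Some_iff[OF s] by auto
        have "e = \<phi> ` {a, b}" using ab(3) by simp
        then have "e = \<phi> ` {s ! i, s ! Suc i}" using i(2) by metis
        then have "e = {map \<phi> s ! i, map \<phi> s ! Suc i}" using i s by (simp add: dpath_def)
        then show False using deco_path_graph[OF p i(1)] * by simp
      qed
    next
      assume *: "deco H e = None"
      show "deco (path_graph (map \<phi> s) w) e = None"
      proof (rule ccontr)
        assume "deco (path_graph (map \<phi> s) w) e \<noteq> None"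
        then obtain i where i: "i < l" "e = {map \<phi> s ! i, map \<phi> s ! Suc i}"
          using deco_path_graph_eq_Some_iff[OF p] by auto
        then have "deco H e = deco (path_graph s w) {s ! i, s ! Suc i}"
          using dec[of "s ! i" "s ! Suc i"] s by (simp add: dpath_def)
        then show False using deco_path_graph[OF s i(1)] * by simp
      qed
    qed
  next
    assume "deco (path_graph (map \<phi> s) w) e \<noteq> None"
    then obtain d where d: "deco (path_graph (map \<phi> s) w) e = Some d" by blast
    then obtain i where i: "i < l" "e = {map \<phi> s ! i, map \<phi> s ! Suc i}" "w ! i = d"
      using deco_path_graph_eq_Some_iff[OF p] by auto
    then have "deco H e = deco (path_graph s w) {s ! i, s ! Suc i}"
      using dec[of "s ! i" "s ! Suc i"] s by (simp add: dpath_def)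
    then show "the (deco H e) = the (deco (path_graph (map \<phi> s) w) e)"
      using deco_path_graph[OF s i(1)] d i by simp
  qed
  moreover have "verts H = \<phi> ` set s" using bij by (simp add: bij_betw_def)
  ultimately show "H = path_graph (map \<phi> s) w" by (intro dgraph.equality) auto
qed

lemma dgraph_iso_path_graph:
  assumes s: "dpath l s w" and t: "dpath l t w"
  shows "dgraph_iso (path_graph s w) (path_graph t w)"
proof -
  define \<phi> where "\<phi> = (\<lambda>x. the (map_of (zip s t) x))"
  have \<phi>: "\<phi> (s ! i) = t ! i" if "i \<le> l" for i
    using s t that map_of_zip_nth[of s t i] by (simp add: \<phi>_def dpath_def)
  have m: "map \<phi> s = t"
    using s t \<phi> by (intro nth_equalityI) (auto simp: dpath_def)
  have bij: "bij_betw \<phi> (set s) (set t)"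
    using m s t by (metis bij_betw_def distinct_map dpath_def set_map)
  have "deco (path_graph t w) {\<phi> a, \<phi> b} = Some d \<longleftrightarrow> deco (path_graph s w) {a, b} = Some d"
    if "a \<in> set s" "b \<in> set s" for a b d
  proof -
    have "{\<phi> a, \<phi> b} = {t ! i, t ! Suc i} \<longleftrightarrow> {a, b} = {s ! i, s ! Suc i}" if i: "i < l" for i
    proof -
      have ab: "{a, b} \<subseteq> set s" using \<open>a \<in> set s\<close> \<open>b \<in> set s\<close> by simp
      have "{t ! i, t ! Suc i} = \<phi> ` {s ! i, s ! Suc i}" using \<phi> i by simp
      moreover have "{s ! i, s ! Suc i} \<subseteq> set s" using s i by (simp add: dpath_def)
      moreover have "{\<phi> a, \<phi> b} = \<phi> ` {a, b}" by simp
      ultimately show ?thesis using ab bij by (metis bij_betw_def inj_on_image_eq_iff)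
    qed
    then show ?thesis
      unfolding deco_path_graph_eq_Some_iff[OF s] deco_path_graph_eq_Some_iff[OF t]
      by (intro ex_cong1 conj_cong refl) simp_all
  qed
  note dec_iff = this
  have "deco (path_graph t w) {\<phi> a, \<phi> b} = deco (path_graph s w) {a, b}"
    if "a \<in> set s" "b \<in> set s" for a b
    by (rule option_eqI) (use that in \<open>simp add: dec_iff\<close>)
  then show ?thesis
    using bij decorated_graph_path_graph[OF s] decorated_graph_path_graph[OF t]
    by (auto simp: dgraph_iso_def is_dgraph_iso_def)
qed

lemma dgraph_iso_path_graph_iff:
  assumes "dpath l s w"
  shows "dgraph_iso (path_graph s w) H \<longleftrightarrow> (\<exists>t. dpath l t w \<and> H = path_graph t w)"
proof
  assume "dgraph_iso (path_graph s w) H"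
  then obtain \<phi> where "decorated_graph H" "is_dgraph_iso \<phi> (path_graph s w) H"
    by (auto simp: dgraph_iso_def)
  from iso_image_path_graph[OF assms this] show "\<exists>t. dpath l t w \<and> H = path_graph t w" by metis
next
  assume "\<exists>t. dpath l t w \<and> H = path_graph t w"
  then obtain t where "dpath l t w" "H = path_graph t w" by (elim exE conjE)
  then show "dgraph_iso (path_graph s w) H" using dgraph_iso_path_graph[OF assms, of t] by simp
qed

text \<open>By strong induction, the edge of \<open>t\<close> leaving position \<open>k\<close> is
  an edge of \<open>s\<close> at the common vertex there. It is the next edge of \<open>s\<close> or
  the previous one; the previous one would lead \<open>t\<close> back to its position
  \<open>k - 1\<close>, against distinctness.\<close>

lemma path_edges_start_unique:
  assumes s: "dpath l s w" and t: "dpath l t w'"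
    and eq: "(\<lambda>i. {s ! i, s ! Suc i}) ` {..<l} = (\<lambda>i. {t ! i, t ! Suc i}) ` {..<l}"
    and start: "s ! 0 = t ! 0"
  shows "s = t"
proof -
  have "s ! i = t ! i" if "i \<le> l" for i
    using that
  proof (induction i rule: less_induct)
    case (less i)
    show ?case
    proof (cases i)
      case 0
      then show ?thesis using start by simp
    next
      case (Suc k)
      then have k: "k < l" using less by simp
      have sk: "s ! k = t ! k" using less.IH[of k] Suc k by simp
      have "{t ! k, t ! Suc k} \<in> (\<lambda>i. {s ! i, s ! Suc i}) ` {..<l}"
        unfolding eq using k by (intro imageI) simp
      then obtain j where j: "j < l" "{t ! k, t ! Suc k} = {s ! j, s ! Suc j}"
        by (elim imageE) simp
      then consider "s ! j = s ! k" "t ! Suc k = s ! Suc j" | "s ! Suc j = s ! k" "t ! Suc k = s ! j"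
        using sk by (auto simp: doubleton_eq_iff)
      then show ?thesis
      proof cases
        case 1
        then show ?thesis using nth_eq_dpath[OF s, of j k] j k Suc by simp
      next
        case 2
        then have "Suc j = k" using nth_eq_dpath[OF s, of "Suc j" k] j k by simp
        then have "t ! j = s ! j" using less.IH[of j] Suc k by simp
        then have "t ! Suc k = t ! j" using 2 by simp
        then show ?thesis using nth_eq_dpath[OF t, of "Suc k" j] \<open>Suc j = k\<close> k by simp
      qed
    qed
  qed
  then show ?thesis using s t by (intro nth_equalityI) (auto simp: dpath_def)
qed

lemma path_graph_start_unique:
  assumes s: "dpath l s w" and t: "dpath l t w'" and eq: "path_graph s w = path_graph t w'"
    and start: "s ! 0 = t ! 0"
  shows "s = t \<and> w = w'"
proof -
  have "(\<lambda>i. {s ! i, s ! Suc i}) ` {..<l} = (\<lambda>i. {t ! i, t ! Suc i}) ` {..<l}"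
    using edges_path_graph[OF s] edges_path_graph[OF t] eq by simp
  then have st: "s = t" using path_edges_start_unique[OF s t] start by simp
  have "w ! i = w' ! i" if "i < l" for i
    using deco_path_graph[OF s that] deco_path_graph[OF t that] st eq by simp
  then show ?thesis using st s t by (auto simp: dpath_def intro: nth_equalityI)
qed

lemma dpath_rev:
  assumes "dpath l s w" shows "dpath l (rev s) (rev w)"
  using assms by (simp add: dpath_def)

lemma path_graph_rev:
  assumes s: "dpath l s w" shows "path_graph (rev s) (rev w) = path_graph s w"
proof -
  have r: "dpath l (rev s) (rev w)" using s by (rule dpath_rev)
  have "deco (path_graph (rev s) (rev w)) {s ! i, s ! Suc i} = Some (w ! i)" if i: "i < l" for i
  proof -
    have "rev s ! (l - Suc i) = s ! Suc i" "rev s ! Suc (l - Suc i) = s ! i" "rev w ! (l - Suc i) = w ! i"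
      using s i by (auto simp: dpath_def rev_nth Suc_diff_Suc)
    then show ?thesis using deco_path_graph[OF r, of "l - Suc i"] i by (simp add: insert_commute)
  qed
  then have 1: "deco (path_graph s w) e = Some d \<Longrightarrow> deco (path_graph (rev s) (rev w)) e = Some d" for e d
    using deco_path_graph_eq_Some_iff[OF s] by auto
  have "deco (path_graph s w) {rev s ! i, rev s ! Suc i} = Some (rev w ! i)" if i: "i < l" for i
  proof -
    have "rev s ! i = s ! Suc (l - Suc i)" "rev s ! Suc i = s ! (l - Suc i)" "rev w ! i = w ! (l - Suc i)"
      using s i by (auto simp: dpath_def rev_nth Suc_diff_Suc)
    then show ?thesis using deco_path_graph[OF s, of "l - Suc i"] i by (simp add: insert_commute)
  qed
  then have 2: "deco (path_graph (rev s) (rev w)) e = Some d \<Longrightarrow> deco (path_graph s w) e = Some d" for e d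
    using deco_path_graph_eq_Some_iff[OF r] by auto
  have "deco (path_graph (rev s) (rev w)) e = deco (path_graph s w) e" for e
    by (rule option_eqI) (rule iffI[OF 2 1])
  then show ?thesis by (intro dgraph.equality) auto
qed

text \<open>Both sequences start at one of the two leaves, and a traversal is determined by its
  start.\<close>

lemma path_graph_eq_cases:
  assumes s: "dpath l s w" and t: "dpath l t w'" and eq: "path_graph s w = path_graph t w'" and "0 < l"
  shows "(s = t \<and> w = w') \<or> (s = rev t \<and> w = rev w')"
proof -
  have "s ! 0 \<in> {t ! 0, t ! l}"
    using leaves_path_graph[OF s \<open>0 < l\<close>] leaves_path_graph[OF t \<open>0 < l\<close>] eq by auto
  then show ?thesis
  proof
    assume "s ! 0 = t ! 0"
    then show ?thesis using path_graph_start_unique[OF s t eq] by simp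
  next
    assume "s ! 0 \<in> {t ! l}"
    then have "s ! 0 = rev t ! 0" using t by (simp add: dpath_def rev_nth)
    then show ?thesis
      using path_graph_start_unique[OF s dpath_rev[OF t]] path_graph_rev[OF t] eq by simp
  qed
qed

text \<open>An automorphism is determined by the image of \<open>s\<close>, and that image is again
  a traversal of the same graph, hence \<open>s\<close> or \<open>rev s\<close>.\<close>

lemma card_Aut_path_graph:
  assumes s: "dpath l s w" and "0 < l"
  shows "1 \<le> card (Aut (path_graph s w))" "card (Aut (path_graph s w)) \<le> 2"
proof -
  have fin: "finite (Aut (path_graph s w))"
    by (rule finite_subset[OF _ finite_PiE[of "set s" "\<lambda>_. set s"]]) (auto simp: Aut_def)
  have "restrict id (set s) \<in> Aut (path_graph s w)"
    by (auto simp: Aut_def is_dgraph_iso_def intro!: bij_betwI[where g = id])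
  then show "1 \<le> card (Aut (path_graph s w))" using fin
    by (metis One_nat_def Suc_leI card_gt_0_iff empty_iff)
  have inj: "inj_on (\<lambda>\<phi>. map \<phi> s) (Aut (path_graph s w))"
  proof (rule inj_onI)
    fix \<phi> \<psi> assume *: "\<phi> \<in> Aut (path_graph s w)" "\<psi> \<in> Aut (path_graph s w)" "map \<phi> s = map \<psi> s"
    show "\<phi> = \<psi>"
    proof (rule PiE_ext)
      show "\<phi> \<in> set s \<rightarrow>\<^sub>E set s" "\<psi> \<in> set s \<rightarrow>\<^sub>E set s" using *(1,2) by (simp_all add: Aut_def)
      show "\<And>x. x \<in> set s \<Longrightarrow> \<phi> x = \<psi> x" using *(3) by simp
    qed
  qed
  have "(\<lambda>\<phi>. map \<phi> s) ` Aut (path_graph s w) \<subseteq> {s, rev s}"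
  proof (rule image_subsetI)
    fix \<phi> assume "\<phi> \<in> Aut (path_graph s w)"
    then have "is_dgraph_iso \<phi> (path_graph s w) (path_graph s w)" by (simp add: Aut_def)
    from iso_image_path_graph[OF s decorated_graph_path_graph[OF s] this]
    show "map \<phi> s \<in> {s, rev s}"
      using path_graph_eq_cases[OF _ s _ \<open>0 < l\<close>, of "map \<phi> s" w] by auto
  qed
  from card_mono[OF _ this] have "card ((\<lambda>\<phi>. map \<phi> s) ` Aut (path_graph s w)) \<le> card {s, rev s}" by simp
  also have "\<dots> \<le> 2" by (simp add: card_insert_if)
  finally show "card (Aut (path_graph s w)) \<le> 2" using card_image[OF inj] by simp
qed

section \<open>Words, isomorphism classes and the size of \<open>beta_J\<close>\<close>

definition words :: "nat \<Rightarrow> decoration list set" where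
  "words l = {w. length w = l \<and> w ! 0 = Bullet \<and> w ! (l - 1) = Bullet}"

definition word_class :: "nat \<Rightarrow> decoration list \<Rightarrow> nat dgraph set" where
  "word_class l w = {path_graph t w | t. dpath l t w}"

lemma finite_words [simp]: "finite (words l)"
  by (rule finite_subset[OF _ finite_lists_length_eq[of UNIV l]]) (auto simp: words_def)

lemma dpath_upt: "length w = l \<Longrightarrow> dpath l [0..<Suc l] w"
  by (simp add: dpath_def)

lemma JJ_eq:
  assumes "0 < l"
  shows "JJ l = word_class l ` words l"
proof -
  have cls: "{(G, H). dgraph_iso G H} `` {path_graph s w} = word_class l w" if "dpath l s w" for s w
    using dgraph_iso_path_graph_iff[OF that] by (auto simp: word_class_def)
  have "{H :: nat dgraph. decorated_path l H \<and> leaves H \<subseteq> verts_of Bullet H} =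
      {path_graph s w | s w. dpath l s w \<and> w \<in> words l}"
    using leaves_subset_Bullet_iff[OF _ assms]
    by (auto simp: decorated_path_iff words_def dpath_def)
  then have "JJ l = {path_graph s w | s w. dpath l (s :: nat list) w \<and> w \<in> words l} //
      {(G, H). dgraph_iso G H}"
    by (simp only: JJ_def)
  also have "\<dots> = word_class l ` words l"
  proof (intro equalityI subsetI)
    fix c assume "c \<in> {path_graph s w | s w. dpath l (s :: nat list) w \<and> w \<in> words l} //
      {(G, H). dgraph_iso G H}"
    then obtain s w where p: "dpath l (s :: nat list) w" "w \<in> words l"
        "c = {(G, H). dgraph_iso G H} `` {path_graph s w}"
      by (elim quotientE) blast
    from p(3) have "c = word_class l w" unfolding cls[OF p(1)] .
    then show "c \<in> word_class l ` words l" using p(2) by simp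
  next
    fix c assume "c \<in> word_class l ` words l"
    then obtain w where w: "w \<in> words l" "c = word_class l w" by blast
    then have p: "dpath l [0..<Suc l] w" using dpath_upt[of w l] by (simp only: words_def mem_Collect_eq)
    have "c = {(G, H). dgraph_iso G H} `` {path_graph [0..<Suc l] w}" using cls[OF p] w by simp
    moreover have "path_graph [0..<Suc l] w \<in> {path_graph s w | s w. dpath l (s :: nat list) w \<and> w \<in> words l}"
      using p w(1) by blast
    ultimately show "c \<in> {path_graph s w | s w. dpath l (s :: nat list) w \<and> w \<in> words l} //
      {(G, H). dgraph_iso G H}"
      by (simp only: quotientI)
  qed
  finally show ?thesis .
qed

lemma class_rep_word_class:
  assumes "length w = l"
  shows "\<exists>t. dpath l t w \<and> class_rep (word_class l w) = path_graph t w"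
proof -
  have "path_graph [0..<Suc l] w \<in> word_class l w"
    using dpath_upt[OF assms] by (auto simp: word_class_def)
  then have "class_rep (word_class l w) \<in> word_class l w"
    unfolding class_rep_def by (rule someI)
  then show ?thesis by (auto simp: word_class_def)
qed

lemma word_class_eqD:
  assumes "word_class l w = word_class l w'" "length w = l" "0 < l"
  shows "w' = w \<or> w' = rev w"
proof -
  have "path_graph [0..<Suc l] w \<in> word_class l w'"
    using dpath_upt[OF assms(2)] assms(1) by (auto simp: word_class_def)
  then obtain t where t: "dpath l t w'" "path_graph [0..<Suc l] w = path_graph t w'"
    by (auto simp: word_class_def)
  then show ?thesis
    using path_graph_eq_cases[OF dpath_upt[OF assms(2)] t(1) t(2) assms(3)] by auto
qed

lemma Xi_class_rep:
  assumes "length w = l"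
  shows "Xi lam \<mu> \<rho> (class_rep (word_class l w)) = word_weight lam \<mu> \<rho> w"
  using class_rep_word_class[OF assms] Xi_path_graph by metis

text \<open>Two words give the same class only if they are equal or reverses of each other. A
  palindrome has a fibre of size 1 and two automorphisms, any other word a fibre of size 2 and one
  automorphism, so the true ratio is 2; bounding both counts between 1 and 2 is enough for the order
  of magnitude.\<close>

lemma beta_J_bounds:
  assumes "0 < l"
  shows "beta_J lam \<mu> \<rho> l \<le> (\<Sum>w\<in>words l. (word_weight lam \<mu> \<rho> w)\<^sup>2)"
    and "(\<Sum>w\<in>words l. (word_weight lam \<mu> \<rho> w)\<^sup>2) \<le> 4 * beta_J lam \<mu> \<rho> l"
proof -
  let ?x = "\<lambda>c. (Xi lam \<mu> \<rho> (class_rep c))\<^sup>2"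
  let ?a = "\<lambda>c. real (card (Aut (class_rep c)))"
  have x: "?x (word_class l w) = (word_weight lam \<mu> \<rho> w)\<^sup>2" if "w \<in> words l" for w
    using that Xi_class_rep by (simp add: words_def)
  have a: "1 \<le> ?a (word_class l w)" "?a (word_class l w) \<le> 2" if w: "w \<in> words l" for w
  proof -
    obtain t where "dpath l t w" "class_rep (word_class l w) = path_graph t w"
      using class_rep_word_class[of w l] w by (auto simp: words_def)
    then show "1 \<le> ?a (word_class l w)" "?a (word_class l w) \<le> 2"
      using card_Aut_path_graph[of l t w] assms by simp_all
  qed
  have "beta_J lam \<mu> \<rho> l \<le> (\<Sum>c\<in>word_class l ` words l. ?x c)"
    unfolding beta_J_def JJ_eq[OF assms]
  proof (intro sum_mono)
    fix c assume "c \<in> word_class l ` words l"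
    then have "1 \<le> ?a c" using a by auto
    then show "?x c / ?a c \<le> ?x c" using divide_left_mono[of 1 "?a c" "?x c"] by simp
  qed
  also have "\<dots> \<le> (\<Sum>w\<in>words l. ?x (word_class l w))"
    by (rule sum_image_le[of _ ?x "word_class l", unfolded comp_def]) auto
  finally show "beta_J lam \<mu> \<rho> l \<le> (\<Sum>w\<in>words l. (word_weight lam \<mu> \<rho> w)\<^sup>2)"
    using x by simp
  have "(\<Sum>w\<in>words l. (word_weight lam \<mu> \<rho> w)\<^sup>2) = (\<Sum>w\<in>words l. ?x (word_class l w))"
    using x by simp
  also have "\<dots> = (\<Sum>c\<in>word_class l ` words l. \<Sum>w\<in>{w \<in> words l. word_class l w = c}. ?x (word_class l w))"
    by (rule sum.image_gen) simp
  also have "\<dots> = (\<Sum>c\<in>word_class l ` words l. real (card {w \<in> words l. word_class l w = c}) * ?x c)"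
    by (intro sum.cong refl) simp
  also have "\<dots> \<le> (\<Sum>c\<in>word_class l ` words l. 4 * (?x c / ?a c))"
  proof (intro sum_mono)
    fix c assume "c \<in> word_class l ` words l"
    then obtain v where v: "v \<in> words l" "c = word_class l v" by blast
    have "{w \<in> words l. word_class l w = c} \<subseteq> {v, rev v}"
      using word_class_eqD[of l v] v assms by (auto simp: words_def)
    then have "card {w \<in> words l. word_class l w = c} \<le> card {v, rev v}" by (intro card_mono) auto
    also have "\<dots> \<le> 2" by (simp add: card_insert_if)
    finally have 1: "real (card {w \<in> words l. word_class l w = c}) * ?x c \<le> 2 * ?x c"
      by (intro mult_right_mono) auto
    have "2 * ?x c * ?a c \<le> 4 * ?x c"
      using mult_left_mono[OF a(2)[OF v(1)], of "2 * ?x c"] v by simp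
    then have "2 * ?x c \<le> 4 * (?x c / ?a c)"
      using a(1)[OF v(1)] v(2) by (simp add: field_simps)
    with 1 show "real (card {w \<in> words l. word_class l w = c}) * ?x c \<le> 4 * (?x c / ?a c)" by simp
  qed
  also have "\<dots> = 4 * beta_J lam \<mu> \<rho> l"
    unfolding beta_J_def JJ_eq[OF assms] by (simp add: sum_distrib_left)
  finally show "(\<Sum>w\<in>words l. (word_weight lam \<mu> \<rho> w)\<^sup>2) \<le> 4 * beta_J lam \<mu> \<rho> l" .
qed

section \<open>The statistic as a sum over rooted paths\<close>

definition rooted_paths :: "nat \<Rightarrow> nat \<Rightarrow> nat \<Rightarrow> nat \<Rightarrow> nat list set" where
  "rooted_paths n l u v = {s. length s = Suc l \<and> distinct s \<and> set s \<subseteq> {1..n} \<and> s ! 0 = u \<and> s ! l = v}"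

lemma finite_rooted_paths [simp]: "finite (rooted_paths n l u v)"
  by (rule finite_subset[OF _ finite_lists_length_eq[of "{1..n}" "Suc l"]]) (auto simp: rooted_paths_def)

text \<open>Orienting a path from \<open>u\<close> to \<open>v\<close> selects one of its two
  traversals, so each subgraph with these leaves comes from exactly one pair of word and sequence,
  and no factor 2 appears.\<close>

lemma Phi_sum_eq:
  assumes "0 < l"
  shows "(\<Sum>c\<in>JJ l. Xi lam \<mu> \<rho> (class_rep c) *
        (\<Sum>S | S \<in> decorated_subgraphs_K n \<and> dgraph_iso S (class_rep c) \<and> leaves S = {u, v}. f S)) =
    (\<Sum>w\<in>words l. \<Sum>s\<in>rooted_paths n l u v. word_weight lam \<mu> \<rho> w * f (path_graph s w))"
    (is "?L = ?R")
proof -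
  define T where "T = (\<lambda>c. {S. S \<in> decorated_subgraphs_K n \<and> dgraph_iso S (class_rep c) \<and> leaves S = {u, v}})"
  let ?P = "words l \<times> rooted_paths n l u v"
  let ?g = "\<lambda>(w, s :: nat list). path_graph s w"
  have T: "T (word_class l w) =
      {path_graph s w | s. dpath l s w \<and> set s \<subseteq> {1..n} \<and> {s ! 0, s ! l} = {u, v}}"
    if w: "w \<in> words l" for w
  proof -
    have lw: "length w = l" using w by (simp add: words_def)
    obtain t where t: "dpath l t w" "class_rep (word_class l w) = path_graph t w"
      using class_rep_word_class[OF lw] by auto
    have "dgraph_iso S (path_graph t w) \<longleftrightarrow> (\<exists>s. dpath l s w \<and> S = path_graph s w)" for S :: "nat dgraph"
    proof
      assume S: "dgraph_iso S (path_graph t w)"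
      then obtain \<phi> where \<phi>: "is_dgraph_iso \<phi> S (path_graph t w)" and dS: "decorated_graph S"
        by (auto simp: dgraph_iso_def)
      \<comment> \<open>The isomorphism leads from the subgraph to the representative, while the
        traversal is known on the representative; the inverse transports it back.\<close>
      define \<psi> where "\<psi> = the_inv_into (verts S) \<phi>"
      have bij: "bij_betw \<phi> (verts S) (set t)" using \<phi> by (simp add: is_dgraph_iso_def)
      then have bij': "bij_betw \<psi> (set t) (verts S)"
        unfolding \<psi>_def by (rule bij_betw_the_inv_into)
      have "\<phi> (\<psi> a) = a" "\<psi> a \<in> verts S" if "a \<in> set t" for a
        using that bij bij' f_the_inv_into_f_bij_betw[OF bij] by (auto simp: \<psi>_def bij_betw_def)
      then have "is_dgraph_iso \<psi> (path_graph t w) S"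
        using \<phi> bij' unfolding is_dgraph_iso_def by (metis verts_path_graph)
      then show "\<exists>s. dpath l s w \<and> S = path_graph s w"
        using iso_image_path_graph[OF t(1) dS] by blast
    qed (use dgraph_iso_path_graph[OF _ t(1)] in auto)
    moreover have "path_graph s w \<in> decorated_subgraphs_K n \<longleftrightarrow> set s \<subseteq> {1..n}"
      "leaves (path_graph s w) = {s ! 0, s ! l}" if "dpath l s w" for s
      using leaves_path_graph[OF that assms] decorated_graph_path_graph[OF that]
      by (simp_all add: decorated_subgraphs_K_def)
    ultimately show ?thesis
      unfolding T_def t(2) by (intro Collect_cong) (simp, metis)
  qed
  have union: "(\<Union>c\<in>JJ l. T c) = ?g ` ?P"
  proof (intro equalityI subsetI)
    fix S assume "S \<in> (\<Union>c\<in>JJ l. T c)"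
    then obtain w s where w: "w \<in> words l" and s: "dpath l s w" "set s \<subseteq> {1..n}" "{s ! 0, s ! l} = {u, v}"
      and S: "S = path_graph s w"
      using T by (auto simp: JJ_eq[OF assms])
    show "S \<in> ?g ` ?P"
    proof (cases "s ! 0 = u")
      case True
      then have "s \<in> rooted_paths n l u v" using s by (auto simp: rooted_paths_def dpath_def doubleton_eq_iff)
      then show ?thesis using S w by force
    next
      case False
      \<comment> \<open>The traversal runs from \<open>v\<close> to \<open>u\<close> and is
        reversed. \<open>words l\<close> is closed under reversal because its condition is symmetric
        in the two ends.\<close>
      then have "rev s \<in> rooted_paths n l u v"
        using s by (auto simp: rooted_paths_def dpath_def doubleton_eq_iff rev_nth)
      moreover have "rev w \<in> words l" using w assms by (auto simp: words_def rev_nth)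
      ultimately have "path_graph (rev s) (rev w) \<in> ?g ` ?P"
        by (intro image_eqI[of _ _ "(rev w, rev s)"]) auto
      then show ?thesis using S path_graph_rev[OF s(1)] by simp
    qed
  next
    fix S assume "S \<in> ?g ` ?P"
    then obtain w s where w: "w \<in> words l" and s: "s \<in> rooted_paths n l u v" and S: "S = path_graph s w"
      by auto
    then have "dpath l s w" by (auto simp: rooted_paths_def dpath_def words_def)
    then have "S \<in> T (word_class l w)" using T[OF w] s S by (auto simp: rooted_paths_def)
    then show "S \<in> (\<Union>c\<in>JJ l. T c)" using w by (auto simp: JJ_eq[OF assms])
  qed
  have disj: "T c \<inter> T c' = {}" if c: "c \<in> JJ l" "c' \<in> JJ l" "c \<noteq> c'" for c c'
  proof (rule ccontr)
    assume "T c \<inter> T c' \<noteq> {}"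
    then obtain S where S: "S \<in> T c" "S \<in> T c'" by blast
    obtain w w' where w: "w \<in> words l" "c = word_class l w" "w' \<in> words l" "c' = word_class l w'"
      using c by (auto simp: JJ_eq[OF assms])
    obtain s where s: "dpath l s w" "S = path_graph s w" using S(1) T[OF w(1)] w(2) by auto
    obtain s' where s': "dpath l s' w'" "S = path_graph s' w'" using S(2) T[OF w(3)] w(4) by auto
    have "word_class l w'' = {H. dgraph_iso S H}"
      if "dpath l s'' w''" "S = path_graph s'' w''" for s'' w''
      using dgraph_iso_path_graph_iff[OF that(1)] that(2) by (auto simp: word_class_def)
    from this[OF s] this[OF s'] show False using \<open>c \<noteq> c'\<close> w by simp
  qed
  have fin: "finite (T c)" if "c \<in> JJ l" for c
    by (rule finite_subset[of _ "?g ` ?P"]) (use union that in blast, simp)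
  have Xi: "Xi lam \<mu> \<rho> S = Xi lam \<mu> \<rho> (class_rep c)" if c: "c \<in> JJ l" and S: "S \<in> T c" for c S
  proof -
    obtain w where w: "w \<in> words l" "c = word_class l w" using c by (auto simp: JJ_eq[OF assms])
    obtain s where s: "dpath l s w" "S = path_graph s w" using S T[OF w(1)] w(2) by auto
    show ?thesis using Xi_class_rep[of w l] Xi_path_graph[OF s(1)] s w by (auto simp: words_def)
  qed
  have inj: "inj_on ?g ?P"
  proof (rule inj_onI)
    fix p q assume p: "p \<in> ?P" and q: "q \<in> ?P" and eq: "?g p = ?g q"
    obtain w s w' s' where pq: "p = (w, s)" "q = (w', s')" by (cases p, cases q)
    have "dpath l s w" "dpath l s' w'" "s ! 0 = s' ! 0"
      using p q pq by (auto simp: rooted_paths_def dpath_def words_def)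
    then show "p = q" using path_graph_start_unique[of l s w s' w'] eq pq by simp
  qed
  have "?L = (\<Sum>c\<in>JJ l. \<Sum>S\<in>T c. Xi lam \<mu> \<rho> S * f S)"
  proof (intro sum.cong refl)
    fix c assume c: "c \<in> JJ l"
    have "Xi lam \<mu> \<rho> (class_rep c) *
        (\<Sum>S | S \<in> decorated_subgraphs_K n \<and> dgraph_iso S (class_rep c) \<and> leaves S = {u, v}. f S) =
        (\<Sum>S\<in>T c. Xi lam \<mu> \<rho> (class_rep c) * f S)"
      unfolding T_def by (rule sum_distrib_left)
    also have "\<dots> = (\<Sum>S\<in>T c. Xi lam \<mu> \<rho> S * f S)"
      by (intro sum.cong refl) (simp add: Xi[OF c])
    finally show "Xi lam \<mu> \<rho> (class_rep c) *
        (\<Sum>S | S \<in> decorated_subgraphs_K n \<and> dgraph_iso S (class_rep c) \<and> leaves S = {u, v}. f S) =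
        (\<Sum>S\<in>T c. Xi lam \<mu> \<rho> S * f S)" .
  qed
  also have "\<dots> = (\<Sum>S\<in>(\<Union>c\<in>JJ l. T c). Xi lam \<mu> \<rho> S * f S)"
    using disj fin by (intro sum.UNION_disjoint[symmetric]) (auto simp: JJ_eq[OF assms])
  also have "\<dots> = (\<Sum>p\<in>?P. Xi lam \<mu> \<rho> (?g p) * f (?g p))"
    unfolding union by (subst sum.reindex[OF inj]) simp
  also have "\<dots> = (\<Sum>(w, s)\<in>?P. word_weight lam \<mu> \<rho> w * f (path_graph s w))"
    by (intro sum.cong refl) (auto simp: Xi_path_graph rooted_paths_def words_def dpath_def)
  also have "\<dots> = ?R" by (simp add: sum.cartesian_product)
  finally show ?thesis .
qed

subsection \<open>Noise and prior\<close>

lemma has_bochner_integral_pair_mult: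
  fixes f g :: "_ \<Rightarrow> real"
  assumes "sigma_finite_measure M" "sigma_finite_measure N"
    and f: "has_bochner_integral M f a" and g: "has_bochner_integral N g b"
  shows "has_bochner_integral (M \<Otimes>\<^sub>M N) (\<lambda>p. f (fst p) * g (snd p)) (a * b)"
proof -
  interpret M: sigma_finite_measure M by fact
  interpret N: sigma_finite_measure N by fact
  interpret P: pair_sigma_finite M N ..
  have [measurable]: "f \<in> borel_measurable M" "g \<in> borel_measurable N"
    using f g by (auto simp: has_bochner_integral_iff)
  have fi: "integrable M f" "integral\<^sup>L M f = a" and gi: "integrable N g" "integral\<^sup>L N g = b"
    using f g by (auto simp: has_bochner_integral_iff)
  have int: "integrable (M \<Otimes>\<^sub>M N) (\<lambda>p. f (fst p) * g (snd p))"
  proof (rule P.Fubini_integrable)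
    show "integrable M (\<lambda>x. \<integral>y. norm (f (fst (x, y)) * g (snd (x, y))) \<partial>N)"
      using fi by (simp add: abs_mult)
    show "AE x in M. integrable N (\<lambda>y. f (fst (x, y)) * g (snd (x, y)))"
      using gi by simp
  qed measurable
  have "integral\<^sup>L (M \<Otimes>\<^sub>M N) (\<lambda>p. f (fst p) * g (snd p)) = (\<integral>x. \<integral>y. f x * g y \<partial>N \<partial>M)"
    using P.integral_fst'[OF int] by simp
  then show ?thesis using int fi gi by (simp add: has_bochner_integral_iff)
qed

lemma has_bochner_integral_PiM_prod:
  fixes f :: "'i \<Rightarrow> 'a \<Rightarrow> real"
  assumes "\<And>i. prob_space (M i)" "finite I"
    and "\<And>i. i \<in> I \<Longrightarrow> has_bochner_integral (M i) (f i) (a i)"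
  shows "has_bochner_integral (Pi\<^sub>M I M) (\<lambda>x. \<Prod>i\<in>I. f i (x i)) (\<Prod>i\<in>I. a i)"
proof -
  interpret P: product_sigma_finite M
    using assms(1) by (simp add: product_sigma_finite_def prob_space_imp_sigma_finite)
  have "integrable (M i) (f i)" "integral\<^sup>L (M i) (f i) = a i" if "i \<in> I" for i
    using assms(3)[OF that] by (auto simp: has_bochner_integral_iff)
  then show ?thesis
    using P.product_integrable_prod[of I f] P.product_integral_prod[of I f] assms(2)
    by (simp add: has_bochner_integral_iff)
qed

section \<open>Gaussian noise\<close>

definition wigner_index :: "nat \<Rightarrow> (nat \<times> nat) set" where
  "wigner_index n = {(i, j). 1 \<le> i \<and> i \<le> j \<and> j \<le> n}"

definition wigner_entry :: "nat \<times> nat \<Rightarrow> real measure" where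
  "wigner_entry = (\<lambda>(i, j). density lborel (\<lambda>t. ennreal (normal_density 0 (sqrt (1 + of_bool (i = j))) t)))"

lemma wigner_law_eq: "wigner_law n = Pi\<^sub>M (wigner_index n) wigner_entry"
  by (simp add: wigner_law_def wigner_index_def wigner_entry_def)

lemma finite_wigner_index [simp]: "finite (wigner_index n)"
  by (rule finite_subset[of _ "{1..n} \<times> {1..n}"]) (auto simp: wigner_index_def)

lemma prob_space_wigner_entry: "prob_space (wigner_entry e)"
  by (auto simp: wigner_entry_def split: prod.split intro!: prob_space_normal_density)

lemma sets_wigner_entry [measurable_cong]: "sets (wigner_entry e) = sets borel"
  by (simp add: wigner_entry_def split: prod.split)

lemma prob_space_wigner_law: "prob_space (wigner_law n)"
  unfolding wigner_law_eq by (intro prob_space_PiM prob_space_wigner_entry)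

lemma wigner_entry_moment:
  assumes "k \<le> 2" "0 < k \<Longrightarrow> fst e \<noteq> snd e"
  shows "has_bochner_integral (wigner_entry e) (\<lambda>t. t ^ k) (if k = 1 then 0 else 1)"
proof -
  obtain i j where e: "e = (i, j)" by (cases e)
  define \<sigma> :: real where "\<sigma> = sqrt (1 + of_bool (i = j))"
  have \<sigma>: "0 < \<sigma>" by (simp add: \<sigma>_def)
  have "has_bochner_integral lborel (\<lambda>t. normal_density 0 \<sigma> t *\<^sub>R t ^ k) (if k = 1 then 0 else 1)"
  proof -
    consider "k = 0" | "k = 1" | "k = 2" using assms(1) by linarith
    then show ?thesis
    proof cases
      case 1
      then show ?thesis using normal_moment_even[OF \<sigma>, of 0 0] by simp
    next
      case 2
      then show ?thesis using normal_moment_odd[OF \<sigma>, of 0 0] by simp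
    next
      case 3
      then have "\<sigma> = 1" using assms(2) e by (simp add: \<sigma>_def)
      then show ?thesis using 3 normal_moment_even[OF \<sigma>, of 0 1] by (simp add: fact_numeral)
    qed
  qed
  then show ?thesis
    unfolding wigner_entry_def e prod.case \<sigma>_def[symmetric]
    by (intro has_bochner_integral_density) (auto simp: normal_density_nonneg)
qed

definition noise :: "(nat \<times> nat \<Rightarrow> real) \<times> (nat \<times> nat \<Rightarrow> real) \<Rightarrow> decoration \<times> nat \<times> nat \<Rightarrow> real" where
  "noise N k = (case fst k of Bullet \<Rightarrow> fst N (snd k) | Circ \<Rightarrow> snd N (snd k))"

text \<open>Edges of a path join distinct vertices, so only off-diagonal entries occur. These have
  variance 1, which is what makes the noise monomials orthonormal.\<close>

definition strict_index :: "nat \<Rightarrow> (nat \<times> nat) set" where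
  "strict_index n = {(i, j). 1 \<le> i \<and> i < j \<and> j \<le> n}"

lemma prod_noise_eq:
  assumes "F \<subseteq> UNIV \<times> wigner_index n"
  shows "(\<Prod>k\<in>F. noise N k) =
    (\<Prod>e\<in>wigner_index n. fst N e ^ of_bool ((Bullet, e) \<in> F)) *
    (\<Prod>e\<in>wigner_index n. snd N e ^ of_bool ((Circ, e) \<in> F))"
proof -
  have fin: "finite (UNIV \<times> wigner_index n :: (decoration \<times> nat \<times> nat) set)"
    by (simp add: UNIV_decoration)
  have "(\<Prod>k\<in>F. noise N k) = (\<Prod>k\<in>F. noise N k ^ of_bool (k \<in> F))" by simp
  also have "\<dots> = (\<Prod>k\<in>UNIV \<times> wigner_index n. noise N k ^ of_bool (k \<in> F))"
    by (rule prod.mono_neutral_left[OF fin assms]) simp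
  also have "\<dots> = (\<Prod>d\<in>UNIV. \<Prod>e\<in>wigner_index n. noise N (d, e) ^ of_bool ((d, e) \<in> F))"
    by (simp add: prod.cartesian_product case_prod_unfold)
  finally show ?thesis by (simp add: UNIV_decoration noise_def)
qed

text \<open>Each variable occurs in the product of the two monomials with exponent 0, 1 or 2.
  Exponent 1 annihilates the expectation and the other two contribute 1, so only equal index sets
  survive.\<close>

lemma noise_orthonormal:
  assumes F: "F \<subseteq> UNIV \<times> strict_index n" and G: "G \<subseteq> UNIV \<times> strict_index n"
  shows "has_bochner_integral (wigner_law n \<Otimes>\<^sub>M wigner_law n)
    (\<lambda>N. (\<Prod>k\<in>F. noise N k) * (\<Prod>k\<in>G. noise N k)) (of_bool (F = G))"
proof -
  have sub: "UNIV \<times> strict_index n \<subseteq> UNIV \<times> wigner_index n"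
    by (auto simp: strict_index_def wigner_index_def)
  define m :: "decoration \<Rightarrow> nat \<times> nat \<Rightarrow> nat" where
    "m = (\<lambda>d e. of_bool ((d, e) \<in> F) + of_bool ((d, e) \<in> G))"
  have m: "m d e \<le> 2" "0 < m d e \<Longrightarrow> fst e \<noteq> snd e" for d e
    using F G by (auto simp: m_def strict_index_def split: if_splits)
  have *: "has_bochner_integral (wigner_law n)
      (\<lambda>x. \<Prod>e\<in>wigner_index n. x e ^ m d e) (\<Prod>e\<in>wigner_index n. if m d e = 1 then 0 else 1)" for d
    unfolding wigner_law_eq
    by (intro has_bochner_integral_PiM_prod prob_space_wigner_entry finite_wigner_index wigner_entry_moment m)
  have val: "(\<Prod>e\<in>wigner_index n. if m Bullet e = 1 then 0 else 1) * (\<Prod>e\<in>wigner_index n. if m Circ e = 1 then 0 else 1) =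
      (of_bool (F = G) :: real)"
  proof (cases "F = G")
    case True
    have "m d e \<noteq> 1" for d e by (simp add: m_def True of_bool_def)
    then show ?thesis by (simp add: True)
  next
    case False
    then obtain d e where "(d, e) \<in> F \<longleftrightarrow> (d, e) \<notin> G" by auto
    then have "m d e = 1" "e \<in> wigner_index n" using F G sub by (auto simp: m_def)
    then show ?thesis using False by (cases d) (auto simp: prod_zero_iff)
  qed
  have "has_bochner_integral (wigner_law n \<Otimes>\<^sub>M wigner_law n)
      (\<lambda>N. (\<Prod>e\<in>wigner_index n. fst N e ^ m Bullet e) * (\<Prod>e\<in>wigner_index n. snd N e ^ m Circ e)) (of_bool (F = G))"
    unfolding val[symmetric]
    by (intro has_bochner_integral_pair_mult * prob_space_imp_sigma_finite prob_space_wigner_law)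
  moreover have "(\<Prod>k\<in>F. noise N k) * (\<Prod>k\<in>G. noise N k) =
      (\<Prod>e\<in>wigner_index n. fst N e ^ m Bullet e) * (\<Prod>e\<in>wigner_index n. snd N e ^ m Circ e)" for N
    using prod_noise_eq[of F n N] prod_noise_eq[of G n N] F G sub
    by (simp add: m_def power_add prod.distrib subset_trans[OF _ sub])
  ultimately show ?thesis by simp
qed

section \<open>Moments of the prior\<close>

definition coord :: "decoration \<Rightarrow> real \<times> real \<Rightarrow> real" where
  "coord d p = (case d of Bullet \<Rightarrow> fst p | Circ \<Rightarrow> snd p)"

lemma borel_measurable_coord [measurable]: "coord d \<in> borel_measurable borel"
  unfolding coord_def by (cases d) (simp_all add: borel_prod[symmetric])

locale prior =
  fixes \<rho> C :: real and \<pi> :: "(real \<times> real) measure"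
  assumes correlated: "correlated_prior \<rho> C \<pi>"
begin

sublocale prob_space \<pi>
  using correlated by (simp add: correlated_prior_def)

lemma sets_prior [measurable_cong]: "sets \<pi> = sets borel"
  using correlated by (simp add: correlated_prior_def)

text \<open>Makes the constant \<open>M\<close> of the later bounds at least 1, so that it can be
  inserted freely. The moments are compared through 2 x^2 - 1 <= x^4.\<close>

lemma C_ge_1: "1 \<le> C"
proof -
  have [measurable]: "fst \<in> borel_measurable \<pi>"
    by (simp add: measurable_cong_sets[OF sets_prior refl] borel_prod[symmetric])
  have i4: "integrable \<pi> (\<lambda>p. fst p ^ 4)" and "(\<integral>p. (fst p)\<^sup>2 \<partial>\<pi>) = 1" "(\<integral>p. fst p ^ 4 \<partial>\<pi>) \<le> C"
    using correlated by (auto simp: correlated_prior_def)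
  \<comment> \<open>A non-integrable function has Bochner integral 0, so the value 1 of the second
    moment already yields integrability.\<close>
  have i2: "integrable \<pi> (\<lambda>p. (fst p)\<^sup>2)"
  proof (rule ccontr)
    assume "\<not> integrable \<pi> (\<lambda>p. (fst p)\<^sup>2)"
    then show False using \<open>(\<integral>p. (fst p)\<^sup>2 \<partial>\<pi>) = 1\<close> not_integrable_integral_eq by fastforce
  qed
  have "2 * (fst p)\<^sup>2 - 1 \<le> fst p ^ 4" for p :: "real \<times> real"
    using zero_le_power2[of "(fst p)\<^sup>2 - 1"] by (simp add: power2_eq_square power4_eq_xxxx algebra_simps)
  then have "(\<integral>p. 2 * (fst p)\<^sup>2 - 1 \<partial>\<pi>) \<le> (\<integral>p. fst p ^ 4 \<partial>\<pi>)"
    using i2 i4 by (intro integral_mono) auto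
  also have "(\<integral>p. 2 * (fst p)\<^sup>2 - 1 \<partial>\<pi>) = 1"
    using i2 \<open>(\<integral>p. (fst p)\<^sup>2 \<partial>\<pi>) = 1\<close> by (simp add: prob_space)
  finally show ?thesis using \<open>(\<integral>p. fst p ^ 4 \<partial>\<pi>) \<le> C\<close> by simp
qed

lemma integrable_quartic:
  fixes f :: "real \<times> real \<Rightarrow> real"
  assumes [measurable]: "f \<in> borel_measurable borel"
    and le: "\<And>p. \<bar>f p\<bar> \<le> 1 + fst p ^ 4 + snd p ^ 4"
  shows "integrable \<pi> f" "\<bar>integral\<^sup>L \<pi> f\<bar> \<le> 1 + 2 * C"
proof -
  have i: "integrable \<pi> (\<lambda>p. fst p ^ 4)" "integrable \<pi> (\<lambda>p. snd p ^ 4)"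
    "(\<integral>p. fst p ^ 4 \<partial>\<pi>) \<le> C" "(\<integral>p. snd p ^ 4 \<partial>\<pi>) \<le> C"
    using correlated by (auto simp: correlated_prior_def)
  have d: "integrable \<pi> (\<lambda>p. 1 + fst p ^ 4 + snd p ^ 4)" using i by simp
  show int: "integrable \<pi> f"
  proof (rule Bochner_Integration.integrable_bound[OF d])
    show "f \<in> borel_measurable \<pi>" by measurable
    show "AE p in \<pi>. norm (f p) \<le> norm (1 + fst p ^ 4 + snd p ^ 4)"
      using le by (intro AE_I2) (auto intro: order_trans)
  qed
  have "\<bar>integral\<^sup>L \<pi> f\<bar> \<le> (\<integral>p. \<bar>f p\<bar> \<partial>\<pi>)" by (rule integral_abs_bound)
  also have "\<dots> \<le> (\<integral>p. 1 + fst p ^ 4 + snd p ^ 4 \<partial>\<pi>)"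
    using int d le by (intro integral_mono) auto
  also have "\<dots> \<le> 1 + 2 * C" using i by (simp add: prob_space)
  finally show "\<bar>integral\<^sup>L \<pi> f\<bar> \<le> 1 + 2 * C" .
qed

text \<open>The product is at most the fourth power of the largest of 1 and the two absolute values.
  Shorter products are filled up with the factor 1.\<close>

lemma coord_prod4_le:
  assumes "\<And>i. i < 4 \<Longrightarrow> a i = 1 \<or> (\<exists>d. a i = coord d p)"
  shows "\<bar>a 0 * a 1 * a 2 * a (3 :: nat)\<bar> \<le> 1 + fst p ^ 4 + snd p ^ 4"
proof -
  define m where "m = max 1 (max \<bar>fst p\<bar> \<bar>snd p\<bar>)"
  have c: "\<bar>coord d p\<bar> \<le> m" for d by (cases d) (auto simp: coord_def m_def)
  have a: "\<bar>a i\<bar> \<le> m" if "i < 4" for i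
    using assms[OF that] c by (auto simp: m_def)
  have "\<bar>a 0 * a 1 * a 2 * a 3\<bar> \<le> m * m * m * m"
    unfolding abs_mult by (intro mult_mono a) (auto simp: m_def)
  also have "m * m * m * m = m ^ 4" by (simp add: power4_eq_xxxx)
  also have "\<dots> \<le> 1 + fst p ^ 4 + snd p ^ 4"
  proof -
    have "m = 1 \<or> m = \<bar>fst p\<bar> \<or> m = \<bar>snd p\<bar>" by (auto simp: m_def max_def)
    moreover have "0 \<le> fst p ^ 4" "0 \<le> snd p ^ 4" by simp_all
    ultimately show ?thesis by (auto simp: power_abs)
  qed
  finally show ?thesis .
qed

text \<open>The correlation matrix of the prior: an interior vertex with two signal edges
  contributes 1 or \<open>\<rho>\<close>, according to whether their decorations agree.\<close>

lemma coord_moment2: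
  "has_bochner_integral \<pi> (\<lambda>p. coord d p * coord d' p) (if d = d' then 1 else \<rho>)"
proof -
  have "\<bar>coord d p * coord d' p\<bar> \<le> 1 + fst p ^ 4 + snd p ^ 4" for p
  proof -
    define a :: "nat \<Rightarrow> real" where "a = (\<lambda>i. if i = 0 then coord d p else if i = 1 then coord d' p else 1)"
    have "\<bar>a 0 * a 1 * a 2 * a (3 :: nat)\<bar> \<le> 1 + fst p ^ 4 + snd p ^ 4"
      by (rule coord_prod4_le) (auto simp: a_def)
    then show ?thesis by (simp add: a_def)
  qed
  then have "integrable \<pi> (\<lambda>p. coord d p * coord d' p)"
    by (intro integrable_quartic(1)) measurable
  moreover have "(\<integral>p. coord d p * coord d' p \<partial>\<pi>) = (if d = d' then 1 else \<rho>)"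
    using correlated
    by (cases d; cases d') (auto simp: correlated_prior_def coord_def power2_eq_square mult.commute)
  ultimately show ?thesis by (simp add: has_bochner_integral_iff)
qed

end

subsection \<open>Walks along a planted path\<close>

text \<open>How a walk takes a step relative to a fixed path: along an edge of the path in its direction
  (\<open>Fwd\<close>) or against it (\<open>Bwd\<close>), the noise of the two edges being matched, or otherwise (\<open>Free\<close>).\<close>

datatype mode = Free | Fwd | Bwd

lemma UNIV_mode: "UNIV = {Free, Fwd, Bwd}"
  using mode.exhaust by blast

locale planted_walk =
  fixes s :: "nat list" and w :: "decoration list" and l n :: nat
    and L :: "decoration \<Rightarrow> real" and \<rho> q :: real
  assumes path: "dpath l s w"
begin

type_synonym state = "nat \<times> decoration \<times> mode"

definition step_ok :: "nat \<Rightarrow> nat \<Rightarrow> decoration \<Rightarrow> mode \<Rightarrow> bool" where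
  "step_ok x z d m = (case m of Free \<Rightarrow> True
     | Fwd \<Rightarrow> \<exists>j<l. x = s ! j \<and> z = s ! Suc j \<and> d = w ! j
     | Bwd \<Rightarrow> \<exists>j<l. x = s ! Suc j \<and> z = s ! j \<and> d = w ! j)"

text \<open>The factor belongs to the vertex that the step leaves. Off the path it is an entry of
  the transfer matrix. Inside a run of matched edges no coordinate of the prior is left, whence 1;
  at any other vertex of the path a constant \<open>q\<close>, later \<open>M / \<rho>\<close>, is
  paid.\<close>

definition vertex_factor :: "nat \<Rightarrow> decoration \<Rightarrow> mode \<Rightarrow> decoration \<Rightarrow> mode \<Rightarrow> real" where
  "vertex_factor x d m d' m' =
     (if x \<notin> set s then (if d = d' then 1 else \<rho>\<^sup>2)
      else if m \<noteq> Free \<and> m = m' then 1 else q)"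

text \<open>Each step carries a factor \<open>1 / n\<close> for its vertex, which a matched edge gains back. A path does
  not backtrack, so a run of matched edges never reverses its direction.\<close>

fun walk_step :: "state \<Rightarrow> state \<Rightarrow> real" where
  "walk_step (x, d, m) (z, d', m') =
     (if step_ok x z d' m' \<and> (m = Free \<or> m' = Free \<or> m = m')
      then vertex_factor x d m d' m' * (if m' = Free then (L d')\<^sup>2 / n else 1) else 0)"

text \<open>The last vertex is prescribed, not summed over; the final \<open>n\<close> offsets the
  factor \<open>1 / n\<close> that a free last step is charged for it.\<close>

fun walk_weight :: "state \<Rightarrow> state list \<Rightarrow> real" where
  "walk_weight st [] = (if fst st = s ! l then real n else 0)"
| "walk_weight st (p # ps) = walk_step st p * walk_weight p ps"

abbreviation states :: "state set" where
  "states \<equiv> {1..n} \<times> UNIV \<times> UNIV"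

definition walks :: "nat \<Rightarrow> state list set" where
  "walks k = {ps. set ps \<subseteq> states \<and> length ps = k}"

lemma finite_states: "finite states"
  unfolding UNIV_mode UNIV_decoration by simp

lemma finite_walks: "finite (walks k)"
  unfolding walks_def by (rule finite_lists_length_eq[OF finite_states])

definition walk_sum :: "nat \<Rightarrow> state \<Rightarrow> real" where
  "walk_sum k st = (\<Sum>ps\<in>walks k. walk_weight st ps)"

lemma walk_sum_0: "walk_sum 0 st = (if fst st = s ! l then real n else 0)"
proof -
  have "walks 0 = {[]}" by (auto simp: walks_def)
  then show ?thesis by (simp add: walk_sum_def)
qed

lemma walk_sum_Suc: "walk_sum (Suc k) st = (\<Sum>p\<in>states. walk_step st p * walk_sum k p)"
proof -
  have "walks (Suc k) = (\<lambda>(p, ps). p # ps) ` (states \<times> walks k)"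
    by (auto simp: walks_def length_Suc_conv image_iff)
  moreover have "inj_on (\<lambda>(p, ps). p # ps) (states \<times> walks k)"
    by (auto simp: inj_on_def)
  ultimately have "walk_sum (Suc k) st = (\<Sum>(p, ps)\<in>states \<times> walks k. walk_step st p * walk_weight p ps)"
    by (simp add: walk_sum_def sum.reindex case_prod_unfold)
  also have "\<dots> = (\<Sum>p\<in>states. walk_step st p * walk_sum k p)"
    by (simp add: walk_sum_def sum_distrib_left sum.cartesian_product)
  finally show ?thesis .
qed

end

section \<open>The potential and the recursion for walk sums\<close>

locale planted_walk_potential = planted_walk +
  fixes A hm :: real and h :: "decoration \<Rightarrow> real"
  assumes n_pos: "0 < n"
    and L: "\<And>d. 0 \<le> L d" "\<And>d. L d \<le> 1"
    and A_gt_1: "1 < A" and q: "1 \<le> q"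
    and h: "\<And>d. 1 \<le> h d" "\<And>d. h d \<le> hm"
    and rho_sq: "\<rho>\<^sup>2 \<le> 1"
    and eigen: "\<And>d. (\<Sum>d'\<in>UNIV. (if d = d' then 1 else \<rho>\<^sup>2) * (L d')\<^sup>2 * h d') = A * h d"
begin

text \<open>\<open>B1\<close> is the value on the path inside a matched run, \<open>B2\<close> the
  value there after a free step. Leaving a run costs at most \<open>2 * q * hm\<close> (two
  decorations, eigenvector entries at most \<open>hm\<close>), so \<open>B1\<close> has to satisfy
  \<open>B1 + 2 * q * hm \<le> A * B1\<close>; hence the division by \<open>A - 1\<close>. After a
  free arrival the walk steps freely or enters a run in one of two directions, which gives
  \<open>B2\<close>.\<close>

definition "B1 = 2 * q * hm / (A - 1) + q"
definition "B2 = 2 * q * hm + 2 * q * B1"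
text \<open>The relative cost of a free landing on one of the at most \<open>l + 1\<close> vertices
  of the path, with one of two decorations.\<close>

definition "\<theta> = 2 * (real l + 1) * B2 / n"
text \<open>Chosen so that \<open>D_Suc\<close> holds: the power collects the free landings on the
  path, the bracket the landings at the one vertex from which a matched run ends in time.\<close>

definition D :: "nat \<Rightarrow> real" where
  "D k = (1 + \<theta>) ^ k * (1 + 2 * q * (\<Sum>i\<in>{1..k}. (1 / A) ^ i))"

text \<open>The term with \<open>n / A ^ k\<close> accounts for the run of \<open>k\<close> matched edges that reaches the end of the
  path exactly when the walk stops; a run that ends earlier pays \<open>1 / n\<close> for landing on the path.\<close>

definition potential :: "nat \<Rightarrow> state \<Rightarrow> real" where
  "potential k = (\<lambda>(x, d, m).
     if x \<notin> set s then h d * D k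
     else (if m = Free then B2 else B1) * D k +
       (if x = s ! (l - k) \<and> m \<noteq> Bwd then (if m = Free then q else 1) * n / A ^ k else 0))"

text \<open>An invariant of the walk. After a backward matched step the vertex is some
  \<open>s ! j\<close> with \<open>j < l\<close>, never the end \<open>s ! l\<close>; therefore
  \<open>potential\<close> needs no term of order \<open>n\<close> in mode
  \<open>Bwd\<close>.\<close>

definition valid_state :: "state \<Rightarrow> bool" where
  "valid_state = (\<lambda>(x, d, m). m = Free \<or> (m = Fwd \<and> x \<in> set s) \<or> (m = Bwd \<and> (\<exists>j<l. x = s ! j)))"

lemma hm_ge_1: "1 \<le> hm" using h[of Bullet] by linarith

lemma B1_ge: "q \<le> B1" "B1 + 2 * q * hm \<le> A * B1"
proof -
  have "0 \<le> 2 * q * hm / (A - 1)" using q hm_ge_1 A_gt_1 by simp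
  then show "q \<le> B1" by (simp add: B1_def)
  have "(A - 1) * B1 = 2 * q * hm + (A - 1) * q"
    using A_gt_1 by (simp add: B1_def field_simps)
  moreover have "0 \<le> (A - 1) * q" using A_gt_1 q by simp
  ultimately show "B1 + 2 * q * hm \<le> A * B1" by (simp add: algebra_simps)
qed

lemma B2_ge: "q \<le> B2" "0 \<le> B2" "hm \<le> B2"
proof -
  have "0 \<le> q * B1" "1 * hm \<le> q * hm" "q * 1 \<le> q * hm"
    using q B1_ge(1) hm_ge_1 by (auto intro!: mult_right_mono mult_left_mono)
  then show "q \<le> B2" "0 \<le> B2" "hm \<le> B2" using q hm_ge_1 unfolding B2_def by linarith+
qed

lemma theta_nonneg: "0 \<le> \<theta>"
  using B2_ge n_pos by (simp add: \<theta>_def)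

lemma D_ge_1: "1 \<le> D k"
proof -
  have "0 \<le> 2 * q * (\<Sum>i\<in>{1..k}. (1 / A) ^ i)"
    using q A_gt_1 by (intro mult_nonneg_nonneg sum_nonneg) auto
  moreover have "1 \<le> (1 + \<theta>) ^ k" using theta_nonneg by (intro one_le_power) simp
  ultimately have "1 * 1 \<le> D k" unfolding D_def by (intro mult_mono) auto
  then show ?thesis by simp
qed

lemma D_Suc: "D k * (1 + \<theta>) + 2 * q / A ^ Suc k \<le> D (Suc k)"
proof -
  have "1 \<le> (1 + \<theta>) ^ Suc k" using theta_nonneg by (intro one_le_power) simp
  moreover have "0 \<le> 2 * q / A ^ Suc k" using q A_gt_1 by simp
  ultimately have "1 * (2 * q / A ^ Suc k) \<le> (1 + \<theta>) ^ Suc k * (2 * q / A ^ Suc k)"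
    by (rule mult_right_mono)
  moreover have "D (Suc k) = D k * (1 + \<theta>) + (1 + \<theta>) ^ Suc k * (2 * q / A ^ Suc k)"
    by (simp add: D_def algebra_simps divide_inverse power_inverse)
  ultimately show ?thesis by simp
qed

lemma potential_Free_le:
  "potential k (z, d, Free) \<le> h d * D k + (if z \<in> set s then B2 * D k else 0)
     + (if z = s ! (l - k) then q * n / A ^ k else 0)"
  using h[of d] D_ge_1[of k] q A_gt_1 by (auto simp: potential_def)

text \<open>The eigenvector part is averaged over all \<open>n\<close> new vertices and reproduces
  the matrix product. The vertices of the path add \<open>\<theta> * D k\<close>. The vertex
  \<open>s ! (l - k)\<close>, where the potential is of order \<open>n\<close>, adds
  \<open>q / A ^ k\<close> for each of the two decorations.\<close>

lemma free_steps_le: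
  assumes c: "\<And>d. 0 \<le> c d" "\<And>d. c d \<le> 1"
  shows "(\<Sum>z\<in>{1..n}. \<Sum>d\<in>UNIV. c d * ((L d)\<^sup>2 / n) * potential k (z, d, Free))
    \<le> (\<Sum>d\<in>UNIV. c d * (L d)\<^sup>2 * h d) * D k + \<theta> * D k + 2 * q / A ^ k"
proof -
  have L2: "(L d)\<^sup>2 \<le> 1" for d using L by (simp add: power_le_one)
  have cL: "c d * (L d)\<^sup>2 \<le> 1" "0 \<le> c d * (L d)\<^sup>2" for d
    using c L2 by (auto intro: mult_le_one)
  let ?e = "\<lambda>z. (if z \<in> set s then B2 * D k else 0) + (if z = s ! (l - k) then q * n / A ^ k else 0)"
  have e: "0 \<le> ?e z" for z using B2_ge D_ge_1[of k] q A_gt_1 by simp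
  have "(\<Sum>z\<in>{1..n}. \<Sum>d\<in>UNIV. c d * ((L d)\<^sup>2 / n) * potential k (z, d, Free))
      \<le> (\<Sum>z\<in>{1..n}. \<Sum>d\<in>UNIV. c d * (L d)\<^sup>2 * h d * D k / n + ?e z / n)"
  proof (intro sum_mono)
    fix z d
    have "c d * (L d)\<^sup>2 * potential k (z, d, Free) \<le> c d * (L d)\<^sup>2 * (h d * D k + ?e z)"
      using potential_Free_le[of k z d] cL(2) by (intro mult_left_mono) (auto simp: add.assoc)
    also have "\<dots> \<le> c d * (L d)\<^sup>2 * h d * D k + ?e z"
      using mult_right_mono[OF cL(1) e, of d z] by (simp add: algebra_simps)
    finally show "c d * ((L d)\<^sup>2 / n) * potential k (z, d, Free)
        \<le> c d * (L d)\<^sup>2 * h d * D k / n + ?e z / n"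
      using n_pos by (simp add: divide_right_mono field_simps)
  qed
  also have "\<dots> = (\<Sum>d\<in>UNIV. c d * (L d)\<^sup>2 * h d) * D k + 2 / n * (\<Sum>z\<in>{1..n}. ?e z)"
  proof -
    have "(\<Sum>z\<in>{1..n}. \<Sum>d\<in>UNIV. a d * b / n + e z / n) = (\<Sum>d\<in>UNIV. a d) * b + 2 / n * (\<Sum>z\<in>{1..n}. e z)"
      for a :: "decoration \<Rightarrow> real" and b and e :: "nat \<Rightarrow> real"
      using n_pos by (simp add: UNIV_decoration sum.distrib sum_divide_distrib[symmetric]
        sum_distrib_right[symmetric] field_simps)
    then show ?thesis .
  qed
  also have "(\<Sum>z\<in>{1..n}. ?e z) \<le> (real l + 1) * (B2 * D k) + q * n / A ^ k"
  proof -
    have "(\<Sum>z\<in>{1..n}. if z \<in> set s then B2 * D k else 0) = card ({1..n} \<inter> set s) * (B2 * D k)"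
      by (simp add: sum.inter_restrict[symmetric])
    also have "\<dots> \<le> (real l + 1) * (B2 * D k)"
    proof (rule mult_right_mono)
      have "card ({1..n} \<inter> set s) \<le> card (set s)" by (intro card_mono) auto
      also have "\<dots> \<le> Suc l" using path card_length[of s] by (simp add: dpath_def)
      finally show "real (card ({1..n} \<inter> set s)) \<le> real l + 1" by simp
    qed (use B2_ge D_ge_1[of k] in simp)
    finally have "(\<Sum>z\<in>{1..n}. if z \<in> set s then B2 * D k else 0) \<le> (real l + 1) * (B2 * D k)" .
    moreover have "0 \<le> q * n / A ^ k" using q A_gt_1 by simp
    ultimately show ?thesis
      by (simp add: sum.distrib sum.delta')
  qed
  finally have "(\<Sum>z\<in>{1..n}. \<Sum>d\<in>UNIV. c d * ((L d)\<^sup>2 / n) * potential k (z, d, Free)) \<le>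
      (\<Sum>d\<in>UNIV. c d * (L d)\<^sup>2 * h d) * D k + 2 / n * ((real l + 1) * (B2 * D k) + q * n / A ^ k)"
    using n_pos by (simp add: mult_left_mono divide_right_mono)
  also have "2 / n * ((real l + 1) * (B2 * D k) + q * n / A ^ k) = \<theta> * D k + 2 * q / A ^ k"
    using n_pos by (simp add: \<theta>_def field_simps)
  finally show ?thesis by simp
qed

lemma potential_nonneg: "0 \<le> potential k st"
proof -
  have "0 \<le> h d" for d using h(1)[of d] by simp
  moreover have "0 \<le> D k" "0 \<le> B1" "0 \<le> B2" "0 \<le> q" "0 \<le> A"
    using D_ge_1[of k] q A_gt_1 B1_ge(1) B2_ge by simp_all
  ultimately show ?thesis by (cases st) (simp add: potential_def)
qed

lemma vertex_factor_nonneg: "0 \<le> vertex_factor x d m d' m'"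
  using q by (simp add: vertex_factor_def)

lemma sum_states:
  "(\<Sum>p\<in>states. g p) =
    (\<Sum>z\<in>{1..n}. \<Sum>d\<in>UNIV. g (z, d, Free)) + (\<Sum>z\<in>{1..n}. \<Sum>d\<in>UNIV. g (z, d, Fwd)) +
    (\<Sum>z\<in>{1..n}. \<Sum>d\<in>UNIV. g (z, d, Bwd))" for g :: "state \<Rightarrow> real"
proof -
  have "(\<Sum>p\<in>states. g p) = (\<Sum>z\<in>{1..n}. \<Sum>d\<in>UNIV. \<Sum>m\<in>UNIV. g (z, d, m))"
    by (simp add: sum.cartesian_product)
  then show ?thesis by (simp add: UNIV_mode sum.distrib)
qed

text \<open>From a vertex of the path there is at most one matched step in each direction, so the
  sums over these two modes have at most one nonzero term.\<close>

lemma sum_single_le: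
  assumes "finite X" "finite Y" "\<And>z d. z \<in> X \<Longrightarrow> d \<in> Y \<Longrightarrow> (z, d) \<noteq> (za, da) \<Longrightarrow> g z d = 0" "0 \<le> b" "g za da \<le> b"
  shows "(\<Sum>z\<in>X. \<Sum>d\<in>Y. g z d) \<le> (b :: real)"
proof -
  have "(\<Sum>z\<in>X. \<Sum>d\<in>Y. g z d) = (\<Sum>p\<in>X \<times> Y. g (fst p) (snd p))"
    by (simp add: sum.cartesian_product case_prod_unfold)
  also have "\<dots> = (\<Sum>p\<in>(X \<times> Y) \<inter> {(za, da)}. g (fst p) (snd p))"
  proof (intro sum.mono_neutral_right ballI)
    fix p assume "p \<in> X \<times> Y - (X \<times> Y) \<inter> {(za, da)}"
    then show "g (fst p) (snd p) = 0" by (intro assms(3)) (auto simp: prod_eq_iff)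
  qed (use assms(1,2) in auto)
  also have "\<dots> \<le> b" using assms(4,5) by (cases "(za, da) \<in> X \<times> Y") (auto simp: Int_insert_right)
  finally show ?thesis .
qed

text \<open>Induction on the number of remaining steps: one walk step applied to the potential for
  \<open>k\<close> steps is at most \<open>A\<close> times the potential for \<open>Suc k\<close>.
  The error terms are absorbed by the growth of \<open>D\<close>.\<close>

lemma walk_sum_le:
  assumes "k \<le> l" "valid_state st"
  shows "walk_sum k st \<le> A ^ k * potential k st"
  using assms
proof (induction k arbitrary: st)
  case 0
  obtain x d m where st: "st = (x, d, m)" by (cases st)
  show ?case
  proof (cases "x = s ! l")
    case True
    have "x \<in> set s" using True path by (simp add: dpath_def)
    \<comment> \<open>At the end of the path with no step left the walk earns the factor
      \<open>n\<close>. The term of \<open>potential\<close> that pays for it is present since mode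
      \<open>Bwd\<close> cannot occur at \<open>s ! l\<close>.\<close>
    moreover have "m \<noteq> Bwd" using 0 st True nth_eq_dpath[OF path] by (auto simp: valid_state_def)
    moreover have "0 \<le> B1 * D 0" "0 \<le> B2 * D 0" using B1_ge(1) B2_ge q D_ge_1[of 0] by simp_all
    moreover have "1 * real n \<le> q * real n" using q by (intro mult_right_mono) auto
    ultimately show ?thesis using True st by (auto simp: walk_sum_0 potential_def)
  next
    case False
    then show ?thesis using st potential_nonneg[of 0 st] by (simp add: walk_sum_0)
  qed
next
  case (Suc k)
  obtain x d m where st: "st = (x, d, m)" by (cases st)
  have kl: "k \<le> l" using Suc by simp
  have A0: "0 < A" "0 < A ^ k" "1 \<le> A ^ k" "1 \<le> A * A ^ k"
    using A_gt_1 one_le_power[of A k] one_le_power[of A "Suc k"] by simp_all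
  have D1: "1 \<le> D k" by (rule D_ge_1)
  have step0: "0 \<le> walk_step st p" for p
    using st vertex_factor_nonneg by (cases p) auto
  let ?g = "\<lambda>p. walk_step st p * (A ^ k * potential k p)"
  have "walk_sum (Suc k) st \<le> (\<Sum>p\<in>states. ?g p)"
    unfolding walk_sum_Suc
  proof (rule sum_mono)
    fix p assume "p \<in> states"
    show "walk_step st p * walk_sum k p \<le> ?g p"
    proof (cases "walk_step st p = 0")
      case False
      obtain z d' m' where p: "p = (z, d', m')" by (cases p)
      have "step_ok x z d' m'" using False st p by (auto split: if_splits)
      then have "valid_state p"
        using p path by (cases m') (auto simp: step_ok_def valid_state_def dpath_def)
      then show ?thesis using Suc.IH[OF kl] step0 by (intro mult_left_mono)
    qed simp
  qed
  also have "\<dots> = (\<Sum>z\<in>{1..n}. \<Sum>d\<in>UNIV. ?g (z, d, Free)) + (\<Sum>z\<in>{1..n}. \<Sum>d\<in>UNIV. ?g (z, d, Fwd)) +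
    (\<Sum>z\<in>{1..n}. \<Sum>d\<in>UNIV. ?g (z, d, Bwd))" (is "_ = ?F + ?U + ?B")
    by (rule sum_states)
  finally have le: "walk_sum (Suc k) st \<le> ?F + ?U + ?B" .
  have F_eq: "?F = A ^ k * (\<Sum>z\<in>{1..n}. \<Sum>d'\<in>UNIV. vertex_factor x d m d' Free * ((L d')\<^sup>2 / n) * potential k (z, d', Free))"
    by (simp add: st step_ok_def sum_distrib_left ac_simps)
  define T where "T = \<theta> * D k + 2 * q / A ^ k"
  have DS: "A ^ Suc k * (D k * (1 + \<theta>)) + 2 * q \<le> A ^ Suc k * D (Suc k)"
    using mult_left_mono[OF D_Suc[of k], of "A ^ Suc k"] A0 by (simp add: distrib_left)
  have AT: "A ^ k * T = A ^ k * (\<theta> * D k) + 2 * q" using A0 by (simp add: T_def distrib_left)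
  show ?case
  proof (cases "x \<in> set s")
    case False
    then have m: "m = Free" using Suc.prems st by (auto simp: valid_state_def dpath_def)
        (metis path dpath_def less_SucI nth_mem)
    have nok: "\<not> step_ok x z d' m'" if "m' \<noteq> Free" for z d' m'
      using False that path by (cases m') (auto simp: step_ok_def dpath_def)
    have UB: "?U = 0" "?B = 0" using nok by (simp_all add: st)
    have vf: "vertex_factor x d m d' Free = (if d = d' then 1 else \<rho>\<^sup>2)" for d'
      using False by (simp add: vertex_factor_def)
    have "?F = A ^ k * (\<Sum>z\<in>{1..n}. \<Sum>d'\<in>UNIV. (if d = d' then 1 else \<rho>\<^sup>2) * ((L d')\<^sup>2 / n) * potential k (z, d', Free))"
      unfolding F_eq vf ..
    also have "\<dots> \<le> A ^ k * ((\<Sum>d'\<in>UNIV. (if d = d' then 1 else \<rho>\<^sup>2) * (L d')\<^sup>2 * h d') * D k + T)"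
      using free_steps_le[of "\<lambda>d'. if d = d' then 1 else \<rho>\<^sup>2" k] rho_sq A0
      by (intro mult_left_mono) (auto simp: T_def add.assoc)
    also have "\<dots> = A ^ Suc k * (h d * D k) + A ^ k * (\<theta> * D k) + 2 * q"
      unfolding eigen distrib_left AT by (simp add: ac_simps)
    \<comment> \<open>The error terms carry no eigenvector entry; \<open>1 \<le> h d\<close>
      supplies it, and \<open>1 < A\<close> supplies the missing power of \<open>A\<close>.\<close>
    also have "\<dots> \<le> h d * (A ^ Suc k * (D k * (1 + \<theta>)) + 2 * q)"
    proof -
      have "0 \<le> \<theta> * D k" using theta_nonneg D1 by simp
      then have "A ^ k * (\<theta> * D k) \<le> A ^ Suc k * (\<theta> * D k)"
        using A_gt_1 A0 by (intro mult_right_mono) auto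
      also have "\<dots> \<le> h d * (A ^ Suc k * (\<theta> * D k))"
        using mult_right_mono[OF h(1)[of d], of "A ^ Suc k * (\<theta> * D k)"] A0 \<open>0 \<le> \<theta> * D k\<close> by simp
      finally have 1: "A ^ k * (\<theta> * D k) \<le> h d * (A ^ Suc k * (\<theta> * D k))" .
      have "1 * (2 * q) \<le> h d * (2 * q)" using h(1)[of d] q by (intro mult_right_mono) auto
      with 1 show ?thesis by (simp add: algebra_simps)
    qed
    also have "\<dots> \<le> h d * (A ^ Suc k * D (Suc k))"
      using h(1)[of d] DS by (intro mult_left_mono) auto
    finally show ?thesis using le UB False st by (simp add: potential_def ac_simps)
  next
    case True
    then obtain j where j: "j \<le> l" "x = s ! j"
      using path by (auto simp: dpath_def in_set_conv_nth less_Suc_eq_le)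
    have vf: "vertex_factor x d m d' m' = (if m \<noteq> Free \<and> m = m' then 1 else q)" for d' m'
      using True by (simp add: vertex_factor_def)
    let ?r = "if x = s ! (l - Suc k) then n / A ^ k else 0"
    let ?q = "if m = Free then q else 1"
    have qpos: "0 \<le> ?q" "0 \<le> B1 * D k" "0 \<le> ?r" using q B1_ge(1) D1 A0 by auto
    have "?F = A ^ k * (q * (\<Sum>z\<in>{1..n}. \<Sum>d'\<in>UNIV. 1 * ((L d')\<^sup>2 / n) * potential k (z, d', Free)))"
      unfolding F_eq vf by (simp add: sum_distrib_left ac_simps)
    also have "\<dots> \<le> A ^ k * (q * (2 * hm * D k + T))"
    proof -
      have "(L d')\<^sup>2 * h d' \<le> 1 * hm" for d'
        using h[of d'] L[of d'] by (intro mult_mono) (auto simp: power_le_one)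
      from this[of Bullet] this[of Circ] have "(\<Sum>d'\<in>UNIV. 1 * (L d')\<^sup>2 * h d') \<le> 2 * hm"
        by (simp add: UNIV_decoration)
      then have "(\<Sum>d'\<in>UNIV. 1 * (L d')\<^sup>2 * h d') * D k \<le> 2 * hm * D k"
        using D1 by (intro mult_right_mono) auto
      then show ?thesis
        using free_steps_le[of "\<lambda>_. 1" k] q A0 by (intro mult_left_mono) (auto simp: T_def)
    qed
    also have "\<dots> = A ^ k * (2 * q * hm * D k) + q * (A ^ k * (\<theta> * D k)) + 2 * q * q"
      using AT by (simp add: distrib_left mult.left_commute[of _ q])
    finally have F: "?F \<le> A ^ k * (2 * q * hm * D k) + q * (A ^ k * (\<theta> * D k)) + 2 * q * q" .
    have U: "?U \<le> (if m = Bwd then 0 else ?q * (A ^ k * (B1 * D k + ?r)))"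
    proof (rule sum_single_le[where za = "s ! Suc j" and da = "w ! j"])
      fix z d' assume "(z, d') \<noteq> (s ! Suc j, w ! j)"
      then have "\<not> step_ok x z d' Fwd"
        using j nth_eq_dpath[OF path] by (auto simp: step_ok_def)
      then show "?g (z, d', Fwd) = 0" by (simp add: st)
    next
      show "0 \<le> (if m = Bwd then 0 else ?q * (A ^ k * (B1 * D k + ?r)))"
        using qpos A0 by simp
    next
      show "?g (s ! Suc j, w ! j, Fwd) \<le> (if m = Bwd then 0 else ?q * (A ^ k * (B1 * D k + ?r)))"
      proof (cases "step_ok x (s ! Suc j) (w ! j) Fwd \<and> m \<noteq> Bwd")
        case True
        then obtain j' where "j' < l" "s ! j = s ! j'" using j by (auto simp: step_ok_def)
        then have jl: "j < l" using nth_eq_dpath[OF path, of j j'] j by simp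
        \<comment> \<open>A forward step advances position and clock together, so the term of order
          \<open>n\<close> is handed on from \<open>Suc k\<close> to \<open>k\<close> remaining
          steps.\<close>
        have "s ! Suc j = s ! (l - k) \<longleftrightarrow> j = l - Suc k" "x = s ! (l - Suc k) \<longleftrightarrow> j = l - Suc k"
          using nth_eq_dpath[OF path] jl j Suc.prems(1) by auto
        moreover have "s ! Suc j \<in> set s" using path jl by (simp add: dpath_def)
        ultimately have "potential k (s ! Suc j, w ! j, Fwd) = B1 * D k + ?r"
          by (simp add: potential_def)
        moreover have "walk_step st (s ! Suc j, w ! j, Fwd) = ?q"
          using True vf[of "w ! j" Fwd] by (cases m) (simp_all add: st)
        ultimately show ?thesis using True by simp
      next
        case False
        then have g0: "?g (s ! Suc j, w ! j, Fwd) = 0" by (cases m) (auto simp: st)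
        show ?thesis by (rule order_trans[OF eq_refl[OF g0]]) (use qpos A0 in simp)
      qed
    qed simp_all
    \<comment> \<open>Backward runs move away from the end and never carry the term of order
      \<open>n\<close>. For \<open>j = 0\<close> no backward step exists, so the truncated index
      \<open>j - 1\<close> is harmless.\<close>
    have Bw: "?B \<le> (if m = Fwd then 0 else ?q * (A ^ k * (B1 * D k)))"
    proof (rule sum_single_le[where za = "s ! (j - 1)" and da = "w ! (j - 1)"])
      fix z d' assume "(z, d') \<noteq> (s ! (j - 1), w ! (j - 1))"
      then have "\<not> step_ok x z d' Bwd"
        using j nth_eq_dpath[OF path] by (auto simp: step_ok_def)
      then show "?g (z, d', Bwd) = 0" by (simp add: st)
    next
      show "0 \<le> (if m = Fwd then 0 else ?q * (A ^ k * (B1 * D k)))"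
        using qpos A0 by simp
    next
      show "?g (s ! (j - 1), w ! (j - 1), Bwd) \<le> (if m = Fwd then 0 else ?q * (A ^ k * (B1 * D k)))"
      proof (cases "step_ok x (s ! (j - 1)) (w ! (j - 1)) Bwd \<and> m \<noteq> Fwd")
        case True
        have "s ! (j - 1) \<in> set s" using path j by (simp add: dpath_def)
        then have "potential k (s ! (j - 1), w ! (j - 1), Bwd) = B1 * D k"
          by (simp add: potential_def)
        moreover have "walk_step st (s ! (j - 1), w ! (j - 1), Bwd) = ?q"
          using True vf[of "w ! (j - 1)" Bwd] by (cases m) (simp_all add: st)
        ultimately show ?thesis using True by simp
      next
        case False
        then have g0: "?g (s ! (j - 1), w ! (j - 1), Bwd) = 0" by (cases m) (auto simp: st)
        show ?thesis by (rule order_trans[OF eq_refl[OF g0]]) (use qpos A0 in simp)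
      qed
    qed simp_all
    have r: "A ^ k * (B1 * D k + ?r) = A ^ k * (B1 * D k) + (if x = s ! (l - Suc k) then real n else 0)"
      using A0 by (simp add: distrib_left)
    have AA: "A ^ k \<le> A ^ Suc k" using A_gt_1 A0 by simp
    have tD: "0 \<le> \<theta> * D k" "0 \<le> D k" using theta_nonneg D1 by simp_all
    have thD: "0 \<le> A ^ k * (\<theta> * D k)" "A ^ k * (\<theta> * D k) \<le> A ^ Suc k * (\<theta> * D k)"
      using tD A0 mult_right_mono[OF AA tD(1)] by simp_all
    have AD: "0 \<le> A ^ k * D k" "A ^ k * D k \<le> A ^ Suc k * D k"
      using tD A0 mult_right_mono[OF AA tD(2)] by simp_all
    have target: "b * (A ^ Suc k * (D k * (1 + \<theta>)) + 2 * q) \<le> A ^ Suc k * (b * D (Suc k))" if "0 \<le> b" for b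
      using mult_left_mono[OF DS that] by (simp add: ac_simps)
    have qth: "q * (A ^ k * (\<theta> * D k)) + 2 * q * q \<le> b * (A ^ Suc k * (\<theta> * D k)) + b * (2 * q)" if "q \<le> b" for b
    proof -
      have "q * (A ^ k * (\<theta> * D k)) \<le> b * (A ^ Suc k * (\<theta> * D k))"
        using mult_mono[OF that thD(2) _ thD(1)] that q by simp
      moreover have "q * (2 * q) \<le> b * (2 * q)" using that q by (intro mult_right_mono) auto
      ultimately show ?thesis by (simp add: ac_simps)
    qed
    show ?thesis
    proof (cases "m = Free")
      case True
      have "walk_sum (Suc k) st \<le> A ^ k * (2 * q * hm * D k) + q * (A ^ k * (\<theta> * D k)) + 2 * q * q
          + q * (A ^ k * (B1 * D k) + (if x = s ! (l - Suc k) then real n else 0)) + q * (A ^ k * (B1 * D k))"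
        using le F U Bw True r by simp
      also have "\<dots> = B2 * (A ^ k * D k) + (q * (A ^ k * (\<theta> * D k)) + 2 * q * q)
          + q * (if x = s ! (l - Suc k) then real n else 0)"
        by (simp add: B2_def algebra_simps)
      also have "\<dots> \<le> B2 * (A ^ Suc k * D k) + (B2 * (A ^ Suc k * (\<theta> * D k)) + B2 * (2 * q))
          + q * (if x = s ! (l - Suc k) then real n else 0)"
        using qth[OF B2_ge(1)] mult_left_mono[OF AD(2) B2_ge(2)] by linarith
      also have "\<dots> \<le> A ^ Suc k * (B2 * D (Suc k)) + q * (if x = s ! (l - Suc k) then real n else 0)"
        using target[OF B2_ge(2)] by (simp add: algebra_simps)
      also have "\<dots> = A ^ Suc k * potential (Suc k) st"
        using True A0 \<open>x \<in> set s\<close> by (simp add: potential_def st distrib_left)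
      finally show ?thesis .
    next
      case False
      have b0: "0 \<le> B1" using B1_ge(1) q by simp
      \<comment> \<open>Here the choice of \<open>B1\<close> enters: the run may be left or
        continued, and both together fit into \<open>A * B1\<close>.\<close>
      have "A ^ k * (2 * q * hm * D k) + A ^ k * (B1 * D k) = (B1 + 2 * q * hm) * (A ^ k * D k)"
        by (simp add: algebra_simps)
      also have "\<dots> \<le> (A * B1) * (A ^ k * D k)"
        by (rule mult_right_mono[OF B1_ge(2) AD(1)])
      finally have 1: "A ^ k * (2 * q * hm * D k) + A ^ k * (B1 * D k) \<le> B1 * (A ^ Suc k * D k)"
        by (simp add: ac_simps)
      let ?n = "if x = s ! (l - Suc k) \<and> m \<noteq> Bwd then real n else 0"
      have "walk_sum (Suc k) st \<le> A ^ k * (2 * q * hm * D k) + q * (A ^ k * (\<theta> * D k)) + 2 * q * q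
          + A ^ k * (B1 * D k) + ?n"
        using le F U Bw False r by (cases m) auto
      also have "\<dots> \<le> B1 * (A ^ Suc k * D k) + (B1 * (A ^ Suc k * (\<theta> * D k)) + B1 * (2 * q)) + ?n"
        using qth[OF B1_ge(1)] 1 by linarith
      also have "\<dots> \<le> A ^ Suc k * (B1 * D (Suc k)) + ?n"
        using target[OF b0] by (simp add: algebra_simps)
      also have "\<dots> = A ^ Suc k * potential (Suc k) st"
        using False A0 \<open>x \<in> set s\<close> by (auto simp: potential_def st distrib_left)
      finally show ?thesis .
    qed
  qed
qed

lemma D_le: "D k \<le> (1 + \<theta>) ^ k * (1 + 2 * q / (A - 1))"
proof -
  have "(\<Sum>i\<in>{1..k}. (1 / A) ^ i) = (1 - (1 / A) ^ k) / (A - 1)"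
  proof (induction k)
    case (Suc k)
    have "(1 - (1 / A) ^ k) / (A - 1) + (1 / A) ^ Suc k = (1 - (1 / A) ^ Suc k) / (A - 1)"
      using A_gt_1 by (simp add: divide_simps) (simp add: algebra_simps)
    then show ?case using Suc by simp
  qed simp
  also have "\<dots> \<le> 1 / (A - 1)" using A_gt_1 by (simp add: divide_right_mono)
  finally have "2 * q * (\<Sum>i\<in>{1..k}. (1 / A) ^ i) \<le> 2 * q * (1 / (A - 1))"
    using q by (intro mult_left_mono) auto
  then show ?thesis
    unfolding D_def using theta_nonneg by (intro mult_left_mono) auto
qed

text \<open>The term \<open>q * n\<close> comes from the walk that follows the whole path along
  matched edges. It is absorbed later by \<open>n \<le> A ^ l\<close>.\<close>

lemma walk_sum_start_le:
  "walk_sum l (s ! 0, d, Free) \<le> A ^ l * (B2 * ((1 + \<theta>) ^ l * (1 + 2 * q / (A - 1)))) + q * n"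
proof -
  have "s ! 0 \<in> set s" using path by (simp add: dpath_def)
  then have "walk_sum l (s ! 0, d, Free) \<le> A ^ l * (B2 * D l + q * n / A ^ l)"
    using walk_sum_le[of l "(s ! 0, d, Free)"] by (simp add: valid_state_def potential_def)
  also have "\<dots> = A ^ l * (B2 * D l) + q * n"
    using A_gt_1 by (simp add: distrib_left)
  also have "\<dots> \<le> A ^ l * (B2 * ((1 + \<theta>) ^ l * (1 + 2 * q / (A - 1)))) + q * n"
    using D_le B2_ge A_gt_1 q by (intro add_mono mult_left_mono) auto
  finally show ?thesis .
qed

end

subsection \<open>Pairs of paths\<close>

definition edge_key :: "nat list \<Rightarrow> decoration list \<Rightarrow> nat \<Rightarrow> decoration \<times> nat \<times> nat" where
  "edge_key s w j = (w ! j, min (s ! j) (s ! Suc j), max (s ! j) (s ! Suc j))"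

lemma edge_key_eq_iff: "edge_key s w j = edge_key t v i \<longleftrightarrow> w ! j = v ! i \<and> {s ! j, s ! Suc j} = {t ! i, t ! Suc i}"
  by (auto simp: edge_key_def doubleton_eq_iff min_def max_def split: if_splits)

lemma inj_on_edge_key:
  assumes "dpath l s w"
  shows "inj_on (edge_key s w) {..<l}"
  using path_edge_eq_iff[OF assms] by (auto simp: inj_on_def edge_key_eq_iff)

text \<open>Expanding each entry into signal plus noise selects sets \<open>B\<close>, \<open>A\<close> of edges of the two paths that
  contribute noise; by orthonormality only pairs with the same noise variables survive.\<close>

definition matched :: "nat \<Rightarrow> nat list \<Rightarrow> decoration list \<Rightarrow> nat list \<Rightarrow> decoration list \<Rightarrow> (nat set \<times> nat set) set" where
  "matched l s w t v = {(B, A). B \<subseteq> {..<l} \<and> A \<subseteq> {..<l} \<and> edge_key s w ` B = edge_key t v ` A}"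

lemma finite_matched [simp]: "finite (matched l s w t v)"
  by (rule finite_subset[of _ "Pow {..<l} \<times> Pow {..<l}"]) (auto simp: matched_def)

lemma nth_at_edge:
  assumes "dpath l s w" "j \<le> l" "j' < l" "s ! j \<in> {s ! j', s ! Suc j'}"
  shows "j' = j \<or> Suc j' = j"
  using assms nth_eq_dpath[OF assms(1)] by auto

text \<open>The contribution to the \<open>j\<close>-th vertex of the (at most two) signal edges there; \<open>B\<close> is the set of
  noise edges.\<close>

definition half_edges :: "nat \<Rightarrow> decoration list \<Rightarrow> nat set \<Rightarrow> nat \<Rightarrow> real \<times> real \<Rightarrow> real" where
  "half_edges l w B j p =
     (if j < l \<and> j \<notin> B then coord (w ! j) p else 1) *
     (if 0 < j \<and> j - 1 \<notin> B then coord (w ! (j - 1)) p else 1)"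

text \<open>A signal edge contributes one coordinate at each of its ends. Regrouping by position
  prepares the factorisation of the expectation over vertices.\<close>

lemma prod_half_edges:
  "(\<Prod>j\<in>{..<l} - B. coord (w ! j) (p (s ! j)) * coord (w ! j) (p (s ! Suc j))) =
    (\<Prod>j\<le>l. half_edges l w B j (p (s ! j)))"
proof -
  have "(\<Prod>j\<in>{..<l} - B. coord (w ! j) (p (s ! j))) =
      (\<Prod>j\<in>{..<l}. if j \<notin> B then coord (w ! j) (p (s ! j)) else 1)"
    by (subst prod.inter_filter[symmetric]) (auto intro!: prod.cong)
  also have "\<dots> = (\<Prod>j\<le>l. if j < l \<and> j \<notin> B then coord (w ! j) (p (s ! j)) else 1)"
    by (rule prod.mono_neutral_cong_left) auto
  finally have 1: "(\<Prod>j\<in>{..<l} - B. coord (w ! j) (p (s ! j))) = \<dots>" .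
  have "(\<Prod>j\<in>{..<l} - B. coord (w ! j) (p (s ! Suc j))) =
      (\<Prod>j\<in>{..<l}. if j \<notin> B then coord (w ! j) (p (s ! Suc j)) else 1)"
    by (subst prod.inter_filter[symmetric]) (auto intro!: prod.cong)
  also have "\<dots> = (\<Prod>j\<le>l. if 0 < j \<and> j - 1 \<notin> B then coord (w ! (j - 1)) (p (s ! j)) else 1)"
    unfolding lessThan_Suc_atMost[symmetric] by (subst prod.lessThan_Suc_shift) (simp cong: if_cong)
  finally have 2: "(\<Prod>j\<in>{..<l} - B. coord (w ! j) (p (s ! Suc j))) = \<dots>" .
  show ?thesis unfolding prod.distrib half_edges_def 1 2 ..
qed

lemma prod_over_vertices:
  assumes "length s = Suc l" "set s \<subseteq> {1..n}"
  shows "(\<Prod>j\<le>l. g j (s ! j)) = (\<Prod>x\<in>{1..n :: nat}. \<Prod>j\<in>{j \<in> {..l}. s ! j = x}. g j x)"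
proof -
  have "(\<Prod>x\<in>{1..n}. \<Prod>j\<in>{j \<in> {..l}. s ! j = x}. g j x) =
      (\<Prod>x\<in>{1..n}. \<Prod>j\<in>{j \<in> {..l}. s ! j = x}. g j (s ! j))"
    by (intro prod.cong refl) auto
  also have "\<dots> = (\<Prod>j\<le>l. g j (s ! j))"
    using assms nth_mem[of _ s] by (intro prod.group) (auto simp: less_Suc_eq_le)
  finally show ?thesis ..
qed

lemma (in planted_walk) walk_weight_eq:
  "walk_weight st ps =
    (\<Prod>i<length ps. walk_step ((st # ps) ! i) (ps ! i)) * (if fst (last (st # ps)) = s ! l then real n else 0)"
proof (induction ps arbitrary: st)
  case (Cons p ps)
  show ?case unfolding walk_weight.simps Cons by (simp add: prod.lessThan_Suc_shift del: prod.lessThan_Suc)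
qed simp

section \<open>Expectations over the prior for a pair of paths\<close>

locale spiked = prior \<rho> C \<pi> for \<rho> C \<pi> +
  fixes lam \<mu> :: real and n l :: nat
  assumes lam: "0 < lam" "lam \<le> 1" and mu: "0 < \<mu>" "\<mu> \<le> 1" and rho: "0 < \<rho>" "\<rho> < 1"
    and n_pos: "0 < n" and l_ge: "2 \<le> l"
begin

text \<open>Bounds the expectation of any product of at most four coordinates at one vertex, by
  \<open>integrable_quartic\<close>.\<close>

definition M :: real where "M = 1 + 2 * C"

lemma M_ge: "1 \<le> M" using C_ge_1 by (simp add: M_def)

abbreviation L :: "decoration \<Rightarrow> real" where "L \<equiv> edge_weight lam \<mu>"

abbreviation weight :: "decoration list \<Rightarrow> real" where "weight \<equiv> word_weight lam \<mu> \<rho>"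

lemma L: "0 < L d" "L d \<le> 1" using lam mu by (cases d; simp add: edge_weight_def)+

abbreviation P1 :: "(nat \<Rightarrow> real \<times> real) measure" where "P1 \<equiv> Pi\<^sub>M {1..n} (\<lambda>_. \<pi>)"

definition signal :: "nat list \<Rightarrow> decoration list \<Rightarrow> nat set \<Rightarrow> (nat \<Rightarrow> real \<times> real) \<Rightarrow> real" where
  "signal s w B p = (\<Prod>j\<in>{..<l} - B. L (w ! j) / sqrt n * coord (w ! j) (p (s ! j)) * coord (w ! j) (p (s ! Suc j)))"

definition amp :: "decoration list \<Rightarrow> nat set \<Rightarrow> real" where
  "amp w B = (\<Prod>j\<in>{..<l} - B. L (w ! j) / sqrt n)"

definition at_vertex :: "nat list \<Rightarrow> decoration list \<Rightarrow> nat set \<Rightarrow> nat \<Rightarrow> real \<times> real \<Rightarrow> real" where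
  "at_vertex s w B x p = (\<Prod>j\<in>{j \<in> {..l}. s ! j = x}. half_edges l w B j p)"

lemma signal_eq:
  assumes "length s = Suc l" "set s \<subseteq> {1..n}"
  shows "signal s w B p = amp w B * (\<Prod>x\<in>{1..n}. at_vertex s w B x (p x))"
proof -
  have "signal s w B p = amp w B * (\<Prod>j\<in>{..<l} - B. coord (w ! j) (p (s ! j)) * coord (w ! j) (p (s ! Suc j)))"
    unfolding signal_def amp_def prod.distrib[symmetric] by (simp only: mult.assoc)
  then show ?thesis
    unfolding prod_half_edges at_vertex_def prod_over_vertices[OF assms, of "\<lambda>j x. half_edges l w B j (p x)"] .
qed

lemma at_vertex_nth:
  assumes "dpath l s w" "j \<le> l"
  shows "at_vertex s w' B (s ! j) p = half_edges l w' B j p"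
proof -
  have "{i \<in> {..l}. s ! i = s ! j} = {j}" using nth_eq_dpath[OF assms(1)] assms(2) by auto
  then show ?thesis by (simp add: at_vertex_def)
qed

lemma at_vertex_notin:
  assumes "length s = Suc l" "x \<notin> set s"
  shows "at_vertex s w B x p = 1"
proof -
  have "{i \<in> {..l}. s ! i = x} = {}" using assms by (auto simp: less_Suc_eq_le)
  then show ?thesis unfolding at_vertex_def by (simp only: prod.empty)
qed

lemma measurable_half_edges [measurable]: "half_edges l w B j \<in> borel_measurable borel"
  unfolding half_edges_def by measurable

lemma measurable_at_vertex [measurable]: "at_vertex s w B x \<in> borel_measurable borel"
  unfolding at_vertex_def by measurable

text \<open>The flag \<open>b\<close> switches on the squared coordinates at both ends, so that one
  argument covers both required second moments.\<close>

definition end_weight :: "bool \<Rightarrow> nat \<Rightarrow> nat \<Rightarrow> nat \<Rightarrow> real \<times> real \<Rightarrow> real" where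
  "end_weight b u v x p = (if b \<and> x \<in> {u, v} then coord Bullet p * coord Bullet p else 1)"

definition pair_vertex where
  "pair_vertex b s w B t v A x p =
    end_weight b (s ! 0) (s ! l) x p * at_vertex s w B x p * at_vertex t v A x p"

lemma measurable_pair_vertex [measurable]: "pair_vertex b s w B t v A x \<in> borel_measurable borel"
  unfolding pair_vertex_def end_weight_def by measurable

text \<open>What an interior vertex of the first path alone contributes when both its edges are
  signal edges. The product over the path is exactly the power of \<open>\<rho>\<close> in the word
  weight, as needed to obtain its square.\<close>

definition path_vertex_bound :: "decoration list \<Rightarrow> nat \<Rightarrow> real" where
  "path_vertex_bound w j = (if 0 < j \<and> j < l then change \<rho> w j else 1)"

text \<open>At a vertex of both paths \<open>path_vertex_bound\<close> already charges a factor at least \<open>\<rho>\<close>, which has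
  to be divided out here.\<close>

definition pair_vertex_bound :: "nat list \<Rightarrow> nat list \<Rightarrow> decoration list \<Rightarrow> nat set \<Rightarrow> nat \<Rightarrow> real" where
  "pair_vertex_bound s t v A i =
    (if i = 0 \<or> i = l then M
     else if t ! i \<notin> set s then change \<rho> v i
     else if i - 1 \<in> A \<and> i \<in> A then 1 / change \<rho> v i else M / \<rho>)"

lemma change_bounds: "\<rho> \<le> change \<rho> w i" "change \<rho> w i \<le> 1" "0 < change \<rho> w i"
  using rho by (auto simp: change_def)

lemma abs_le_quartic4:
  assumes "f = (\<lambda>p. a0 p * a1 p * a2 p * a3 p)"
    and "\<And>p. a0 p = 1 \<or> (\<exists>d. a0 p = coord d p)" "\<And>p. a1 p = 1 \<or> (\<exists>d. a1 p = coord d p)"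
    and "\<And>p. a2 p = 1 \<or> (\<exists>d. a2 p = coord d p)" "\<And>p. a3 p = 1 \<or> (\<exists>d. a3 p = coord d p)"
  shows "\<bar>f p\<bar> \<le> 1 + fst p ^ 4 + snd p ^ 4"
proof -
  define a :: "nat \<Rightarrow> real" where
    "a = (\<lambda>i. if i = 0 then a0 p else if i = 1 then a1 p else if i = 2 then a2 p else a3 p)"
  have "\<bar>a 0 * a 1 * a 2 * a (3 :: nat)\<bar> \<le> 1 + fst p ^ 4 + snd p ^ 4"
    by (rule coord_prod4_le) (auto simp: a_def assms(2-5))
  then show ?thesis by (simp add: a_def assms(1))
qed

definition run_mode :: "nat list \<Rightarrow> nat list \<Rightarrow> nat set \<Rightarrow> nat \<Rightarrow> mode" where
  "run_mode s t A i = (if i \<notin> A then Free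
     else if \<exists>j<l. t ! i = s ! j \<and> t ! Suc i = s ! Suc j then Fwd else Bwd)"

text \<open>The matched set of the first path is not recorded: it is determined by \<open>A\<close>
  through the common noise variables.\<close>

definition walk_of :: "nat list \<Rightarrow> nat list \<Rightarrow> decoration list \<Rightarrow> nat set \<Rightarrow> (nat \<times> decoration \<times> mode) list" where
  "walk_of s t v A = map (\<lambda>i. (t ! Suc i, v ! i, run_mode s t A i)) [0..<l]"

text \<open>An interior vertex of a path has two edges, an end only one. The vacant slot at the ends
  makes room for the two coordinates in \<open>end_weight\<close>.\<close>

lemma at_vertex_factors:
  assumes p: "dpath l s' w'"
  shows "\<exists>a a'. at_vertex s' w' B' x = (\<lambda>p. a p * a' p) \<and>
      (\<forall>p. a p = 1 \<or> (\<exists>d. a p = coord d p)) \<and> (\<forall>p. a' p = 1 \<or> (\<exists>d. a' p = coord d p)) \<and>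
      (x \<in> {s' ! 0, s' ! l} \<longrightarrow> a' = (\<lambda>_. 1))"
  proof (cases "x \<in> set s'")
    case False
    then have "at_vertex s' w' B' x = (\<lambda>p. 1)" using at_vertex_notin[of s' x] p by (auto simp: dpath_def)
    then show ?thesis by (intro exI[of _ "\<lambda>_. 1"]) auto
  next
    case True
    then obtain j where j: "j \<le> l" "x = s' ! j"
      using p by (auto simp: dpath_def in_set_conv_nth less_Suc_eq_le)
    have eq: "at_vertex s' w' B' x = half_edges l w' B' j"
      using at_vertex_nth[OF p j(1)] j(2) by auto
    have ends': "x \<in> {s' ! 0, s' ! l} \<longleftrightarrow> j = 0 \<or> j = l"
      using nth_eq_dpath[OF p] j by auto
    show ?thesis
    proof (cases "j = 0")
      case True
      then show ?thesis unfolding eq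
        by (intro exI[of _ "\<lambda>p. if j < l \<and> j \<notin> B' then coord (w' ! j) p else 1"] exI[of _ "\<lambda>_. 1"])
          (auto simp: half_edges_def)
    next
      case False
      then show ?thesis unfolding eq ends'
        by (intro exI[of _ "\<lambda>p. if 0 < j \<and> j - 1 \<notin> B' then coord (w' ! (j - 1)) p else 1"]
              exI[of _ "\<lambda>p. if j < l \<and> j \<notin> B' then coord (w' ! j) p else 1"])
          (auto simp: half_edges_def)
    qed
  qed

lemma integral_interior:
  assumes "0 < j" "j < l" "j \<notin> B'" "j - 1 \<notin> B'"
  shows "has_bochner_integral \<pi> (half_edges l w' B' j) (change \<rho> w' j)"
  using coord_moment2[of "w' ! j" "w' ! (j - 1)"] assms
  unfolding half_edges_def change_def by (simp add: eq_commute)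

definition pair_signal :: "bool \<Rightarrow> nat list \<Rightarrow> decoration list \<Rightarrow> nat set \<Rightarrow> nat list \<Rightarrow> decoration list \<Rightarrow> nat set \<Rightarrow> real" where
  "pair_signal b s w B t v A =
    amp w B * amp v A * (\<Prod>x\<in>{1..n}. integral\<^sup>L \<pi> (pair_vertex b s w B t v A x))"

context
  fixes s t :: "nat list" and w v :: "decoration list" and B A :: "nat set" and b :: bool
  assumes s: "dpath l s w" and t: "dpath l t v"
    and ends: "s ! 0 = t ! 0" "s ! l = t ! l"
begin

text \<open>Each path brings at most two coordinates; at a common end each brings at most one and
  \<open>end_weight\<close> at most two. In all cases there are at most four.\<close>

lemma pair_vertex_quartic: "\<bar>pair_vertex b s w B t v A x p\<bar> \<le> 1 + fst p ^ 4 + snd p ^ 4"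
proof -
  from at_vertex_factors[OF s, of B x] obtain a a' where a: "at_vertex s w B x = (\<lambda>p. a p * a' p) \<and>
      (\<forall>p. a p = 1 \<or> (\<exists>d. a p = coord d p)) \<and> (\<forall>p. a' p = 1 \<or> (\<exists>d. a' p = coord d p)) \<and>
      (x \<in> {s ! 0, s ! l} \<longrightarrow> a' = (\<lambda>_. 1))"
    by (elim exE)
  from at_vertex_factors[OF t, of A x] obtain c c' where c: "at_vertex t v A x = (\<lambda>p. c p * c' p) \<and>
      (\<forall>p. c p = 1 \<or> (\<exists>d. c p = coord d p)) \<and> (\<forall>p. c' p = 1 \<or> (\<exists>d. c' p = coord d p)) \<and>
      (x \<in> {t ! 0, t ! l} \<longrightarrow> c' = (\<lambda>_. 1))"
    by (elim exE)
  have Bul: "coord Bullet p = 1 \<or> (\<exists>d. coord Bullet p = coord d p)" for p by blast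
  note a1 = spec[OF conjunct1[OF conjunct2[OF a]]] and a2 = spec[OF conjunct1[OF conjunct2[OF conjunct2[OF a]]]]
    and c1 = spec[OF conjunct1[OF conjunct2[OF c]]] and c2 = spec[OF conjunct1[OF conjunct2[OF conjunct2[OF c]]]]
  show ?thesis
  proof (cases "b \<and> x \<in> {s ! 0, s ! l}")
    case True
    then have 1: "end_weight b (s ! 0) (s ! l) x p = coord Bullet p * coord Bullet p" for p
      by (simp only: end_weight_def if_True simp_thms)
    from True have xs: "x \<in> {s ! 0, s ! l}" ..
    then have xt: "x \<in> {t ! 0, t ! l}" unfolding ends .
    note a' = mp[OF conjunct2[OF conjunct2[OF conjunct2[OF a]]] xs]
      and c' = mp[OF conjunct2[OF conjunct2[OF conjunct2[OF c]]] xt]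
    then have "pair_vertex b s w B t v A x = (\<lambda>p. coord Bullet p * coord Bullet p * a p * c p)"
      using conjunct1[OF a] conjunct1[OF c] by (intro ext) (simp add: pair_vertex_def 1 a' c')
    then show ?thesis by (rule abs_le_quartic4[OF _ Bul Bul a1 c1])
  next
    case False
    then have 1: "end_weight b (s ! 0) (s ! l) x p = 1" for p
      by (simp only: end_weight_def if_False)
    have "pair_vertex b s w B t v A x = (\<lambda>p. a p * a' p * c p * c' p)"
      using a c by (intro ext) (simp add: pair_vertex_def 1)
    then show ?thesis by (rule abs_le_quartic4[OF _ a1 a2 c1 c2])
  qed
qed

lemma integrable_pair_vertex: "integrable \<pi> (pair_vertex b s w B t v A x)"
  by (rule integrable_quartic(1)[OF measurable_pair_vertex pair_vertex_quartic])

lemma pair_vertex_le_M: "\<bar>integral\<^sup>L \<pi> (pair_vertex b s w B t v A x)\<bar> \<le> M"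
  unfolding M_def by (rule integrable_quartic(2)[OF measurable_pair_vertex pair_vertex_quartic])

lemma pair_signal_expectation:
  assumes "set s \<subseteq> {1..n}" "set t \<subseteq> {1..n}"
  shows "has_bochner_integral P1 (\<lambda>p. (\<Prod>x\<in>{1..n}. end_weight b (s ! 0) (s ! l) x (p x)) *
      (signal s w B p * signal t v A p)) (pair_signal b s w B t v A)"
proof -
  have ls: "length s = Suc l" and lt: "length t = Suc l" using s t by (auto simp: dpath_def)
  have "has_bochner_integral P1 (\<lambda>p. \<Prod>x\<in>{1..n}. pair_vertex b s w B t v A x (p x))
      (\<Prod>x\<in>{1..n}. integral\<^sup>L \<pi> (pair_vertex b s w B t v A x))"
    by (intro has_bochner_integral_PiM_prod prob_space_axioms finite_atLeastAtMost
        has_bochner_integral_integrable integrable_pair_vertex)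
  then have 1: "has_bochner_integral P1 (\<lambda>p. amp w B * amp v A * (\<Prod>x\<in>{1..n}. pair_vertex b s w B t v A x (p x)))
      (pair_signal b s w B t v A)"
    unfolding pair_signal_def by (intro has_bochner_integral_mult_right)
  have eq: "(\<Prod>x\<in>{1..n}. end_weight b (s ! 0) (s ! l) x (p x)) * (signal s w B p * signal t v A p) =
      amp w B * amp v A * (\<Prod>x\<in>{1..n}. pair_vertex b s w B t v A x (p x))" for p
    unfolding signal_eq[OF ls assms(1)] signal_eq[OF lt assms(2)] pair_vertex_def prod.distrib
    by (simp only: ac_simps)
  show ?thesis
    unfolding eq by (rule 1)
qed

end

context
  fixes s t :: "nat list" and w v :: "decoration list" and B A :: "nat set" and b :: bool
  assumes s: "dpath l s w" and t: "dpath l t v"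
    and ends: "s ! 0 = t ! 0" "s ! l = t ! l"
    and BA: "(B, A) \<in> matched l s w t v"
begin

lemmas s' = s and t' = t

lemma matched_edge:
  assumes "i \<in> A"
  obtains j where "j \<in> B" "j < l" "w ! j = v ! i" "{s ! j, s ! Suc j} = {t ! i, t ! Suc i}"
proof -
  have "edge_key t v i \<in> edge_key s w ` B" using BA assms by (auto simp: matched_def)
  then obtain j where "j \<in> B" "edge_key s w j = edge_key t v i" by (metis imageE)
  then show ?thesis using that[of j] BA by (auto simp: matched_def edge_key_eq_iff)
qed

lemma matched_edge':
  assumes "j \<in> B"
  obtains i where "i \<in> A" "i < l" "w ! j = v ! i" "{s ! j, s ! Suc j} = {t ! i, t ! Suc i}"
proof -
  have "edge_key s w j \<in> edge_key t v ` A" using BA assms by (auto simp: matched_def)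
  then obtain i where "i \<in> A" "edge_key s w j = edge_key t v i" by (elim imageE)
  then show ?thesis using that[of i] BA by (auto simp: matched_def edge_key_eq_iff)
qed

lemma interior_iff:
  assumes "j \<le> l" "i \<le> l" "s ! j = t ! i"
  shows "j = 0 \<longleftrightarrow> i = 0" "j = l \<longleftrightarrow> i = l"
proof -
  show "j = 0 \<longleftrightarrow> i = 0"
    using nth_eq_dpath[OF s assms(1), of 0] nth_eq_dpath[OF t assms(2), of 0] assms(3) ends by simp
  show "j = l \<longleftrightarrow> i = l"
    using nth_eq_dpath[OF s assms(1), of l] nth_eq_dpath[OF t assms(2), of l] assms(3) ends by simp
qed

text \<open>Two consecutive matched edges of \<open>t\<close> correspond to distinct edges of
  \<open>s\<close> at the common vertex, which are therefore the two edges of \<open>s\<close>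
  there. No signal edge remains at this vertex, and the pairs of letters agree up to order.\<close>

lemma run_interior:
  assumes i: "0 < i" "i < l" "i - 1 \<in> A" "i \<in> A" and j: "j \<le> l" "s ! j = t ! i"
  shows "j \<in> B" "j - 1 \<in> B" "0 < j" "j < l" "change \<rho> w j = change \<rho> v i"
proof -
  obtain j1 where j1: "j1 \<in> B" "j1 < l" "w ! j1 = v ! i" "{s ! j1, s ! Suc j1} = {t ! i, t ! Suc i}"
    using matched_edge[OF i(4)] .
  obtain j2 where j2: "j2 \<in> B" "j2 < l" "w ! j2 = v ! (i - 1)"
      "{s ! j2, s ! Suc j2} = {t ! (i - 1), t ! Suc (i - 1)}"
    using matched_edge[OF i(3)] .
  have "j1 = j \<or> Suc j1 = j" using nth_at_edge[OF s j(1) j1(2)] j1(4) j(2) by auto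
  moreover have "j2 = j \<or> Suc j2 = j" using nth_at_edge[OF s j(1) j2(2)] j2(4) j(2) i(1) by auto
  moreover have "{t ! i, t ! Suc i} \<noteq> {t ! (i - 1), t ! Suc (i - 1)}"
    unfolding path_edge_eq_iff[OF t i(2) order_le_less_trans[OF diff_le_self i(2)]] using i(1) by simp
  then have "j1 \<noteq> j2" using j1(4) j2(4) by metis
  ultimately have "(j1 = j \<and> Suc j2 = j) \<or> (j2 = j \<and> Suc j1 = j)" by auto
  then show "j \<in> B" "j - 1 \<in> B" "0 < j" "j < l" "change \<rho> w j = change \<rho> v i"
    using j1 j2 by (auto simp: change_def)
qed

text \<open>Vertices of only one of the paths give 1 or \<open>\<rho>\<close> exactly, interior
  vertices of a run give 1, and only the remaining common vertices are estimated by
  \<open>M\<close>.\<close>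

lemma pair_vertex_integral_le:
  "\<bar>integral\<^sup>L \<pi> (pair_vertex b s w B t v A x)\<bar> \<le>
    (\<Prod>j\<in>{j \<in> {..l}. s ! j = x}. path_vertex_bound w j) *
    (\<Prod>i\<in>{i \<in> {..l}. t ! i = x}. pair_vertex_bound s t v A i)"
proof -
  have ls: "length s = Suc l" and lt: "length t = Suc l" using s t by (auto simp: dpath_def)
  have in_s: "x \<in> set s \<longleftrightarrow> (\<exists>j\<le>l. x = s ! j)" and in_t: "x \<in> set t \<longleftrightarrow> (\<exists>j\<le>l. x = t ! j)"
    using ls lt by (auto simp: in_set_conv_nth less_Suc_eq_le)
  have e: "{j \<in> {..l}. s ! j = x} = {}" if "x \<notin> set s" using that in_s by auto
  have e': "{j \<in> {..l}. t ! j = x} = {}" if "x \<notin> set t" using that in_t by auto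
  have sg: "{j \<in> {..l}. s ! j = x} = {j}" if "j \<le> l" "x = s ! j" for j
    using that nth_eq_dpath[OF s] by auto
  have sg': "{j \<in> {..l}. t ! j = x} = {j}" if "j \<le> l" "x = t ! j" for j
    using that nth_eq_dpath[OF t] by auto
  have no_end: "end_weight b (s ! 0) (s ! l) x p = 1" if "x \<noteq> s ! 0" "x \<noteq> s ! l" for p
    using that by (simp add: end_weight_def)
  have endin: "s ! 0 \<in> set s" "s ! l \<in> set s" "s ! 0 \<in> set t" "s ! l \<in> set t"
    using nth_mem[of 0 s] nth_mem[of l s] nth_mem[of 0 t] nth_mem[of l t] ls lt ends by simp_all
  consider (none) "x \<notin> set s" "x \<notin> set t" | (s) "x \<in> set s" "x \<notin> set t"
    | (t) "x \<notin> set s" "x \<in> set t" | (both) "x \<in> set s" "x \<in> set t" by blast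
  then show ?thesis
  proof cases
    case none
    have "x \<noteq> s ! 0" "x \<noteq> s ! l" using none endin by auto
    then have "pair_vertex b s w B t v A x = (\<lambda>_. 1)"
      using no_end by (intro ext) (simp add: pair_vertex_def at_vertex_notin[OF ls none(1)] at_vertex_notin[OF lt none(2)])
    then show ?thesis unfolding e[OF none(1)] e'[OF none(2)] by (simp add: prob_space)
  next
    case s
    then obtain j where j: "j \<le> l" "x = s ! j" using in_s by blast
    have xe: "x \<noteq> s ! 0" "x \<noteq> s ! l" using s endin by auto
    then have "j \<noteq> 0" "j \<noteq> l" using j(2) by (metis, metis)
    then have j': "0 < j" "j < l" using j by auto
    \<comment> \<open>A matched edge belongs to both paths, so at a vertex missing from
      \<open>t\<close> both edges of \<open>s\<close> are signal edges.\<close>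
    have nB: "k \<notin> B" if "k < l" "x \<in> {s ! k, s ! Suc k}" for k
    proof
      assume "k \<in> B"
      then obtain i where "i < l" "{s ! k, s ! Suc k} = {t ! i, t ! Suc i}" by (rule matched_edge')
      then have "x \<in> {t ! i, t ! Suc i}" using that by simp
      then show False using \<open>i < l\<close> s(2) lt by auto
    qed
    have B: "j \<notin> B" "j - 1 \<notin> B" using nB[of j] nB[of "j - 1"] j j' by auto
    have "pair_vertex b s w B t v A x = half_edges l w B j"
      using no_end[OF xe] at_vertex_nth[OF \<open>dpath l s w\<close> j(1), folded j(2)]
      by (intro ext) (simp add: pair_vertex_def at_vertex_notin[OF lt s(2)])
    then show ?thesis
      using integral_interior[OF j' B, of w] change_bounds(3)[of w j] j'
      unfolding sg[OF j] e'[OF s(2)]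
      by (simp add: has_bochner_integral_iff path_vertex_bound_def)
  next
    case t
    then obtain i where i: "i \<le> l" "x = t ! i" using in_t by blast
    have xe: "x \<noteq> s ! 0" "x \<noteq> s ! l" using t endin by auto
    then have "i \<noteq> 0" "i \<noteq> l" using i(2) ends by (metis, metis)
    then have i': "0 < i" "i < l" using i by auto
    have nA: "k \<notin> A" if "k < l" "x \<in> {t ! k, t ! Suc k}" for k
    proof
      assume "k \<in> A"
      then obtain j where "j < l" "{s ! j, s ! Suc j} = {t ! k, t ! Suc k}" by (rule matched_edge)
      then have "x \<in> {s ! j, s ! Suc j}" using that by simp
      then show False using \<open>j < l\<close> t(1) ls by auto
    qed
    have A: "i \<notin> A" "i - 1 \<notin> A" using nA[of i] nA[of "i - 1"] i i' by auto
    have "pair_vertex b s w B t v A x = half_edges l v A i"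
      using no_end[OF xe] at_vertex_nth[OF \<open>dpath l t v\<close> i(1), folded i(2)]
      by (intro ext) (simp add: pair_vertex_def at_vertex_notin[OF ls t(1)])
    then show ?thesis
      using integral_interior[OF i' A, of v] change_bounds(3)[of v i] i' t(1) i(2)
      unfolding e[OF t(1)] sg'[OF i]
      by (simp add: has_bochner_integral_iff pair_vertex_bound_def)
  next
    case both
    then obtain j i where j: "j \<le> l" "x = s ! j" and i: "i \<le> l" "x = t ! i" using in_s in_t by blast
    note ji = interior_iff[OF j(1) i(1)]
    have goal: "\<bar>integral\<^sup>L \<pi> (pair_vertex b s w B t v A x)\<bar> \<le> path_vertex_bound w j * pair_vertex_bound s t v A i"
    proof (cases "i = 0 \<or> i = l")
      case True
      then have "path_vertex_bound w j = 1" "pair_vertex_bound s t v A i = M"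
        using ji j i by (auto simp: path_vertex_bound_def pair_vertex_bound_def)
      then show ?thesis using pair_vertex_le_M[OF s' t' ends] by simp
    next
      case False
      then have i': "0 < i" "i < l" and j': "0 < j" "j < l" using ji i j by auto
      have tin: "t ! i \<in> set s" using both i by simp
      have p: "path_vertex_bound w j = change \<rho> w j" using j' by (simp add: path_vertex_bound_def)
      show ?thesis
      proof (cases "i - 1 \<in> A \<and> i \<in> A")
        case True
        have jj: "s ! j = t ! i" using i j by simp
        note r = run_interior[OF i' _ _ j(1) jj]
        have xe: "x \<noteq> s ! 0" "x \<noteq> s ! l"
          using nth_eq_dpath[OF \<open>dpath l s w\<close>, of j 0] nth_eq_dpath[OF \<open>dpath l s w\<close>, of j l] j j' by auto
        have "at_vertex s w B x p = half_edges l w B j p" "at_vertex t v A x p = half_edges l v A i p" for p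
          using at_vertex_nth[OF \<open>dpath l s w\<close> j(1)] at_vertex_nth[OF \<open>dpath l t v\<close> i(1)] i(2) j(2) by simp_all
        then have "pair_vertex b s w B t v A x = (\<lambda>_. 1)"
          using no_end[OF xe] r True by (intro ext) (simp add: pair_vertex_def half_edges_def)
        moreover have "path_vertex_bound w j * pair_vertex_bound s t v A i = 1"
          using p r True i' tin change_bounds(3)[of v i] by (simp add: pair_vertex_bound_def)
        ultimately show ?thesis by (simp add: prob_space)
      next
        case F: False
        then have "pair_vertex_bound s t v A i = M / \<rho>"
          using i' tin by (auto simp: pair_vertex_bound_def)
        moreover have "\<rho> * (M / \<rho>) \<le> change \<rho> w j * (M / \<rho>)"
          using change_bounds(1)[of w j] M_ge rho by (intro mult_right_mono) auto
        ultimately show ?thesis using pair_vertex_le_M[OF s' t' ends, where x = x and B = B and A = A and b = b] p rho by simp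
      qed
    qed
    then show ?thesis unfolding sg[OF j] sg'[OF i] by simp
  qed
qed

lemma pair_signal_expectation_le:
  assumes "set s \<subseteq> {1..n}" "set t \<subseteq> {1..n}"
  shows "\<bar>pair_signal b s w B t v A\<bar> \<le>
    amp w B * amp v A * ((\<Prod>j\<le>l. path_vertex_bound w j) * (\<Prod>i\<le>l. pair_vertex_bound s t v A i))"
proof -
  have ls: "length s = Suc l" and lt: "length t = Suc l" using s t by (auto simp: dpath_def)
  have amp0: "0 \<le> amp w' B'" for w' B'
    unfolding amp_def by (intro prod_nonneg divide_nonneg_nonneg less_imp_le[OF L(1)] ballI) simp
  have "\<bar>pair_signal b s w B t v A\<bar> =
      amp w B * amp v A * (\<Prod>x\<in>{1..n}. \<bar>integral\<^sup>L \<pi> (pair_vertex b s w B t v A x)\<bar>)"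
    using amp0 by (simp add: pair_signal_def abs_mult abs_prod)
  also have "\<dots> \<le> amp w B * amp v A * (\<Prod>x\<in>{1..n}. (\<Prod>j\<in>{j \<in> {..l}. s ! j = x}. path_vertex_bound w j) *
      (\<Prod>i\<in>{i \<in> {..l}. t ! i = x}. pair_vertex_bound s t v A i))"
    using amp0 by (intro mult_left_mono prod_mono conjI abs_ge_zero pair_vertex_integral_le) auto
  also have "\<dots> = amp w B * amp v A * ((\<Prod>j\<le>l. path_vertex_bound w j) * (\<Prod>i\<le>l. pair_vertex_bound s t v A i))"
    using prod_over_vertices[OF ls assms(1), of "\<lambda>j _. path_vertex_bound w j"]
      prod_over_vertices[OF lt assms(2), of "\<lambda>i _. pair_vertex_bound s t v A i"]
    by (simp only: prod.distrib)
  finally show ?thesis .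
qed

section \<open>The second path as a walk along the first\<close>

interpretation W: planted_walk s w l n L \<rho> "M / \<rho>"
  using s by unfold_locales

text \<open>Consecutive matched edges of \<open>t\<close> use different edges of \<open>s\<close> at
  the common vertex. One of these ends and the other starts there, so both are traversed in the same
  direction.\<close>

lemma run_mode_eq:
  assumes "0 < i" "i < l" "i - 1 \<in> A" "i \<in> A"
  shows "run_mode s t A (i - 1) = run_mode s t A i"
proof -
  have i1: "i - 1 < l" "Suc (i - 1) = i" using assms by auto
  have ne: "{t ! i, t ! Suc i} \<noteq> {t ! (i - 1), t ! Suc (i - 1)}"
    unfolding path_edge_eq_iff[OF t assms(2) i1(1)] using assms(1) by simp
  obtain j where j: "j < l" "{s ! j, s ! Suc j} = {t ! (i - 1), t ! i}"
    using matched_edge[OF assms(3)] i1(2) by metis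
  obtain j' where j': "j' < l" "{s ! j', s ! Suc j'} = {t ! i, t ! Suc i}"
    using matched_edge[OF assms(4)] by metis
  have jj: "j \<noteq> j'" using ne j j' i1(2) by auto
  have F: "(\<exists>k<l. t ! i = s ! k \<and> t ! Suc i = s ! Suc k) \<longleftrightarrow> t ! i = s ! j'"
    using j' nth_eq_dpath[OF s] by (auto simp: doubleton_eq_iff)
  have F': "(\<exists>k<l. t ! (i - 1) = s ! k \<and> t ! Suc (i - 1) = s ! Suc k) \<longleftrightarrow> t ! i = s ! Suc j"
    unfolding i1(2) using j nth_eq_dpath[OF s] by (auto simp: doubleton_eq_iff)
  have "t ! i = s ! j \<or> t ! i = s ! Suc j" "t ! i = s ! j' \<or> t ! i = s ! Suc j'"
    using j(2) j'(2) by (auto simp: doubleton_eq_iff)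
  moreover have "Suc j \<noteq> Suc j'" using jj by simp
  ultimately have "t ! i = s ! j' \<longleftrightarrow> t ! i = s ! Suc j"
    using nth_eq_dpath[OF s] j(1) j'(1) jj by auto
  then show ?thesis unfolding run_mode_def F F' using assms by simp
qed

lemma run_step_ok:
  assumes "i < l"
  shows "W.step_ok (t ! i) (t ! Suc i) (v ! i) (run_mode s t A i)"
proof (cases "i \<in> A")
  case True
  obtain j where j: "j < l" "w ! j = v ! i" "{s ! j, s ! Suc j} = {t ! i, t ! Suc i}"
    using matched_edge[OF True] by metis
  show ?thesis
  proof (cases "\<exists>k<l. t ! i = s ! k \<and> t ! Suc i = s ! Suc k")
    case F: True
    then obtain k where k: "k < l" "t ! i = s ! k" "t ! Suc i = s ! Suc k" by blast
    then have "k = j" using path_edge_eq_iff[OF s j(1) k(1)] j(3) by simp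
    then show ?thesis using F k j True by (auto simp: W.step_ok_def run_mode_def)
  next
    case False
    then have "t ! i = s ! Suc j \<and> t ! Suc i = s ! j"
      using j(1,3) unfolding doubleton_eq_iff by metis
    then show ?thesis using False j True by (auto simp: W.step_ok_def run_mode_def)
  qed
qed (simp add: W.step_ok_def run_mode_def)

text \<open>The vertex factors of the coding walk. At interior positions they dominate
  \<open>change\<close> times \<open>pair_vertex_bound\<close>: the coefficient of \<open>t\<close>
  turns \<open>change\<close> into its square at fresh vertices and cancels the quotient inside a
  run.\<close>

definition step_bound :: "nat \<Rightarrow> real" where
  "step_bound i = (if i = 0 then M / \<rho> else if t ! i \<notin> set s then (change \<rho> v i)\<^sup>2
     else if i - 1 \<in> A \<and> i \<in> A then 1 else M / \<rho>)"

lemma walk_weight_walk_of: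
  "W.walk_weight (t ! 0, Bullet, Free) (walk_of s t v A) =
    real n * (\<Prod>i<l. step_bound i * (if i \<in> A then 1 else (L (v ! i))\<^sup>2 / n))"
proof -
  let ?st = "(t ! 0, Bullet, Free)"
  have len: "length (walk_of s t v A) = l" by (simp add: walk_of_def)
  have "fst (last (?st # walk_of s t v A)) = s ! l"
    using l_ge ends by (simp add: last_conv_nth len walk_of_def)
  moreover have "W.walk_step ((?st # walk_of s t v A) ! i) (walk_of s t v A ! i) =
      step_bound i * (if i \<in> A then 1 else (L (v ! i))\<^sup>2 / n)" if i: "i < l" for i
  proof -
    have Fr: "run_mode s t A i = Free \<longleftrightarrow> i \<notin> A" for i by (simp add: run_mode_def)
    have here: "walk_of s t v A ! i = (t ! Suc i, v ! i, run_mode s t A i)" using i by (simp add: walk_of_def)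
    have t0: "t ! 0 \<in> set s" using s ends(1) nth_mem[of 0 s] by (simp add: dpath_def)
    show ?thesis
    proof (cases "i = 0")
      case True
      then show ?thesis using run_step_ok[OF i] t0 Fr[of i] here
        by (simp add: step_bound_def W.vertex_factor_def)
    next
      case False
      then have prev: "(?st # walk_of s t v A) ! i = (t ! i, v ! (i - 1), run_mode s t A (i - 1))"
        using i by (cases i) (simp_all add: walk_of_def)
      have nA: "t ! i \<in> set s" if iA: "i \<in> A"
      proof -
        obtain j where "j < l" "{s ! j, s ! Suc j} = {t ! i, t ! Suc i}" using matched_edge[OF iA] by metis
        then have "t ! i = s ! j \<or> t ! i = s ! Suc j" by (auto simp: doubleton_eq_iff)
        then show ?thesis using s \<open>j < l\<close> by (auto simp: dpath_def)
      qed
      have ch: "(if v ! (i - 1) = v ! i then 1 else \<rho>\<^sup>2) = (change \<rho> v i)\<^sup>2" by (simp add: change_def)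
      have vf: "W.vertex_factor (t ! i) (v ! (i - 1)) (run_mode s t A (i - 1)) (v ! i) (run_mode s t A i) = step_bound i"
        using False i run_mode_eq[of i] Fr[of i] Fr[of "i - 1"]
        unfolding W.vertex_factor_def step_bound_def ch by auto
      have "run_mode s t A (i - 1) = Free \<or> run_mode s t A i = Free \<or> run_mode s t A (i - 1) = run_mode s t A i"
        using run_mode_eq[of i] Fr[of i] Fr[of "i - 1"] False i by auto
      then show ?thesis
        unfolding prev here W.walk_step.simps vf using run_step_ok[OF i] Fr[of i] by simp
    qed
  qed
  ultimately show ?thesis unfolding W.walk_weight_eq len by simp
qed

text \<open>Matched edges have equal letters, so the edge weights missing from the two amplitudes
  are equal. Both are charged to \<open>t\<close>, which leaves a full square of
  \<open>weight w\<close> for \<open>s\<close> and the squared free edges of \<open>t\<close> for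
  the walk.\<close>

lemma weighted_pair_bound:
  assumes "length w = l" "length v = l"
  shows "weight w * weight v *
      (amp w B * amp v A * ((\<Prod>j\<le>l. path_vertex_bound w j) * (\<Prod>i\<le>l. pair_vertex_bound s t v A i)))
    \<le> M * (weight w)\<^sup>2 / n * W.walk_weight (t ! 0, Bullet, Free) (walk_of s t v A)"
proof -
  define Pw where "Pw = (\<Prod>j<l. L (w ! j))"
  define Pv where "Pv = (\<Prod>i<l. L (v ! i))"
  define PA where "PA = (\<Prod>i\<in>A. L (v ! i))"
  define Cw where "Cw = (\<Prod>j\<in>{1..<l}. change \<rho> w j)"
  define Cv where "Cv = (\<Prod>i\<in>{1..<l}. change \<rho> v i)"
  have sub: "B \<subseteq> {..<l}" "A \<subseteq> {..<l}" and img: "edge_key s w ` B = edge_key t v ` A"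
    using BA by (auto simp: matched_def)
  have fin: "finite A" "finite B" using sub finite_subset by blast+
  have injB: "inj_on (edge_key s w) B" and injA: "inj_on (edge_key t v) A"
    using inj_on_subset[OF inj_on_edge_key[OF s] sub(1)] inj_on_subset[OF inj_on_edge_key[OF t] sub(2)] .
  have cardBA: "card B = card A"
    using card_image[OF injB] card_image[OF injA] img by simp
  have "(\<Prod>j\<in>B. L (w ! j)) = (\<Prod>k\<in>edge_key s w ` B. L (fst k))"
    by (subst prod.reindex[OF injB]) (simp add: edge_key_def)
  also have "\<dots> = PA"
    unfolding img PA_def by (subst prod.reindex[OF injA]) (simp add: edge_key_def)
  finally have PB: "(\<Prod>j\<in>B. L (w ! j)) = PA" .
  have PA0: "0 < PA" unfolding PA_def using L(1) by (intro prod_pos) auto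
  have split: "(\<Prod>j\<in>{..<l} - X. f j) = (\<Prod>j<l. f j) / (\<Prod>j\<in>X. f j)"
    if "X \<subseteq> {..<l}" "\<And>j. f j \<noteq> 0" for X and f :: "nat \<Rightarrow> real"
  proof -
    have "finite X" using that(1) finite_subset by blast
    then have "(\<Prod>j\<in>X. f j) \<noteq> 0" using that(2) by simp
    then show ?thesis using prod.subset_diff[OF that(1), of f] by simp
  qed
  have Lne: "L d \<noteq> 0" for d using L(1)[of d] by simp
  let ?k = "l - card A"
  have ampw: "amp w B = Pw / PA * (1 / sqrt n) ^ ?k"
  proof -
    have "amp w B = (\<Prod>j\<in>{..<l} - B. L (w ! j)) * (\<Prod>j\<in>{..<l} - B. 1 / sqrt n)"
      unfolding amp_def prod.distrib[symmetric] by simp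
    also have "(\<Prod>j\<in>{..<l} - B. L (w ! j)) = Pw / PA"
      unfolding split[OF sub(1) Lne] PB Pw_def ..
    finally show ?thesis using sub fin by (simp add: card_Diff_subset cardBA)
  qed
  have ampv: "amp v A = Pv / PA * (1 / sqrt n) ^ ?k"
  proof -
    have "amp v A = (\<Prod>j\<in>{..<l} - A. L (v ! j)) * (\<Prod>j\<in>{..<l} - A. 1 / sqrt n)"
      unfolding amp_def prod.distrib[symmetric] by simp
    also have "(\<Prod>j\<in>{..<l} - A. L (v ! j)) = Pv / PA"
      unfolding split[OF sub(2) Lne] PA_def Pv_def ..
    finally show ?thesis using sub fin by (simp add: card_Diff_subset)
  qed
  have edge: "(\<Prod>i<l. if i \<in> A then 1 else (L (v ! i))\<^sup>2 / n) = (Pv / PA)\<^sup>2 * (1 / n) ^ ?k"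
  proof -
    have "(\<Prod>i<l. if i \<in> A then 1 else (L (v ! i))\<^sup>2 / n) = (\<Prod>i\<in>{..<l} - A. (L (v ! i))\<^sup>2 * (1 / n))"
      by (rule prod.mono_neutral_cong_right) auto
    also have "\<dots> = (\<Prod>i\<in>{..<l} - A. L (v ! i))\<^sup>2 * (1 / n) ^ card ({..<l} - A)"
      unfolding prod.distrib by (simp add: prod_power_distrib)
    also have "(\<Prod>i\<in>{..<l} - A. L (v ! i)) = Pv / PA"
      unfolding split[OF sub(2) Lne] PA_def Pv_def ..
    finally show ?thesis using sub fin by (simp add: card_Diff_subset)
  qed
  have sq: "(1 / sqrt n) ^ ?k * (1 / sqrt n) ^ ?k = (1 / n) ^ ?k"
    by (simp add: power_mult_distrib[symmetric])
  have decomp: "{..l} = insert 0 (insert l {1..<l})" using l_ge by auto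
  have decomp': "{..<l} = insert 0 {1..<l}" using l_ge by auto
  have pw: "(\<Prod>j\<le>l. path_vertex_bound w j) = Cw"
    unfolding decomp Cw_def using l_ge by (simp add: path_vertex_bound_def)
  have M0: "0 < M" "M \<le> M / \<rho>" using M_ge rho by (auto simp: field_simps)
  have nonneg: "0 \<le> pair_vertex_bound s t v A i" for i
    using M_ge rho change_bounds(3)[of v i] by (simp add: pair_vertex_bound_def less_imp_le)
  have "Cv * (\<Prod>i\<le>l. pair_vertex_bound s t v A i) =
      M * M * (\<Prod>i\<in>{1..<l}. change \<rho> v i * pair_vertex_bound s t v A i)"
    unfolding decomp Cv_def prod.distrib using l_ge by (simp add: pair_vertex_bound_def)
  also have "\<dots> \<le> M * (M / \<rho>) * (\<Prod>i\<in>{1..<l}. step_bound i)"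
  proof -
    have pos: "0 \<le> change \<rho> v i * pair_vertex_bound s t v A i" for i
      using nonneg[of i] change_bounds(3)[of v i] by simp
    have 1: "(\<Prod>i\<in>{1..<l}. change \<rho> v i * pair_vertex_bound s t v A i) \<le> (\<Prod>i\<in>{1..<l}. step_bound i)"
    proof (intro prod_mono conjI pos)
      fix i assume i: "i \<in> {1..<l}"
      have "change \<rho> v i * (M / \<rho>) \<le> 1 * (M / \<rho>)"
        using change_bounds(2)[of v i] M0 rho by (intro mult_right_mono) auto
      then show "change \<rho> v i * pair_vertex_bound s t v A i \<le> step_bound i"
        using i change_bounds(3)[of v i]
        by (auto simp: pair_vertex_bound_def step_bound_def power2_eq_square)
    qed
    \<comment> \<open>One of the two end vertices becomes the start factor \<open>M / \<rho>\<close>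
      of the walk, the other stays outside as the leading \<open>M\<close>.\<close>
    have 2: "M * M \<le> M * (M / \<rho>)" using M0 by (intro mult_left_mono) auto
    have 3: "0 \<le> M * (M / \<rho>)" using M0 rho by (intro mult_nonneg_nonneg divide_nonneg_nonneg) auto
    show ?thesis by (rule mult_mono[OF 2 1 3]) (intro prod_nonneg ballI pos)
  qed
  also have "\<dots> = M * (\<Prod>i<l. step_bound i)"
    unfolding decomp' by (simp add: step_bound_def)
  finally have C: "Cv * (\<Prod>i\<le>l. pair_vertex_bound s t v A i) \<le> M * (\<Prod>i<l. step_bound i)" .
  have ww: "weight w = Pw * Cw" "weight v = Pv * Cv"
    by (simp_all add: word_weight_def assms Pw_def Cw_def Pv_def Cv_def)
  have "weight w * weight v *
      (amp w B * amp v A * ((\<Prod>j\<le>l. path_vertex_bound w j) * (\<Prod>i\<le>l. pair_vertex_bound s t v A i)))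
    = (Pw * Cw)\<^sup>2 * ((Pv / PA)\<^sup>2 * ((1 / sqrt n) ^ ?k * (1 / sqrt n) ^ ?k)) *
      (Cv * (\<Prod>i\<le>l. pair_vertex_bound s t v A i))"
    unfolding ww ampw ampv pw power2_eq_square by (simp add: ac_simps)
  also have "\<dots> \<le> (Pw * Cw)\<^sup>2 * ((Pv / PA)\<^sup>2 * ((1 / sqrt n) ^ ?k * (1 / sqrt n) ^ ?k)) *
      (M * (\<Prod>i<l. step_bound i))"
    by (intro mult_left_mono C mult_nonneg_nonneg) auto
  also have "\<dots> = M * (weight w)\<^sup>2 / n * W.walk_weight (t ! 0, Bullet, Free) (walk_of s t v A)"
    unfolding walk_weight_walk_of prod.distrib edge sq ww using n_pos by simp
  finally show ?thesis .
qed

end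

end

subsection \<open>Moments of the path statistic\<close>

lemma prod_decoration_split:
  "(\<Prod>j<l. (case w ! j of Bullet \<Rightarrow> f j | Circ \<Rightarrow> g j)) =
    (\<Prod>j\<in>{j. j < l \<and> w ! j = Bullet}. f j) * (\<Prod>j\<in>{j. j < l \<and> w ! j = Circ}. g j :: real)"
proof -
  have "(\<Prod>j<l. (case w ! j of Bullet \<Rightarrow> f j | Circ \<Rightarrow> g j)) =
      (\<Prod>j<l. (if w ! j = Bullet then f j else 1) * (if w ! j = Circ then g j else 1))"
  proof (intro prod.cong refl)
    fix j show "(case w ! j of Bullet \<Rightarrow> f j | Circ \<Rightarrow> g j) = (if w ! j = Bullet then f j else 1) * (if w ! j = Circ then g j else 1)"
      by (cases "w ! j") simp_all
  qed
  then show ?thesis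
    using prod.inter_filter[of "{..<l}" f "\<lambda>j. w ! j = Bullet"] prod.inter_filter[of "{..<l}" g "\<lambda>j. w ! j = Circ"]
    by (simp add: prod.distrib)
qed

lemma f_stat_path_graph:
  assumes p: "dpath l s w"
  shows "f_stat (path_graph s w) X Y =
    (\<Prod>j<l. (case w ! j of Bullet \<Rightarrow> X | Circ \<Rightarrow> Y) (min (s ! j) (s ! Suc j)) (max (s ! j) (s ! Suc j)))"
proof -
  have "(\<Prod>e\<in>edges_of d (path_graph s w). Z (Min e) (Max e)) =
      (\<Prod>j\<in>{j. j < l \<and> w ! j = d}. Z (min (s ! j) (s ! Suc j)) (max (s ! j) (s ! Suc j)))"
    for d and Z :: "nat \<Rightarrow> nat \<Rightarrow> real"
    unfolding edges_of_path_graph[OF p]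
    by (subst prod.reindex) (auto intro: inj_on_subset[OF inj_on_path_edges[OF p]])
  then show ?thesis
    unfolding f_stat_def
    using prod_decoration_split[of "\<lambda>j. X (min (s ! j) (s ! Suc j)) (max (s ! j) (s ! Suc j))"
        "\<lambda>j. Y (min (s ! j) (s ! Suc j)) (max (s ! j) (s ! Suc j))"]
    by (simp add: decoration.case_distrib[of "\<lambda>F. F _ _"])
qed

context spiked
begin

abbreviation PPn where "PPn \<equiv> PP \<pi> n"

definition stat :: "nat list \<Rightarrow> decoration list \<Rightarrow> sample \<Rightarrow> real" where
  "stat s w \<omega> = f_stat (path_graph s w) (X_mat lam n \<omega>) (Y_mat \<mu> n \<omega>)"

lemma PP_eq: "PPn = P1 \<Otimes>\<^sub>M (wigner_law n \<Otimes>\<^sub>M wigner_law n)"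
  by (simp add: PP_def)

lemma prob_space_P1: "prob_space P1"
  by (intro prob_space_PiM prob_space_axioms)

lemma prob_space_noise: "prob_space (wigner_law n \<Otimes>\<^sub>M wigner_law n)"
  by (intro prob_space_pair prob_space_wigner_law)

lemma prob_space_PP: "prob_space PPn"
  unfolding PP_eq by (intro prob_space_pair prob_space_P1 prob_space_noise)

text \<open>Signal plus noise is multiplied out, \<open>B\<close> being the set of positions that
  take the noise term. The signal is symmetric, so the order in which \<open>f_stat\<close> reads an
  edge is immaterial.\<close>

lemma stat_eq:
  assumes p: "dpath l s w"
  shows "stat s w \<omega> = (\<Sum>B\<in>Pow {..<l}. (\<Prod>k\<in>edge_key s w ` B. noise (snd \<omega>) k) * signal s w B (fst \<omega>))"
proof -
  have "stat s w \<omega> = (\<Prod>j<l. noise (snd \<omega>) (edge_key s w j) +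
      L (w ! j) / sqrt n * coord (w ! j) (fst \<omega> (s ! j)) * coord (w ! j) (fst \<omega> (s ! Suc j)))"
    unfolding stat_def f_stat_path_graph[OF p]
  proof (intro prod.cong refl)
    fix j
    have "z (min (s ! j) (s ! Suc j)) * z (max (s ! j) (s ! Suc j)) = z (s ! j) * z (s ! Suc j)" for z :: "nat \<Rightarrow> real"
      by (simp add: min_def max_def mult.commute)
    note 1 = this[of "x_vec \<omega>"] this[of "y_vec \<omega>"]
    show "(case w ! j of Bullet \<Rightarrow> X_mat lam n \<omega> | Circ \<Rightarrow> Y_mat \<mu> n \<omega>)
         (min (s ! j) (s ! Suc j)) (max (s ! j) (s ! Suc j)) =
        noise (snd \<omega>) (edge_key s w j) +
        L (w ! j) / sqrt n * coord (w ! j) (fst \<omega> (s ! j)) * coord (w ! j) (fst \<omega> (s ! Suc j))"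
      using 1 by (cases "w ! j")
        (simp_all add: X_mat_def Y_mat_def W_mat_def Z_mat_def noise_def edge_key_def coord_def edge_weight_def
          x_vec_def y_vec_def mult.assoc min.absorb1 max.absorb2)
  qed
  also have "\<dots> = (\<Sum>B\<in>Pow {..<l}. (\<Prod>j\<in>B. noise (snd \<omega>) (edge_key s w j)) * signal s w B (fst \<omega>))"
    unfolding signal_def by (rule prod_add) simp
  also have "\<dots> = (\<Sum>B\<in>Pow {..<l}. (\<Prod>k\<in>edge_key s w ` B. noise (snd \<omega>) k) * signal s w B (fst \<omega>))"
  proof (intro sum.cong refl)
    fix B assume "B \<in> Pow {..<l}"
    then have "inj_on (edge_key s w) B" using inj_on_subset[OF inj_on_edge_key[OF p]] by blast
    then show "(\<Prod>j\<in>B. noise (snd \<omega>) (edge_key s w j)) * signal s w B (fst \<omega>) =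
        (\<Prod>k\<in>edge_key s w ` B. noise (snd \<omega>) k) * signal s w B (fst \<omega>)"
      by (simp add: prod.reindex)
  qed
  finally show ?thesis .
qed

lemma edge_key_subset:
  assumes "dpath l s w" "set s \<subseteq> {1..n}" "B \<subseteq> {..<l}"
  shows "edge_key s w ` B \<subseteq> UNIV \<times> strict_index n"
proof
  fix k assume "k \<in> edge_key s w ` B"
  then obtain j where j: "j < l" "k = edge_key s w j" using assms(3) by auto
  then have "s ! j \<in> set s" "s ! Suc j \<in> set s" "s ! j \<noteq> s ! Suc j"
    using assms(1) nth_eq_dpath[OF assms(1), of j "Suc j"] by (auto simp: dpath_def)
  then have "s ! j \<in> {1..n}" "s ! Suc j \<in> {1..n}" "s ! j \<noteq> s ! Suc j"
    using assms(2) by blast+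
  then show "k \<in> UNIV \<times> strict_index n"
    using j by (auto simp: edge_key_def strict_index_def min_def max_def)
qed

lemma stat_pair_expectation:
  assumes s: "dpath l s w" and t: "dpath l t v"
    and ends: "s ! 0 = t ! 0" "s ! l = t ! l"
    and sub: "set s \<subseteq> {1..n}" "set t \<subseteq> {1..n}"
  shows "has_bochner_integral PPn
    (\<lambda>\<omega>. (\<Prod>x\<in>{1..n}. end_weight b (s ! 0) (s ! l) x (fst \<omega> x)) * (stat s w \<omega> * stat t v \<omega>))
    (\<Sum>(B, A)\<in>matched l s w t v. pair_signal b s w B t v A)"
proof -
  let ?E = "\<lambda>p. \<Prod>x\<in>{1..n}. end_weight b (s ! 0) (s ! l) x (p x)"
  let ?f = "\<lambda>(B, A) \<omega>. ?E (fst \<omega>) * (signal s w B (fst \<omega>) * signal t v A (fst \<omega>)) *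
      ((\<Prod>k\<in>edge_key s w ` B. noise (snd \<omega>) k) * (\<Prod>k\<in>edge_key t v ` A. noise (snd \<omega>) k))"
  let ?I = "Pow {..<l} \<times> Pow {..<l}"
  have eq: "?E (fst \<omega>) * (stat s w \<omega> * stat t v \<omega>) = (\<Sum>p\<in>?I. ?f p \<omega>)" for \<omega>
  proof -
    have "stat s w \<omega> * stat t v \<omega> = (\<Sum>B\<in>Pow {..<l}. \<Sum>A\<in>Pow {..<l}.
        (signal s w B (fst \<omega>) * signal t v A (fst \<omega>)) *
        ((\<Prod>k\<in>edge_key s w ` B. noise (snd \<omega>) k) * (\<Prod>k\<in>edge_key t v ` A. noise (snd \<omega>) k)))"
      unfolding stat_eq[OF s] stat_eq[OF t] sum_product by (intro sum.cong refl) (simp only: ac_simps)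
    then show ?thesis
      by (simp add: sum_distrib_left sum.cartesian_product case_prod_unfold mult.assoc)
  qed
  have "has_bochner_integral PPn (\<lambda>\<omega>. \<Sum>p\<in>?I. ?f p \<omega>)
      (\<Sum>p\<in>?I. (\<lambda>(B, A). pair_signal b s w B t v A * of_bool (edge_key s w ` B = edge_key t v ` A)) p)"
  proof (rule has_bochner_integral_sum)
    fix p assume "p \<in> ?I"
    then obtain B A where p: "p = (B, A)" "B \<subseteq> {..<l}" "A \<subseteq> {..<l}" by auto
    have "has_bochner_integral PPn
        (\<lambda>\<omega>. (\<lambda>q. ?E q * (signal s w B q * signal t v A q)) (fst \<omega>) *
          (\<lambda>N. (\<Prod>k\<in>edge_key s w ` B. noise N k) * (\<Prod>k\<in>edge_key t v ` A. noise N k)) (snd \<omega>))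
        (pair_signal b s w B t v A * of_bool (edge_key s w ` B = edge_key t v ` A))"
      unfolding PP_eq
      by (intro has_bochner_integral_pair_mult prob_space_imp_sigma_finite prob_space_P1 prob_space_noise
          pair_signal_expectation[OF s t ends sub] noise_orthonormal edge_key_subset[OF s sub(1) p(2)]
          edge_key_subset[OF t sub(2) p(3)])
    then show "has_bochner_integral PPn (?f p)
        ((\<lambda>(B, A). pair_signal b s w B t v A * of_bool (edge_key s w ` B = edge_key t v ` A)) p)"
      by (simp add: p(1))
  qed
  moreover have "(\<Sum>p\<in>?I. (\<lambda>(B, A). pair_signal b s w B t v A * of_bool (edge_key s w ` B = edge_key t v ` A)) p) =
      (\<Sum>(B, A)\<in>matched l s w t v. pair_signal b s w B t v A)"
  proof (rule sum.mono_neutral_cong_right)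
    show "\<forall>p\<in>?I - matched l s w t v. (\<lambda>(B, A). pair_signal b s w B t v A * of_bool (edge_key s w ` B = edge_key t v ` A)) p = 0"
    proof
      fix p assume *: "p \<in> ?I - matched l s w t v"
      obtain B A where p: "p = (B, A)" by (cases p)
      from * have "edge_key s w ` B \<noteq> edge_key t v ` A" unfolding p matched_def by blast
      then have "edge_key s w ` fst p \<noteq> edge_key t v ` snd p" using p by simp
      then show "(\<lambda>(B, A). pair_signal b s w B t v A * of_bool (edge_key s w ` B = edge_key t v ` A)) p = 0"
        by (simp add: case_prod_unfold)
    qed
  qed (auto simp: matched_def)
  ultimately show ?thesis unfolding eq by simp
qed

definition path_end :: "nat list \<Rightarrow> nat \<Rightarrow> real \<times> real \<Rightarrow> real" where
  "path_end s x p = (if x \<in> {s ! 0, s ! l} then coord Bullet p else 1)"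

text \<open>At an end the single signal edge meets the additional coordinate \<open>Bullet\<close>.
  The word starts and ends with \<open>Bullet\<close>, so this is a square with expectation 1; here
  the condition on the leaves enters.\<close>

lemma path_end_expectation:
  assumes s: "dpath l s w" and w: "w \<in> words l"
  shows "has_bochner_integral \<pi> (\<lambda>p. path_end s x p * at_vertex s w {} x p)
    (\<Prod>j\<in>{j \<in> {..l}. s ! j = x}. path_vertex_bound w j)"
proof (cases "x \<in> set s")
  case False
  then have e: "{j \<in> {..l}. s ! j = x} = {}" and "x \<noteq> s ! 0" "x \<noteq> s ! l"
    using s by (auto simp: dpath_def less_Suc_eq_le)
  then show ?thesis
    using False s has_bochner_integral_integrable[of \<pi> "\<lambda>_. 1 :: real"]
    unfolding e by (simp add: path_end_def at_vertex_notin dpath_def prob_space)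
next
  case True
  then obtain j where j: "j \<le> l" "x = s ! j" using s by (auto simp: dpath_def in_set_conv_nth less_Suc_eq_le)
  have J: "{i \<in> {..l}. s ! i = x} = {j}" using j nth_eq_dpath[OF s] by auto
  have at: "at_vertex s w {} x p = half_edges l w {} j p" for p
    using at_vertex_nth[OF s j(1)] j(2) by simp
  have pe: "path_end s x p = (if j = 0 \<or> j = l then coord Bullet p else 1)" for p
    using nth_eq_dpath[OF s j(1), of 0] nth_eq_dpath[OF s j(1), of l] j(2) by (simp add: path_end_def)
  consider "j = 0" | "j = l" | "0 < j" "j < l" using j by linarith
  then show ?thesis
  proof cases
    case 1
    then show ?thesis unfolding J at pe
      using coord_moment2[of Bullet Bullet] w l_ge by (simp add: half_edges_def path_vertex_bound_def words_def)
  next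
    case 2
    then show ?thesis unfolding J at pe
      using coord_moment2[of Bullet Bullet] w l_ge by (simp add: half_edges_def path_vertex_bound_def words_def)
  next
    case 3
    then show ?thesis unfolding J at pe
      using integral_interior[of j "{}" w] by (simp add: path_vertex_bound_def)
  qed
qed

text \<open>A nonempty noise monomial has expectation 0, so only the pure signal term remains. Its
  amplitude and the correlations at its vertices reproduce the word weight.\<close>

lemma stat_first_moment:
  assumes s: "dpath l s w" and w: "w \<in> words l" and sub: "set s \<subseteq> {1..n}"
  shows "has_bochner_integral PPn (\<lambda>\<omega>. (\<Prod>x\<in>{1..n}. path_end s x (fst \<omega> x)) * stat s w \<omega>)
    (weight w * (1 / sqrt n) ^ l)"
proof -
  have ls: "length s = Suc l" and lw: "length w = l" using s by (auto simp: dpath_def)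
  let ?E = "\<lambda>p. \<Prod>x\<in>{1..n}. path_end s x (p x)"
  let ?f = "\<lambda>B \<omega>. ?E (fst \<omega>) * signal s w B (fst \<omega>) * ((\<Prod>k\<in>edge_key s w ` B. noise (snd \<omega>) k) * (\<Prod>k\<in>{}. noise (snd \<omega>) k))"
  have eq: "?E (fst \<omega>) * stat s w \<omega> = (\<Sum>B\<in>Pow {..<l}. ?f B \<omega>)" for \<omega>
    unfolding stat_eq[OF s] sum_distrib_left by (intro sum.cong refl) (simp add: ac_simps)
  have "has_bochner_integral PPn (?f B) (integral\<^sup>L P1 (\<lambda>p. ?E p * signal s w B p) * of_bool (B = {}))"
    if B: "B \<in> Pow {..<l}" for B
  proof -
    have meas: "integrable P1 (\<lambda>p. ?E p * signal s w B p)"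
    proof -
      have "integrable P1 (\<lambda>p. amp w B * (\<Prod>x\<in>{1..n}. path_end s x (p x) * at_vertex s w B x (p x)))"
      proof -
        have "integrable \<pi> (\<lambda>p. path_end s x p * at_vertex s w B x p)" for x
        proof -
          from at_vertex_factors[OF s, of B x] obtain a a' where a: "at_vertex s w B x = (\<lambda>p. a p * a' p) \<and>
              (\<forall>p. a p = 1 \<or> (\<exists>d. a p = coord d p)) \<and> (\<forall>p. a' p = 1 \<or> (\<exists>d. a' p = coord d p)) \<and>
              (x \<in> {s ! 0, s ! l} \<longrightarrow> a' = (\<lambda>_. 1))"
            by (elim exE)
          note a1 = spec[OF conjunct1[OF conjunct2[OF a]]] and a2 = spec[OF conjunct1[OF conjunct2[OF conjunct2[OF a]]]]
          have "(\<lambda>p. path_end s x p * at_vertex s w B x p) = (\<lambda>p. a p * a' p * path_end s x p * 1)"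
            using conjunct1[OF a] by (simp add: ac_simps)
          then have "\<bar>path_end s x p * at_vertex s w B x p\<bar> \<le> 1 + fst p ^ 4 + snd p ^ 4" for p
            by (rule abs_le_quartic4[OF _ a1 a2]) (auto simp: path_end_def)
          then show ?thesis by (intro integrable_quartic(1)) (simp_all add: path_end_def)
        qed
        then show ?thesis
          using has_bochner_integral_PiM_prod[of "\<lambda>_. \<pi>" "{1..n}" "\<lambda>x p. path_end s x p * at_vertex s w B x p"]
            prob_space_axioms by (auto simp: has_bochner_integral_iff)
      qed
      then show ?thesis unfolding signal_eq[OF ls sub] prod.distrib by (simp add: ac_simps)
    qed
    have "(edge_key s w ` B = {}) = (B = {})" by simp
    have "has_bochner_integral PPn
        (\<lambda>\<omega>. (\<lambda>q. ?E q * signal s w B q) (fst \<omega>) *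
          (\<lambda>N. (\<Prod>k\<in>edge_key s w ` B. noise N k) * (\<Prod>k\<in>{}. noise N k)) (snd \<omega>))
        (integral\<^sup>L P1 (\<lambda>p. ?E p * signal s w B p) * of_bool (edge_key s w ` B = {}))"
      unfolding PP_eq using B
      by (intro has_bochner_integral_pair_mult prob_space_imp_sigma_finite prob_space_P1 prob_space_noise
          has_bochner_integral_integrable meas noise_orthonormal edge_key_subset[OF s sub]) auto
    then show ?thesis by simp
  qed
  then have "has_bochner_integral PPn (\<lambda>\<omega>. \<Sum>B\<in>Pow {..<l}. ?f B \<omega>)
      (\<Sum>B\<in>Pow {..<l}. integral\<^sup>L P1 (\<lambda>p. ?E p * signal s w B p) * of_bool (B = {}))"
    by (rule has_bochner_integral_sum)
  moreover have "(\<Sum>B\<in>Pow {..<l}. integral\<^sup>L P1 (\<lambda>p. ?E p * signal s w B p) * of_bool (B = {})) =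
      (\<Sum>B\<in>{{}}. integral\<^sup>L P1 (\<lambda>p. ?E p * signal s w B p))"
    by (rule sum.mono_neutral_cong_right) auto
  moreover have "integral\<^sup>L P1 (\<lambda>p. ?E p * signal s w {} p) = weight w * (1 / sqrt n) ^ l"
  proof -
    have "has_bochner_integral P1 (\<lambda>p. \<Prod>x\<in>{1..n}. path_end s x (p x) * at_vertex s w {} x (p x))
        (\<Prod>x\<in>{1..n}. \<Prod>j\<in>{j \<in> {..l}. s ! j = x}. path_vertex_bound w j)"
      by (intro has_bochner_integral_PiM_prod prob_space_axioms finite_atLeastAtMost path_end_expectation[OF s w])
    then have "has_bochner_integral P1 (\<lambda>p. amp w {} * (\<Prod>x\<in>{1..n}. path_end s x (p x) * at_vertex s w {} x (p x)))
        (amp w {} * (\<Prod>j\<le>l. path_vertex_bound w j))"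
      unfolding prod_over_vertices[OF ls sub, of "\<lambda>j _. path_vertex_bound w j", symmetric]
      by (intro has_bochner_integral_mult_right)
    then have "has_bochner_integral P1 (\<lambda>p. ?E p * signal s w {} p) (amp w {} * (\<Prod>j\<le>l. path_vertex_bound w j))"
      unfolding signal_eq[OF ls sub] prod.distrib by (simp add: ac_simps)
    moreover have "amp w {} = (\<Prod>j<l. L (w ! j)) * (1 / sqrt n) ^ l"
      unfolding amp_def prod_dividef by (simp add: power_one_over)
    moreover have "(\<Prod>j\<le>l. path_vertex_bound w j) = (\<Prod>j\<in>{1..<l}. change \<rho> w j)"
      by (rule prod.mono_neutral_cong_right) (auto simp: path_vertex_bound_def)
    ultimately show ?thesis by (simp add: has_bochner_integral_iff word_weight_def lw)
  qed
  ultimately show ?thesis unfolding eq by simp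
qed

section \<open>First and second moment of the linear statistic\<close>

definition path_words :: "nat \<Rightarrow> nat \<Rightarrow> (decoration list \<times> nat list) set" where
  "path_words u v = words l \<times> rooted_paths n l u v"

lemma finite_path_words [simp]: "finite (path_words u v)"
  by (simp add: path_words_def)

lemma path_wordsD:
  assumes "(w, s) \<in> path_words u v"
  shows "dpath l s w" "s ! 0 = u" "s ! l = v" "set s \<subseteq> {1..n}" "w \<in> words l" "length w = l"
  using assms by (auto simp: path_words_def rooted_paths_def words_def dpath_def)

definition linear_stat :: "nat \<Rightarrow> nat \<Rightarrow> sample \<Rightarrow> real" where
  "linear_stat u v \<omega> = (\<Sum>(w, s)\<in>path_words u v. weight w * stat s w \<omega>)"

definition second_moment :: "bool \<Rightarrow> nat \<Rightarrow> nat \<Rightarrow> real" where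
  "second_moment b u v = (\<Sum>(w, s)\<in>path_words u v. \<Sum>(w', t)\<in>path_words u v.
     weight w * weight w' *
     (\<Sum>(B, A)\<in>matched l s w t w'. pair_signal b s w B t w' A))"

lemma second_moment:
  "has_bochner_integral PPn (\<lambda>\<omega>. (\<Prod>x\<in>{1..n}. end_weight b u v x (fst \<omega> x)) * (linear_stat u v \<omega>)\<^sup>2)
    (second_moment b u v)"
proof -
  let ?E = "\<lambda>\<omega> :: sample. \<Prod>x\<in>{1..n}. end_weight b u v x (fst \<omega> x)"
  let ?t = "\<lambda>p q \<omega>. weight (fst p) * weight (fst q) *
      (?E \<omega> * (stat (snd p) (fst p) \<omega> * stat (snd q) (fst q) \<omega>))"
  let ?v = "\<lambda>p q. weight (fst p) * weight (fst q) *
     (\<Sum>(B, A)\<in>matched l (snd p) (fst p) (snd q) (fst q). pair_signal b (snd p) (fst p) B (snd q) (fst q) A)"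
  have "has_bochner_integral PPn (\<lambda>\<omega>. \<Sum>p\<in>path_words u v. \<Sum>q\<in>path_words u v. ?t p q \<omega>)
      (\<Sum>p\<in>path_words u v. \<Sum>q\<in>path_words u v. ?v p q)"
  proof (intro has_bochner_integral_sum)
    fix p q assume pq: "p \<in> path_words u v" "q \<in> path_words u v"
    then have "(fst p, snd p) \<in> path_words u v" "(fst q, snd q) \<in> path_words u v" by simp_all
    note p = path_wordsD[OF this(1)] and q = path_wordsD[OF this(2)]
    have e: "snd p ! 0 = snd q ! 0" "snd p ! l = snd q ! l" using p(2,3) q(2,3) by simp_all
    show "has_bochner_integral PPn (?t p q) (?v p q)"
      using stat_pair_expectation[OF p(1) q(1) e p(4) q(4), of b] unfolding p(2,3)
      by (intro has_bochner_integral_mult_right)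
  qed
  moreover have "(\<Sum>p\<in>path_words u v. \<Sum>q\<in>path_words u v. ?t p q \<omega>) = ?E \<omega> * (linear_stat u v \<omega>)\<^sup>2" for \<omega>
    unfolding linear_stat_def power2_eq_square sum_product
    by (simp add: sum_distrib_left case_prod_unfold ac_simps)
  moreover have "(\<Sum>p\<in>path_words u v. \<Sum>q\<in>path_words u v. ?v p q) = second_moment b u v"
    by (simp add: second_moment_def case_prod_unfold)
  ultimately show ?thesis by simp
qed

text \<open>The walk lists the vertices after the common start and the letters, and its mode tells
  which positions are matched.\<close>

lemma walk_of_inj:
  assumes "dpath l t v" "dpath l t' v'" "A \<subseteq> {..<l}" "A' \<subseteq> {..<l}" "t ! 0 = t' ! 0"
    and eq: "walk_of s t v A = walk_of s t' v' A'"
  shows "t = t'" "v = v'" "A = A'"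
proof -
  have i: "t ! Suc i = t' ! Suc i" "v ! i = v' ! i" "run_mode s t A i = run_mode s t' A' i" if "i < l" for i
    using arg_cong[OF eq, of "\<lambda>x. x ! i"] that by (simp_all add: walk_of_def)
  have "t ! i = t' ! i" if "i \<le> l" for i
    using i(1)[of "i - 1"] assms(5) that by (cases i) auto
  then show "t = t'" using assms(1,2) by (auto simp: dpath_def intro!: nth_equalityI)
  show "v = v'" using assms(1,2) i(2) by (auto simp: dpath_def intro!: nth_equalityI)
  have "i \<in> A \<longleftrightarrow> i \<in> A'" if "i < l" for i
  proof -
    have "run_mode s t A i = Free \<longleftrightarrow> i \<notin> A" "run_mode s t' A' i = Free \<longleftrightarrow> i \<notin> A'" by (simp_all add: run_mode_def)
    then show ?thesis using i(3)[OF that] by simp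
  qed
  then show "A = A'" using assms(3,4) by blast
qed

lemma walk_weight_nonneg:
  assumes "dpath l s w"
  shows "0 \<le> planted_walk.walk_weight s w l n L \<rho> (M / \<rho>) st ps"
proof -
  interpret W: planted_walk s w l n L \<rho> "M / \<rho>" using assms by unfold_locales
  have "0 \<le> W.walk_step st p" for st p
    using M_ge rho by (cases st; cases p) (auto simp: W.vertex_factor_def)
  then show ?thesis by (induction ps arbitrary: st) auto
qed

text \<open>For a fixed first path the coding of second path and matching by a walk is injective, so
  their total contribution is at most the sum over all walks, for which \<open>Wb\<close> is a bound
  uniform in the first path.\<close>

lemma second_moment_le:
  assumes Wb: "\<And>w s. dpath l s w \<Longrightarrow> planted_walk.walk_sum s w l n L \<rho> (M / \<rho>) l (s ! 0, Bullet, Free) \<le> Wb"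
  shows "second_moment b u v \<le> M / n * Wb * (\<Sum>(w, s)\<in>path_words u v. (weight w)\<^sup>2)"
proof -
  have "(\<Sum>(w', t)\<in>path_words u v.
     weight w * weight w' * (\<Sum>(B, A)\<in>matched l s w t w'. pair_signal b s w B t w' A))
    \<le> M / n * Wb * (weight w)\<^sup>2" if ws: "(w, s) \<in> path_words u v" for w s
  proof -
    note p = path_wordsD[OF ws]
    interpret W: planted_walk s w l n L \<rho> "M / \<rho>" using p(1) by unfold_locales
    let ?T = "Sigma (path_words u v) (\<lambda>(w', t). matched l s w t w')"
    let ?g = "\<lambda>((w', t), (B, A)). walk_of s t w' A"
    let ?F = "\<lambda>((w', t), (B, A)). weight w * weight w' * pair_signal b s w B t w' A"
    let ?c = "M * (weight w)\<^sup>2 / n"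
    have c0: "0 \<le> ?c" using M_ge by simp
    have ww0: "0 \<le> weight w'" for w'
      unfolding word_weight_def using L(1) change_bounds(3)
      by (intro mult_nonneg_nonneg prod_nonneg) (auto intro: less_imp_le)
    have TD: "dpath l t w'" "t ! 0 = u" "t ! l = v" "set t \<subseteq> {1..n}" "length w' = l" "(B, A) \<in> matched l s w t w'"
      if "((w', t), (B, A)) \<in> ?T" for w' t B A
      using that path_wordsD[of w' t u v] by auto
    have "(\<Sum>(w', t)\<in>path_words u v.
        weight w * weight w' * (\<Sum>(B, A)\<in>matched l s w t w'. pair_signal b s w B t w' A)) =
      (\<Sum>x\<in>?T. ?F x)"
      by (subst sum.Sigma[symmetric]) (auto simp: sum_distrib_left case_prod_unfold)
    also have "\<dots> \<le> (\<Sum>x\<in>?T. ?c * W.walk_weight (u, Bullet, Free) (?g x))"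
    proof (rule sum_mono)
      fix x assume x: "x \<in> ?T"
      obtain w' t B A where xe: "x = ((w', t), (B, A))" by (metis surj_pair)
      note q = TD[OF x[unfolded xe]]
      have e: "s ! 0 = t ! 0" "s ! l = t ! l" using p q by simp_all
      have "weight w * weight w' * pair_signal b s w B t w' A \<le>
          weight w * weight w' * (amp w B * amp w' A *
            ((\<Prod>j\<le>l. path_vertex_bound w j) * (\<Prod>i\<le>l. pair_vertex_bound s t w' A i)))"
        using pair_signal_expectation_le[OF p(1) q(1) e q(6) p(4) q(4), of b] ww0
        by (intro mult_left_mono mult_nonneg_nonneg) auto
      also have "\<dots> \<le> ?c * W.walk_weight (t ! 0, Bullet, Free) (walk_of s t w' A)"
        using weighted_pair_bound[OF p(1) q(1) e q(6) p(6) q(5)] .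
      finally show "?F x \<le> ?c * W.walk_weight (u, Bullet, Free) (?g x)"
        using q(2) by (simp add: xe)
    qed
    also have "\<dots> = ?c * (\<Sum>ps\<in>?g ` ?T. W.walk_weight (u, Bullet, Free) ps)"
    proof -
      have "inj_on ?g ?T"
      proof (rule inj_onI)
        fix x y assume x: "x \<in> ?T" and y: "y \<in> ?T" and eq: "?g x = ?g y"
        obtain w' t B A where xe: "x = ((w', t), (B, A))" by (metis surj_pair)
        obtain w'' t' B' A' where ye: "y = ((w'', t'), (B', A'))" by (metis surj_pair)
        note q = TD[OF x[unfolded xe]] and r = TD[OF y[unfolded ye]]
        have AA: "A \<subseteq> {..<l}" "A' \<subseteq> {..<l}" "B \<subseteq> {..<l}" "B' \<subseteq> {..<l}"
          "edge_key s w ` B = edge_key t w' ` A" "edge_key s w ` B' = edge_key t' w'' ` A'"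
          using q(6) r(6) by (auto simp: matched_def)
        have "t ! 0 = t' ! 0" "walk_of s t w' A = walk_of s t' w'' A'" using q(2) r(2) eq by (simp_all add: xe ye)
        note w = walk_of_inj[OF q(1) r(1) AA(1,2) this]
        have "edge_key s w ` B = edge_key s w ` B'" using AA(5,6) w by simp
        then have "B = B'" using inj_on_image_eq_iff[OF inj_on_edge_key[OF p(1)] AA(3,4)] by simp
        then show "x = y" using w by (simp add: xe ye)
      qed
      then show ?thesis by (simp add: sum.reindex sum_distrib_left)
    qed
    \<comment> \<open>Nonnegativity of the weights allows the sum to be enlarged to walks that
      intersect themselves.\<close>
    also have "\<dots> \<le> ?c * (\<Sum>ps\<in>W.walks l. W.walk_weight (u, Bullet, Free) ps)"
    proof (intro mult_left_mono[OF _ c0] sum_mono2 W.finite_walks walk_weight_nonneg[OF p(1)])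
      show "?g ` ?T \<subseteq> W.walks l"
      proof (rule image_subsetI)
        fix x assume x: "x \<in> ?T"
        obtain w' t B A where xe: "x = ((w', t), (B, A))" by (metis surj_pair)
        note q = TD[OF x[unfolded xe]]
        have "t ! Suc i \<in> {1..n}" if "i < l" for i
          using q(1,4) that nth_mem[of "Suc i" t] by (auto simp: dpath_def simp del: nth_mem)
        then show "?g x \<in> W.walks l" by (auto simp: xe W.walks_def walk_of_def)
      qed
    qed
    also have "\<dots> = ?c * W.walk_sum l (s ! 0, Bullet, Free)" using p(2) by (simp add: W.walk_sum_def)
    also have "\<dots> \<le> ?c * Wb" by (rule mult_left_mono[OF Wb[OF p(1)] c0])
    finally show ?thesis by (simp add: ac_simps)
  qed
  then have "second_moment b u v \<le> (\<Sum>(w, s)\<in>path_words u v. M / n * Wb * (weight w)\<^sup>2)"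
    unfolding second_moment_def by (intro sum_mono) auto
  then show ?thesis by (simp add: sum_distrib_left case_prod_unfold)
qed

lemma sum_path_words:
  "(\<Sum>(w, s)\<in>path_words u v. f w) = real (card (rooted_paths n l u v)) * (\<Sum>w\<in>words l. f w :: real)"
  by (simp add: path_words_def sum.cartesian_product[symmetric] sum_distrib_left)

lemma prod_pair:
  assumes "u \<in> {1..n}" "v \<in> {1..n}" "u \<noteq> v"
  shows "(\<Prod>x\<in>{1..n}. if x \<in> {u, v} then f x else (1 :: real)) = f u * f v"
proof -
  have "(\<Prod>x\<in>{1..n}. if x \<in> {u, v} then f x else 1) = (\<Prod>x\<in>{u, v}. f x)"
    using assms by (intro prod.mono_neutral_cong_right) auto
  then show ?thesis using assms(3) by simp
qed

lemma first_moment: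
  assumes "u \<in> {1..n}" "v \<in> {1..n}" "u \<noteq> v"
  shows "has_bochner_integral PPn (\<lambda>\<omega>. linear_stat u v \<omega> * (x_vec \<omega> u * x_vec \<omega> v))
    (real (card (rooted_paths n l u v)) * (1 / sqrt n) ^ l * (\<Sum>w\<in>words l. (weight w)\<^sup>2))"
proof -
  have "has_bochner_integral PPn (\<lambda>\<omega>. \<Sum>p\<in>path_words u v. weight (fst p) * ((x_vec \<omega> u * x_vec \<omega> v) * stat (snd p) (fst p) \<omega>))
      (\<Sum>p\<in>path_words u v. weight (fst p) * (weight (fst p) * (1 / sqrt n) ^ l))"
  proof (intro has_bochner_integral_sum has_bochner_integral_mult_right)
    fix p assume "p \<in> path_words u v"
    then have "(fst p, snd p) \<in> path_words u v" by simp
    note p = path_wordsD[OF this]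
    have "(\<Prod>x\<in>{1..n}. path_end (snd p) x (fst \<omega> x)) = x_vec \<omega> u * x_vec \<omega> v" for \<omega> :: sample
      unfolding path_end_def p(2,3) prod_pair[OF assms, of "\<lambda>x. coord Bullet (fst \<omega> x)"]
      by (simp add: x_vec_def coord_def)
    then show "has_bochner_integral PPn (\<lambda>\<omega>. (x_vec \<omega> u * x_vec \<omega> v) * stat (snd p) (fst p) \<omega>)
        (weight (fst p) * (1 / sqrt n) ^ l)"
      using stat_first_moment[OF p(1,5,4)] by simp
  qed
  moreover have "(\<Sum>p\<in>path_words u v. weight (fst p) * ((x_vec \<omega> u * x_vec \<omega> v) * stat (snd p) (fst p) \<omega>)) =
      linear_stat u v \<omega> * (x_vec \<omega> u * x_vec \<omega> v)" for \<omega>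
    by (simp add: linear_stat_def sum_distrib_left sum_distrib_right case_prod_unfold ac_simps)
  moreover have "(\<Sum>p\<in>path_words u v. weight (fst p) * (weight (fst p) * (1 / sqrt n) ^ l)) =
      real (card (rooted_paths n l u v)) * (1 / sqrt n) ^ l * (\<Sum>w\<in>words l. (weight w)\<^sup>2)"
    using sum_path_words[where u = u and v = v and f = "\<lambda>w. (weight w)\<^sup>2 * (1 / sqrt n) ^ l"]
    by (simp add: case_prod_unfold power2_eq_square sum_distrib_left ac_simps)
  ultimately show ?thesis by simp
qed

end

subsection \<open>Transfer matrix and path counts\<close>

definition transfer :: "real \<Rightarrow> decoration \<Rightarrow> decoration \<Rightarrow> real" where
  "transfer \<rho> d e = (if d = e then 1 else \<rho>\<^sup>2)"

text \<open>The characteristic equation of the matrix with entries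
  \<open>transfer \<rho> d e * (edge_weight lam \<mu> e)\<^sup>2\<close>. The discriminant is a sum
  of two nonnegative terms, so the square root is genuine.\<close>

lemma A_plus_quadratic:
  assumes "0 \<le> lam" "0 \<le> \<mu>"
  shows "(A_plus lam \<mu> \<rho> - lam\<^sup>2) * (A_plus lam \<mu> \<rho> - \<mu>\<^sup>2) = \<rho> ^ 4 * lam\<^sup>2 * \<mu>\<^sup>2"
proof -
  define D where "D = lam ^ 4 + \<mu> ^ 4 - (2 - 4 * \<rho> ^ 4) * lam\<^sup>2 * \<mu>\<^sup>2"
  have D: "D = (lam\<^sup>2 - \<mu>\<^sup>2)\<^sup>2 + 4 * \<rho> ^ 4 * lam\<^sup>2 * \<mu>\<^sup>2"
    by (simp add: D_def power2_eq_square power4_eq_xxxx algebra_simps)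
  have "0 \<le> D" unfolding D by simp
  then have sq: "(sqrt D)\<^sup>2 = D" by simp
  have A: "A_plus lam \<mu> \<rho> = (lam\<^sup>2 + \<mu>\<^sup>2 + sqrt D) / 2" by (simp add: A_plus_def D_def)
  have "(A_plus lam \<mu> \<rho> - lam\<^sup>2) * (A_plus lam \<mu> \<rho> - \<mu>\<^sup>2) = ((sqrt D)\<^sup>2 - (lam\<^sup>2 - \<mu>\<^sup>2)\<^sup>2) / 4"
    unfolding A by (simp add: power2_eq_square field_simps)
  then show ?thesis unfolding sq D by simp
qed

text \<open>Both factors on the left of the characteristic equation are positive, since
  \<open>A_plus\<close> exceeds 1 and the squares do not; hence the right side cannot
  vanish.\<close>

lemma A_plus_gt_1_pos:
  assumes "0 \<le> lam" "lam \<le> 1" "0 \<le> \<mu>" "\<mu> \<le> 1" "1 < A_plus lam \<mu> \<rho>"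
  shows "0 < lam" "0 < \<mu>"
proof -
  have le: "lam\<^sup>2 \<le> 1" "\<mu>\<^sup>2 \<le> 1" using assms by (simp_all add: power_le_one)
  then have "0 < (A_plus lam \<mu> \<rho> - lam\<^sup>2) * (A_plus lam \<mu> \<rho> - \<mu>\<^sup>2)" using assms(5) by simp
  then have "0 < \<rho> ^ 4 * lam\<^sup>2 * \<mu>\<^sup>2" using A_plus_quadratic[OF assms(1,3), of \<rho>] by simp
  then have "lam \<noteq> 0" "\<mu> \<noteq> 0" by auto
  then show "0 < lam" "0 < \<mu>" using assms by simp_all
qed

lemma transfer_eigenvector:
  assumes "0 < lam" "lam \<le> 1" "0 < \<mu>" "\<mu> \<le> 1" "0 < \<rho>" "1 < A_plus lam \<mu> \<rho>"
  obtains h hm where "\<And>d. 1 \<le> h d" "\<And>d. h d \<le> hm"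
    "\<And>d. (\<Sum>e\<in>UNIV. transfer \<rho> d e * (edge_weight lam \<mu> e)\<^sup>2 * h e) = A_plus lam \<mu> \<rho> * h d"
proof -
  let ?A = "A_plus lam \<mu> \<rho>"
  have le: "lam\<^sup>2 \<le> 1" using assms by (simp add: power_le_one)
  \<comment> \<open>Read off from the first row of the eigenvalue equation; the second row is then
    the characteristic equation. Division by the smaller entry gives the normalisation
    \<open>1 \<le> h d\<close>.\<close>
  define h0 where "h0 = (\<lambda>d. case d of Bullet \<Rightarrow> \<rho>\<^sup>2 * \<mu>\<^sup>2 | Circ \<Rightarrow> ?A - lam\<^sup>2)"
  have pos: "0 < h0 d" for d using assms le by (cases d) (simp_all add: h0_def)
  define m where "m = min (h0 Bullet) (h0 Circ)"
  have m: "0 < m" "m \<le> h0 d" for d using pos by (cases d; simp add: m_def)+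
  have quad: "?A * (?A - lam\<^sup>2) = \<rho> ^ 4 * lam\<^sup>2 * \<mu>\<^sup>2 + \<mu>\<^sup>2 * (?A - lam\<^sup>2)"
    using A_plus_quadratic[of lam \<mu> \<rho>] assms by (simp add: algebra_simps)
  have eig0: "(\<Sum>e\<in>UNIV. transfer \<rho> d e * (edge_weight lam \<mu> e)\<^sup>2 * h0 e) = ?A * h0 d" for d
    using quad by (cases d)
      (simp_all add: UNIV_decoration transfer_def edge_weight_def h0_def power2_eq_square power4_eq_xxxx algebra_simps)
  show ?thesis
  proof (rule that[of "\<lambda>d. h0 d / m" "max (h0 Bullet / m) (h0 Circ / m)"])
    fix d
    show "1 \<le> h0 d / m" using m(1) m(2)[of d] by simp
    show "h0 d / m \<le> max (h0 Bullet / m) (h0 Circ / m)" by (cases d) simp_all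
    show "(\<Sum>e\<in>UNIV. transfer \<rho> d e * (edge_weight lam \<mu> e)\<^sup>2 * (h0 e / m)) = ?A * (h0 d / m)"
      using eig0[of d] by (simp add: sum_divide_distrib[symmetric])
  qed
qed

text \<open>The squared weight of the rest of a word after the letter \<open>d\<close>. In this form
  the word sums obey the one-step recursion of the transfer matrix.\<close>

fun tail_weight :: "real \<Rightarrow> real \<Rightarrow> real \<Rightarrow> decoration \<Rightarrow> decoration list \<Rightarrow> real" where
  "tail_weight lam \<mu> \<rho> d [] = 1"
| "tail_weight lam \<mu> \<rho> d (e # es) = transfer \<rho> d e * (edge_weight lam \<mu> e)\<^sup>2 * tail_weight lam \<mu> \<rho> e es"

lemma word_weight_Cons2:
  "word_weight lam \<mu> \<rho> (d # e # es) =
    edge_weight lam \<mu> d * (if d = e then 1 else \<rho>) * word_weight lam \<mu> \<rho> (e # es)"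
proof -
  let ?k = "length es"
  have "(\<Prod>i\<in>{1..<Suc (Suc ?k)}. change \<rho> (d # e # es) i) =
      change \<rho> (d # e # es) 1 * (\<Prod>i\<in>{Suc 1..<Suc (Suc ?k)}. change \<rho> (d # e # es) i)"
    by (subst prod.atLeast_Suc_lessThan) auto
  also have "(\<Prod>i\<in>{Suc 1..<Suc (Suc ?k)}. change \<rho> (d # e # es) i) =
      (\<Prod>i\<in>{1..<Suc ?k}. change \<rho> (d # e # es) (Suc i))"
    by (rule prod.shift_bounds_Suc_ivl)
  also have "\<dots> = (\<Prod>i\<in>{1..<Suc ?k}. change \<rho> (e # es) i)"
    by (intro prod.cong refl) (auto simp: change_def nth_Cons')
  finally show ?thesis
    unfolding word_weight_def
    by (simp add: prod.lessThan_Suc_shift change_def del: prod.lessThan_Suc)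
qed

lemma word_weight_tail:
  "(word_weight lam \<mu> \<rho> (d # es))\<^sup>2 = (edge_weight lam \<mu> d)\<^sup>2 * tail_weight lam \<mu> \<rho> d es"
proof (induction es arbitrary: d)
  case Nil
  then show ?case by (simp add: word_weight_def)
next
  case (Cons e es)
  then show ?case
    by (simp add: word_weight_Cons2 power_mult_distrib transfer_def)
qed

definition tail_sum :: "real \<Rightarrow> real \<Rightarrow> real \<Rightarrow> nat \<Rightarrow> decoration \<Rightarrow> real" where
  "tail_sum lam \<mu> \<rho> k d = (\<Sum>es | length es = k \<and> last (d # es) = Bullet. tail_weight lam \<mu> \<rho> d es)"

lemma finite_decoration_lists [simp]: "finite {es :: decoration list. length es = k \<and> P es}"
  by (rule finite_subset[OF _ finite_lists_length_eq[of UNIV k]]) auto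

lemma tail_sum_0: "tail_sum lam \<mu> \<rho> 0 d = of_bool (d = Bullet)"
proof -
  have "{es. length es = 0 \<and> last (d # es) = Bullet} = (if d = Bullet then {[]} else {})" by auto
  then show ?thesis by (simp add: tail_sum_def)
qed

lemma tail_sum_Suc:
  "tail_sum lam \<mu> \<rho> (Suc k) d = (\<Sum>e\<in>UNIV. transfer \<rho> d e * (edge_weight lam \<mu> e)\<^sup>2 * tail_sum lam \<mu> \<rho> k e)"
proof -
  let ?S = "\<lambda>e. {es. length es = k \<and> last (e # es) = Bullet}"
  have "{es. length es = Suc k \<and> last (d # es) = Bullet} = (\<lambda>(e, es). e # es) ` Sigma UNIV ?S"
    by (auto simp: length_Suc_conv image_iff)
  moreover have "inj_on (\<lambda>(e, es). e # es) (Sigma UNIV ?S)" by (auto simp: inj_on_def)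
  ultimately have "tail_sum lam \<mu> \<rho> (Suc k) d = (\<Sum>(e, es)\<in>Sigma UNIV ?S. tail_weight lam \<mu> \<rho> d (e # es))"
    unfolding tail_sum_def by (simp add: sum.reindex case_prod_unfold del: tail_weight.simps)
  also have "\<dots> = (\<Sum>e\<in>UNIV. \<Sum>es\<in>?S e. transfer \<rho> d e * (edge_weight lam \<mu> e)\<^sup>2 * tail_weight lam \<mu> \<rho> e es)"
    by (subst sum.Sigma[symmetric]) auto
  finally show ?thesis by (simp add: tail_sum_def sum_distrib_left)
qed

lemma words_weight_sum:
  assumes "2 \<le> l"
  shows "(\<Sum>w\<in>words l. (word_weight lam \<mu> \<rho> w)\<^sup>2) = lam\<^sup>2 * tail_sum lam \<mu> \<rho> (l - 1) Bullet"
proof -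
  have "words l = Cons Bullet ` {es. length es = l - 1 \<and> last (Bullet # es) = Bullet}"
  proof (intro equalityI subsetI)
    fix w assume w: "w \<in> words l"
    then obtain e es where "w = e # es" using assms by (cases w) (auto simp: words_def)
    then show "w \<in> Cons Bullet ` {es. length es = l - 1 \<and> last (Bullet # es) = Bullet}"
      using w assms last_conv_nth[of w] by (auto simp: words_def)
  next
    fix w assume "w \<in> Cons Bullet ` {es. length es = l - 1 \<and> last (Bullet # es) = Bullet}"
    then show "w \<in> words l"
      using assms last_conv_nth[of w] by (auto simp: words_def)
  qed
  then have "(\<Sum>w\<in>words l. (word_weight lam \<mu> \<rho> w)\<^sup>2) =
      (\<Sum>es | length es = l - 1 \<and> last (Bullet # es) = Bullet. (word_weight lam \<mu> \<rho> (Bullet # es))\<^sup>2)"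
    by (simp add: sum.reindex)
  then show ?thesis
    unfolding word_weight_tail tail_sum_def by (simp add: sum_distrib_left edge_weight_def)
qed

lemma words_weight_sum_ge:
  assumes "0 < lam" "0 < \<rho>" "\<rho> < 1" "0 < \<mu>" "2 \<le> l" "1 < A"
    and h: "\<And>d. 1 \<le> h d" "\<And>d. h d \<le> hm"
    and eig: "\<And>d. (\<Sum>e\<in>UNIV. transfer \<rho> d e * (edge_weight lam \<mu> e)\<^sup>2 * h e) = A * h d"
  shows "lam ^ 4 * \<rho>\<^sup>2 / (A\<^sup>2 * hm) * A ^ l \<le> (\<Sum>w\<in>words l. (word_weight lam \<mu> \<rho> w)\<^sup>2)"
proof -
  have hm: "1 \<le> hm" using h(1)[of Bullet] h(2)[of Bullet] by linarith
  have \<rho>2: "\<rho>\<^sup>2 \<le> 1" using assms by (simp add: power_le_one)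
  \<comment> \<open>The comparison with the eigenvector starts after one step: with no letter left
    the tail sum vanishes at \<open>Circ\<close>, while after one step both entries are at least
    \<open>lam\<^sup>2 * \<rho>\<^sup>2\<close>. This fixes \<open>c\<close>.\<close>
  define c where "c = lam\<^sup>2 * \<rho>\<^sup>2 / (A * hm)"
  have tr: "0 \<le> transfer \<rho> d e" for d e by (simp add: transfer_def)
  have S: "c * A ^ Suc k * h d \<le> tail_sum lam \<mu> \<rho> (Suc k) d" for k d
  proof (induction k arbitrary: d)
    case 0
    have "tail_sum lam \<mu> \<rho> (Suc 0) d = transfer \<rho> d Bullet * lam\<^sup>2"
      unfolding tail_sum_Suc tail_sum_0 by (simp add: UNIV_decoration edge_weight_def)
    moreover have "\<rho>\<^sup>2 * lam\<^sup>2 \<le> transfer \<rho> d Bullet * lam\<^sup>2"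
      using \<rho>2 by (intro mult_right_mono) (auto simp: transfer_def)
    moreover have "c * A ^ Suc 0 * h d = lam\<^sup>2 * \<rho>\<^sup>2 * (h d / hm)"
      using assms hm by (simp add: c_def)
    moreover have "lam\<^sup>2 * \<rho>\<^sup>2 * (h d / hm) \<le> lam\<^sup>2 * \<rho>\<^sup>2 * 1"
      using h(2)[of d] hm by (intro mult_left_mono) auto
    ultimately show ?case by (simp add: mult.commute)
  next
    case (Suc k)
    have "c * A ^ Suc (Suc k) * h d = c * A ^ Suc k * (\<Sum>e\<in>UNIV. transfer \<rho> d e * (edge_weight lam \<mu> e)\<^sup>2 * h e)"
      unfolding eig by simp
    also have "\<dots> = (\<Sum>e\<in>UNIV. transfer \<rho> d e * (edge_weight lam \<mu> e)\<^sup>2 * (c * A ^ Suc k * h e))"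
      by (simp add: sum_distrib_left ac_simps)
    also have "\<dots> \<le> (\<Sum>e\<in>UNIV. transfer \<rho> d e * (edge_weight lam \<mu> e)\<^sup>2 * tail_sum lam \<mu> \<rho> (Suc k) e)"
      using tr Suc.IH by (intro sum_mono mult_left_mono) auto
    finally show ?case unfolding tail_sum_Suc[of _ _ _ "Suc k"] .
  qed
  have c0: "0 \<le> c" using assms hm by (simp add: c_def)
  have l: "Suc (l - 2) = l - 1" "Suc (l - 1) = l" using assms by auto
  have "c * A ^ (l - 1) * 1 \<le> c * A ^ (l - 1) * h Bullet"
    using c0 assms h(1)[of Bullet] by (intro mult_left_mono) auto
  also have "\<dots> \<le> tail_sum lam \<mu> \<rho> (l - 1) Bullet" using S[of "l - 2" Bullet] unfolding l .
  finally have "lam\<^sup>2 * (c * A ^ (l - 1)) \<le> lam\<^sup>2 * tail_sum lam \<mu> \<rho> (l - 1) Bullet"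
    by (intro mult_left_mono) auto
  moreover have "lam\<^sup>2 * (c * A ^ (l - 1)) = lam ^ 4 * \<rho>\<^sup>2 / (A\<^sup>2 * hm) * A ^ l"
  proof -
    have "A ^ l = A * A ^ (l - 1)" using l(2) by (metis power_Suc)
    then show ?thesis using assms hm by (simp add: c_def power2_eq_square power4_eq_xxxx)
  qed
  ultimately show ?thesis unfolding words_weight_sum[OF assms(5)] by simp
qed

section \<open>Counting rooted paths\<close>

lemma card_rooted_paths_le:
  assumes "2 \<le> l"
  shows "card (rooted_paths n l u v) \<le> n ^ (l - 1)"
proof -
  let ?f = "\<lambda>s. map (\<lambda>i. s ! Suc i) [0..<l - 1]"
  have "inj_on ?f (rooted_paths n l u v)"
  proof (rule inj_onI)
    fix s t assume s: "s \<in> rooted_paths n l u v" and t: "t \<in> rooted_paths n l u v" and eq: "?f s = ?f t"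
    have i: "s ! Suc i = t ! Suc i" if "i < l - 1" for i
      using arg_cong[OF eq, of "\<lambda>x. x ! i"] that by simp
    have "s ! i = t ! i" if "i \<le> l" for i
    proof -
      consider "i = 0" | "i = l" | "0 < i" "i < l" using \<open>i \<le> l\<close> by linarith
      then show ?thesis
      proof cases
        case 3
        then show ?thesis using i[of "i - 1"] by simp
      qed (use s t in \<open>auto simp: rooted_paths_def\<close>)
    qed
    then show "s = t" using s t by (intro nth_equalityI) (auto simp: rooted_paths_def)
  qed
  moreover have "?f ` rooted_paths n l u v \<subseteq> {xs. set xs \<subseteq> {1..n} \<and> length xs = l - 1}"
  proof (rule image_subsetI)
    fix s assume s: "s \<in> rooted_paths n l u v"
    have "s ! Suc i \<in> {1..n}" if "i < l - 1" for i
    proof -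
      have "s ! Suc i \<in> set s" using s that by (auto simp: rooted_paths_def)
      then show ?thesis using s by (auto simp: rooted_paths_def)
    qed
    then show "?f s \<in> {xs. set xs \<subseteq> {1..n} \<and> length xs = l - 1}" by auto
  qed
  ultimately have "card (rooted_paths n l u v) \<le> card {xs. set xs \<subseteq> {1..n} \<and> length xs = l - 1}"
    by (intro card_inj_on_le) (auto intro: finite_lists_length_eq)
  then show ?thesis using card_lists_length_eq[of "{1..n}" "l - 1"] by simp
qed

text \<open>The \<open>l - 1\<close> interior vertices are chosen one after another, each time with
  at least \<open>n - l\<close> choices.\<close>

lemma card_rooted_paths_ge:
  assumes "2 \<le> l" "l \<le> n" "u \<in> {1..n}" "v \<in> {1..n}" "u \<noteq> v"
  shows "(n - l) ^ (l - 1) \<le> card (rooted_paths n l u v)"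
proof (cases "l = n")
  \<comment> \<open>The left side is a positive power of 0. The count used in the other case needs
    \<open>l - 1 \<le> n - 2\<close>.\<close>
  case True
  then show ?thesis using assms(1) by (simp add: zero_power)
next
  case False
  let ?X = "{1..n} - {u, v}"
  let ?D = "{xs. length xs = l - 1 \<and> distinct xs \<and> set xs \<subseteq> ?X}"
  have cX: "card ?X = n - 2" using assms by (simp add: card_Diff_subset)
  have "(\<lambda>xs. u # xs @ [v]) ` ?D \<subseteq> rooted_paths n l u v"
    using assms by (auto simp: rooted_paths_def nth_append)
  moreover have "inj_on (\<lambda>xs. u # xs @ [v]) ?D" by (auto simp: inj_on_def)
  ultimately have "card ?D \<le> card (rooted_paths n l u v)"
    by (intro card_inj_on_le[of "\<lambda>xs. u # xs @ [v]"]) auto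
  moreover have "card ?D = \<Prod>{n - 2 - (l - 1) + 1..n - 2}"
    unfolding cX[symmetric] using assms False cX by (intro card_lists_distinct_length_eq) auto
  moreover have "(n - l) ^ (l - 1) \<le> \<Prod>{n - 2 - (l - 1) + 1..n - 2}"
  proof -
    have "card {n - 2 - (l - 1) + 1..n - 2} = l - 1" using assms False by auto
    then have "(n - l) ^ (l - 1) = (\<Prod>i\<in>{n - 2 - (l - 1) + 1..n - 2}. n - l)" by simp
    also have "\<dots> \<le> \<Prod>{n - 2 - (l - 1) + 1..n - 2}"
      using assms by (intro prod_mono) auto
    finally show ?thesis .
  qed
  ultimately show ?thesis by linarith
qed

text \<open>Bernoulli's inequality for the power \<open>l - 1\<close> of 1 - l / n.\<close>

lemma card_rooted_paths_ratio:
  assumes "2 \<le> l" "l \<le> n" "u \<in> {1..n}" "v \<in> {1..n}" "u \<noteq> v"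
  shows "1 - (real l)\<^sup>2 / n \<le> real (card (rooted_paths n l u v)) / real n ^ (l - 1)"
proof -
  have n: "0 < real n" using assms by auto
  have "1 - (real l)\<^sup>2 / n \<le> 1 + real (l - 1) * (- real l / n)"
  proof -
    have "real (l - 1) * real l \<le> real l * real l" by (intro mult_right_mono) auto
    then show ?thesis using n by (simp add: power2_eq_square divide_right_mono)
  qed
  also have "\<dots> \<le> (1 + - real l / n) ^ (l - 1)"
    using assms(2) n by (intro Bernoulli_inequality) (simp add: field_simps)
  also have "\<dots> = (real (n - l)) ^ (l - 1) / real n ^ (l - 1)"
    using assms(2) n by (simp add: power_divide[symmetric] of_nat_diff diff_divide_distrib)
  also have "\<dots> \<le> real (card (rooted_paths n l u v)) / real n ^ (l - 1)"
    using card_rooted_paths_ge[OF assms] n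
    by (intro divide_right_mono) (simp_all flip: of_nat_power)
  finally show ?thesis .
qed

text \<open>Keeps l^2 / n bounded for every \<open>n\<close> and not merely eventually, as required
  for moment bounds that hold for all \<open>n\<close>.\<close>

lemma ln_sq_le:
  assumes "1 \<le> x"
  shows "(ln x)\<^sup>2 \<le> 4 * (x :: real)"
proof -
  have "ln x = 2 * ln (sqrt x)" using assms by (simp add: ln_sqrt)
  moreover have "ln (sqrt x) \<le> sqrt x" using assms by (intro order_trans[OF ln_le_minus_one]) auto
  ultimately have "ln x \<le> 2 * sqrt x" by simp
  then have "(ln x)\<^sup>2 \<le> (2 * sqrt x)\<^sup>2" using assms by (intro power_mono) auto
  then show ?thesis using assms by (simp add: power_mult_distrib)
qed

subsection \<open>Uniform moment bounds\<close>

context spiked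
begin

abbreviation \<beta> :: real where "\<beta> \<equiv> beta_J lam \<mu> \<rho> l"

abbreviation weight_sum :: real where "weight_sum \<equiv> \<Sum>w\<in>words l. (weight w)\<^sup>2"

definition Phi :: "nat \<Rightarrow> nat \<Rightarrow> sample \<Rightarrow> real" where
  "Phi u v \<omega> = Phi_J lam \<mu> \<rho> n l (X_mat lam n \<omega>) (Y_mat \<mu> n \<omega>) u v"

lemma weight_sum_beta: "\<beta> \<le> weight_sum" "weight_sum \<le> 4 * \<beta>"
  using beta_J_bounds[of l] l_ge by auto

lemma Phi_eq: "Phi u v \<omega> = 1 / (real n powr (real l / 2 - 1) * \<beta>) * linear_stat u v \<omega>"
proof -
  have "0 < l" using l_ge by simp
  then show ?thesis
    unfolding Phi_def Phi_J_def Phi_sum_eq[OF \<open>0 < l\<close>] linear_stat_def stat_def path_words_def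
    by (simp add: sum.cartesian_product)
qed

text \<open>The normalising exponent is not an integer for odd \<open>l\<close>, hence
  \<open>powr\<close>; its square is an ordinary power.\<close>

lemma powr_sq: "(real n powr (real l / 2 - 1))\<^sup>2 = real n ^ (l - 2)"
proof -
  have "(real n powr (real l / 2 - 1))\<^sup>2 = real n powr (real (l - 2))"
    using l_ge n_pos by (simp add: powr_powr[symmetric] powr_numeral[symmetric] powr_add[symmetric] power2_eq_square of_nat_diff)
  then show ?thesis using n_pos by (simp add: powr_realpow)
qed

lemma end_weight_prod:
  assumes "u \<in> {1..n}" "v \<in> {1..n}" "u \<noteq> v"
  shows "(\<Prod>x\<in>{1..n}. end_weight True u v x (fst \<omega> x)) = (x_vec \<omega> u)\<^sup>2 * (x_vec \<omega> v)\<^sup>2"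
    and "(\<Prod>x\<in>{1..n}. end_weight False u v x (fst \<omega> x)) = 1"
  using prod_pair[OF assms, of "\<lambda>x. coord Bullet (fst \<omega> x) * coord Bullet (fst \<omega> x)"]
  by (simp_all add: end_weight_def coord_def x_vec_def power2_eq_square)

text \<open>Against the squared normalisation \<open>n ^ (l - 2) * \<beta>\<^sup>2\<close> stand at
  most \<open>n ^ (l - 1)\<close> vertex sequences, a factor \<open>1 / n\<close> and a word sum of
  at most \<open>4 * \<beta>\<close>.\<close>

lemma Phi_moment:
  assumes Wb: "\<And>w s. dpath l s w \<Longrightarrow> planted_walk.walk_sum s w l n L \<rho> (M / \<rho>) l (s ! 0, Bullet, Free) \<le> Wb"
    and "0 \<le> Wb" "0 < \<beta>"
  shows "integrable PPn (\<lambda>\<omega>. (\<Prod>x\<in>{1..n}. end_weight b u v x (fst \<omega> x)) * (Phi u v \<omega>)\<^sup>2)"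
    and "(\<integral>\<omega>. (\<Prod>x\<in>{1..n}. end_weight b u v x (fst \<omega> x)) * (Phi u v \<omega>)\<^sup>2 \<partial>PPn) \<le> 4 * M * Wb / \<beta>"
proof -
  let ?E = "\<lambda>\<omega> :: sample. \<Prod>x\<in>{1..n}. end_weight b u v x (fst \<omega> x)"
  let ?k = "1 / (real n ^ (l - 2) * \<beta>\<^sup>2)"
  have sq: "?E \<omega> * (Phi u v \<omega>)\<^sup>2 = ?k * (?E \<omega> * (linear_stat u v \<omega>)\<^sup>2)" for \<omega>
    unfolding Phi_eq by (simp add: power_mult_distrib power_divide powr_sq)
  have "has_bochner_integral PPn (\<lambda>\<omega>. ?E \<omega> * (Phi u v \<omega>)\<^sup>2) (?k * second_moment b u v)"
    unfolding sq by (intro has_bochner_integral_mult_right second_moment)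
  then show "integrable PPn (\<lambda>\<omega>. ?E \<omega> * (Phi u v \<omega>)\<^sup>2)"
    by (auto simp: has_bochner_integral_iff)
  have eq: "(\<integral>\<omega>. ?E \<omega> * (Phi u v \<omega>)\<^sup>2 \<partial>PPn) = ?k * second_moment b u v"
    using \<open>has_bochner_integral PPn _ _\<close> by (auto simp: has_bochner_integral_iff)
  have n0: "0 < real n" using n_pos by simp
  have MW: "0 \<le> M / n * Wb" using M_ge assms by simp
  have l: "l - 1 = Suc (l - 2)" using l_ge by simp
  have "second_moment b u v \<le> M / n * Wb * (real (card (rooted_paths n l u v)) * weight_sum)"
    using second_moment_le[OF Wb, of b u v] unfolding sum_path_words by simp
  also have "\<dots> \<le> M / n * Wb * (real (n ^ (l - 1)) * (4 * \<beta>))"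
    using card_rooted_paths_le[OF l_ge, of n u v] weight_sum_beta MW
    by (intro mult_left_mono mult_mono of_nat_mono) (auto intro!: sum_nonneg)
  also have "\<dots> = 4 * M * Wb * \<beta> * real n ^ (l - 2)"
    unfolding l using n0 by simp
  finally have "?k * second_moment b u v \<le> ?k * (4 * M * Wb * \<beta> * real n ^ (l - 2))"
    using assms n0 by (intro mult_left_mono) auto
  also have "\<dots> = 4 * M * Wb / \<beta>" using assms n0 by (simp add: power2_eq_square)
  finally show "(\<integral>\<omega>. ?E \<omega> * (Phi u v \<omega>)\<^sup>2 \<partial>PPn) \<le> 4 * M * Wb / \<beta>"
    using eq by simp
qed

end

text \<open>\<open>B1\<close> and \<open>B2\<close> are the constants of \<^locale>\<open>planted_walk_potential\<close>, with \<open>q = M / \<rho>\<close>.\<close>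

definition moment_const :: "real \<Rightarrow> real \<Rightarrow> real \<Rightarrow> real \<Rightarrow> real \<Rightarrow> real \<Rightarrow> real" where
  "moment_const lam \<rho> C K A hm =
    (let M = 1 + 2 * C; q = M / \<rho>; B1 = 2 * q * hm / (A - 1) + q; B2 = 2 * q * hm + 2 * q * B1
     in 16 * M * (B2 * (exp (16 * B2 * K\<^sup>2) * (1 + 2 * q / (A - 1))) + q) / (lam ^ 4 * \<rho>\<^sup>2 / (A\<^sup>2 * hm)))"

context spiked
begin

text \<open>The walk sum is at most and \<open>\<beta>\<close> at least of order
  \<open>A ^ l\<close>. Here \<open>real n \<le> A ^ l\<close> absorbs the fully matched walk, and
  the logarithmic length keeps \<open>(1 + \<theta>) ^ l\<close> bounded.\<close>

lemma Phi_moment_le: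
  assumes A: "1 < A" and h: "\<And>d. 1 \<le> h d" "\<And>d. h d \<le> hm"
    and eig: "\<And>d. (\<Sum>e\<in>UNIV. transfer \<rho> d e * (L e)\<^sup>2 * h e) = A * h d"
    and nA: "real n \<le> A ^ l" and lK: "real l \<le> K * ln (real n)"
  shows "integrable PPn (\<lambda>\<omega>. (\<Prod>x\<in>{1..n}. end_weight b u v x (fst \<omega> x)) * (Phi u v \<omega>)\<^sup>2)"
    and "(\<integral>\<omega>. (\<Prod>x\<in>{1..n}. end_weight b u v x (fst \<omega> x)) * (Phi u v \<omega>)\<^sup>2 \<partial>PPn)
      \<le> moment_const lam \<rho> C K A hm"
    and "0 < \<beta>"
proof -
  define q where "q = M / \<rho>"
  define b1 where "b1 = 2 * q * hm / (A - 1) + q"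
  define b2 where "b2 = 2 * q * hm + 2 * q * b1"
  define Wc where "Wc = b2 * (exp (16 * b2 * K\<^sup>2) * (1 + 2 * q / (A - 1))) + q"
  have n1: "1 \<le> real n" using n_pos by simp
  have q1: "1 \<le> q" using M_ge rho by (simp add: q_def)
  have hm: "1 \<le> hm" using h(1)[of Bullet] h(2)[of Bullet] by linarith
  have b1_0: "0 \<le> b1" unfolding b1_def using q1 hm A by simp
  have b2_0: "0 \<le> b2" unfolding b2_def using q1 hm b1_0 by simp
  define c0 where "c0 = lam ^ 4 * \<rho>\<^sup>2 / (A\<^sup>2 * hm)"
  have c0: "0 < c0" using lam rho A hm by (simp add: c0_def)
  have Z: "c0 * A ^ l \<le> weight_sum"
    unfolding c0_def by (rule words_weight_sum_ge[OF lam(1) rho mu(1) l_ge A h eig])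
  have Al: "0 < A ^ l" using A by simp
  have "0 < weight_sum" using Z c0 Al by (auto intro: less_le_trans[OF mult_pos_pos])
  then show \<beta>0: "0 < \<beta>" using weight_sum_beta by linarith
  have l2: "(real l)\<^sup>2 / n \<le> 4 * K\<^sup>2"
  proof -
    have "(real l)\<^sup>2 \<le> (K * ln n)\<^sup>2" using lK by (intro power_mono) auto
    also have "\<dots> \<le> K\<^sup>2 * (4 * n)"
      unfolding power_mult_distrib using ln_sq_le[OF n1] by (intro mult_left_mono) auto
    finally show ?thesis using n1 by (simp add: field_simps)
  qed
  have Wb: "planted_walk.walk_sum s w l n L \<rho> q l (s ! 0, Bullet, Free) \<le> A ^ l * Wc" if "dpath l s w" for s w
  proof -
    interpret W: planted_walk_potential s w l n L \<rho> q A hm h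
      using that n_pos L A q1 h eig rho
      by unfold_locales (auto simp: transfer_def power_le_one intro: less_imp_le)
    have B2: "W.B2 = b2" unfolding W.B2_def W.B1_def b2_def b1_def ..
    \<comment> \<open>The 16 consists of 2 from \<open>\<theta>\<close>, 2 from
      \<open>l + 1 \<le> 2 * l\<close> and 4 from \<open>ln_sq_le\<close>.\<close>
    have "W.\<theta> * real l \<le> 16 * b2 * K\<^sup>2"
    proof -
      have "(real l + 1) * real l \<le> 2 * (real l)\<^sup>2"
        using l_ge by (simp add: power2_eq_square algebra_simps)
      then have "2 * ((real l + 1) * real l) * b2 / n \<le> 2 * (2 * (real l)\<^sup>2) * b2 / n"
        using b2_0 by (intro divide_right_mono mult_right_mono mult_left_mono) auto
      also have "\<dots> = 4 * b2 * ((real l)\<^sup>2 / n)" by simp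
      also have "\<dots> \<le> 4 * b2 * (4 * K\<^sup>2)" using l2 b2_0 by (intro mult_left_mono) auto
      finally show ?thesis unfolding W.\<theta>_def B2 by (simp add: ac_simps)
    qed
    then have "exp (W.\<theta> * real l) \<le> exp (16 * b2 * K\<^sup>2)" by simp
    moreover have "(1 + W.\<theta>) ^ l \<le> exp (W.\<theta> * real l)"
    proof -
      have "(1 + W.\<theta>) ^ l \<le> exp W.\<theta> ^ l"
        using W.theta_nonneg exp_ge_add_one_self[of "W.\<theta>"] by (intro power_mono) auto
      then show ?thesis by (simp add: exp_of_nat2_mult)
    qed
    ultimately have e: "(1 + W.\<theta>) ^ l \<le> exp (16 * b2 * K\<^sup>2)" by linarith
    have q0: "0 \<le> 2 * q / (A - 1)" using q1 A by simp
    have "W.walk_sum l (s ! 0, Bullet, Free) \<le> A ^ l * (b2 * ((1 + W.\<theta>) ^ l * (1 + 2 * q / (A - 1)))) + q * n"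
      using W.walk_sum_start_le unfolding B2 .
    also have "\<dots> \<le> A ^ l * (b2 * (exp (16 * b2 * K\<^sup>2) * (1 + 2 * q / (A - 1)))) + q * A ^ l"
      using e Al b2_0 q1 nA q0 by (intro add_mono mult_left_mono mult_right_mono) auto
    also have "\<dots> = A ^ l * Wc" by (simp add: Wc_def algebra_simps)
    finally show ?thesis .
  qed
  have Wc0: "0 \<le> Wc" unfolding Wc_def using b2_0 q1 A by simp
  have AW: "0 \<le> A ^ l * Wc" using Al Wc0 by simp
  note P = Phi_moment[OF Wb[unfolded q_def] AW \<beta>0, of b u v]
  show "integrable PPn (\<lambda>\<omega>. (\<Prod>x\<in>{1..n}. end_weight b u v x (fst \<omega> x)) * (Phi u v \<omega>)\<^sup>2)"
    by (rule P(1))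
  have "4 * M * (A ^ l * Wc) / \<beta> \<le> 16 * M * Wc / c0"
  proof -
    have "c0 * A ^ l \<le> 4 * \<beta>" using Z weight_sum_beta by linarith
    then have "(4 * M * Wc) * (c0 * A ^ l) \<le> (4 * M * Wc) * (4 * \<beta>)"
      using M_ge Wc0 by (intro mult_left_mono) auto
    then show ?thesis using c0 \<beta>0 by (simp add: field_simps)
  qed
  also have "\<dots> = moment_const lam \<rho> C K A hm"
    unfolding moment_const_def Let_def Wc_def c0_def b2_def b1_def q_def M_def ..
  finally show "(\<integral>\<omega>. (\<Prod>x\<in>{1..n}. end_weight b u v x (fst \<omega> x)) * (Phi u v \<omega>)\<^sup>2 \<partial>PPn)
      \<le> moment_const lam \<rho> C K A hm"
    using P(2) by linarith
qed

section \<open>Measurability, marginals and the first moment\<close>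

lemma measurable_x_vec [measurable]:
  assumes "i \<in> {1..n}" shows "(\<lambda>\<omega>. x_vec \<omega> i) \<in> borel_measurable PPn"
proof -
  have "(\<lambda>\<omega>. fst \<omega> i) \<in> measurable PPn \<pi>"
    unfolding PP_eq using assms
    by (intro measurable_compose[OF measurable_fst] measurable_component_singleton)
  moreover have "fst \<in> borel_measurable \<pi>"
    by (simp add: measurable_cong_sets[OF sets_prior refl] borel_prod[symmetric])
  ultimately show ?thesis unfolding x_vec_def by (rule measurable_compose)
qed

lemma measurable_stat:
  assumes p: "dpath l s w" and sub: "set s \<subseteq> {1..n}"
  shows "stat s w \<in> borel_measurable PPn"
proof -
  have coord: "(\<lambda>\<omega>. coord d (fst \<omega> i)) \<in> borel_measurable PPn" if "i \<in> {1..n}" for d i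
  proof -
    have "(\<lambda>\<omega>. fst \<omega> i) \<in> measurable PPn \<pi>"
      unfolding PP_eq using that
      by (intro measurable_compose[OF measurable_fst] measurable_component_singleton)
    moreover have "coord d \<in> borel_measurable \<pi>"
      by (simp add: measurable_cong_sets[OF sets_prior refl])
    ultimately show ?thesis by (rule measurable_compose)
  qed
  have noise: "(\<lambda>\<omega>. noise (snd \<omega>) k) \<in> borel_measurable PPn" if "k \<in> UNIV \<times> strict_index n" for k
  proof -
    obtain d e where k: "k = (d, e)" by (cases k)
    have e: "e \<in> wigner_index n" using that by (auto simp: k strict_index_def wigner_index_def)
    have c: "(\<lambda>x. x e) \<in> borel_measurable (wigner_law n)"
      using measurable_component_singleton[OF e, of wigner_entry]
      by (simp add: wigner_law_eq measurable_cong_sets[OF refl sets_wigner_entry])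
    have "(\<lambda>\<omega>. fst (snd \<omega>)) \<in> measurable PPn (wigner_law n)" "(\<lambda>\<omega>. snd (snd \<omega>)) \<in> measurable PPn (wigner_law n)"
      unfolding PP_eq by measurable
    from measurable_compose[OF this(1) c] measurable_compose[OF this(2) c]
    show ?thesis by (cases d) (simp_all add: noise_def k)
  qed
  have s: "s ! j \<in> {1..n}" if "j \<le> l" for j
  proof -
    have "s ! j \<in> set s" using p that by (auto simp: dpath_def)
    then show ?thesis using sub by blast
  qed
  have "(\<lambda>\<omega>. (\<Prod>k\<in>edge_key s w ` B. noise (snd \<omega>) k) * signal s w B (fst \<omega>)) \<in> borel_measurable PPn"
    if "B \<in> Pow {..<l}" for B
    unfolding signal_def using that edge_key_subset[OF p sub, of B] s
    by (intro borel_measurable_times borel_measurable_prod noise coord borel_measurable_const) auto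
  then show ?thesis unfolding stat_eq[OF p, abs_def] by (intro borel_measurable_sum)
qed

lemma measurable_Phi [measurable]: "Phi u v \<in> borel_measurable PPn"
proof -
  have "linear_stat u v \<in> borel_measurable PPn"
    unfolding linear_stat_def[abs_def] case_prod_unfold
  proof (intro borel_measurable_sum borel_measurable_times borel_measurable_const)
    fix p assume "p \<in> path_words u v"
    then have "(fst p, snd p) \<in> path_words u v" by simp
    from path_wordsD[OF this] show "stat (snd p) (fst p) \<in> borel_measurable PPn"
      by (intro measurable_stat)
  qed
  then show ?thesis unfolding Phi_eq[abs_def] by (intro borel_measurable_times borel_measurable_const)
qed

lemma marginal:
  assumes "i \<in> {1..n}" "has_bochner_integral \<pi> f (a :: real)"
  shows "has_bochner_integral PPn (\<lambda>\<omega>. f (fst \<omega> i)) a"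
proof -
  interpret N: prob_space "wigner_law n \<Otimes>\<^sub>M wigner_law n" by (rule prob_space_noise)
  have one: "has_bochner_integral \<pi> (\<lambda>_. 1) (1 :: real)"
    by (simp add: has_bochner_integral_iff prob_space)
  have "has_bochner_integral P1 (\<lambda>p. \<Prod>x\<in>{1..n}. (if x = i then f else (\<lambda>_. 1)) (p x)) (\<Prod>x\<in>{1..n}. if x = i then a else 1)"
    using assms(2) one by (intro has_bochner_integral_PiM_prod prob_space_axioms) auto
  moreover have "(\<Prod>x\<in>{1..n}. (if x = i then f else (\<lambda>_. 1)) (p x)) = f (p i)" for p
  proof -
    have "(\<Prod>x\<in>{1..n}. (if x = i then f else (\<lambda>_. 1)) (p x)) = (\<Prod>x\<in>{1..n}. if x = i then f (p x) else 1)"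
      by (intro prod.cong) auto
    then show ?thesis using assms(1) by simp
  qed
  moreover have "(\<Prod>x\<in>{1..n}. if x = i then a else 1) = a" using assms(1) by simp
  ultimately have "has_bochner_integral P1 (\<lambda>p. f (p i)) a" by simp
  moreover have "has_bochner_integral (wigner_law n \<Otimes>\<^sub>M wigner_law n) (\<lambda>_. 1) (1 :: real)"
    by (simp add: has_bochner_integral_iff N.prob_space)
  ultimately have "has_bochner_integral PPn (\<lambda>\<omega>. (\<lambda>p. f (p i)) (fst \<omega>) * (\<lambda>_. 1) (snd \<omega>)) (a * 1)"
    unfolding PP_eq
    by (intro has_bochner_integral_pair_mult prob_space_imp_sigma_finite prob_space_P1 prob_space_noise)
  then show ?thesis by simp
qed

lemma x_vec_fourth:
  assumes "i \<in> {1..n}"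
  shows "integrable PPn (\<lambda>\<omega>. (x_vec \<omega> i) ^ 4)" "(\<integral>\<omega>. (x_vec \<omega> i) ^ 4 \<partial>PPn) \<le> C"
proof -
  have "has_bochner_integral \<pi> (\<lambda>p. fst p ^ 4) (\<integral>p. fst p ^ 4 \<partial>\<pi>)" "(\<integral>p. fst p ^ 4 \<partial>\<pi>) \<le> C"
    using correlated by (auto simp: correlated_prior_def has_bochner_integral_iff)
  then show "integrable PPn (\<lambda>\<omega>. (x_vec \<omega> i) ^ 4)" "(\<integral>\<omega>. (x_vec \<omega> i) ^ 4 \<partial>PPn) \<le> C"
    using marginal[OF assms, of "\<lambda>p. fst p ^ 4"] by (auto simp: has_bochner_integral_iff x_vec_def)
qed

lemma Phi_self: "Phi w w \<omega> = 0"
proof -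
  have "rooted_paths n l w w = {}"
    using l_ge by (auto simp: rooted_paths_def nth_eq_iff_index_eq)
  then show ?thesis by (simp add: Phi_eq linear_stat_def path_words_def)
qed

text \<open>The powers of \<open>n\<close> combine to the proportion of admissible sequences among
  \<open>n ^ (l - 1)\<close>, and the quotient of the word sum by \<open>\<beta>\<close> is at least
  1.\<close>

lemma Phi_first_moment:
  assumes "u \<in> {1..n}" "v \<in> {1..n}" "u \<noteq> v" "l \<le> n" "0 < \<beta>"
  shows "integrable PPn (\<lambda>\<omega>. Phi u v \<omega> * (x_vec \<omega> u * x_vec \<omega> v))"
    and "1 - (real l)\<^sup>2 / n \<le> (\<integral>\<omega>. Phi u v \<omega> * (x_vec \<omega> u * x_vec \<omega> v) \<partial>PPn)"
proof -
  let ?k = "1 / (real n powr (real l / 2 - 1) * \<beta>)"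
  have "has_bochner_integral PPn (\<lambda>\<omega>. ?k * (linear_stat u v \<omega> * (x_vec \<omega> u * x_vec \<omega> v)))
    (?k * (real (card (rooted_paths n l u v)) * (1 / sqrt n) ^ l * weight_sum))"
    by (intro has_bochner_integral_mult_right first_moment[OF assms(1-3)])
  then have hb: "has_bochner_integral PPn (\<lambda>\<omega>. Phi u v \<omega> * (x_vec \<omega> u * x_vec \<omega> v))
    (?k * (real (card (rooted_paths n l u v)) * (1 / sqrt n) ^ l * weight_sum))"
    by (simp add: Phi_eq mult.assoc)
  then show "integrable PPn (\<lambda>\<omega>. Phi u v \<omega> * (x_vec \<omega> u * x_vec \<omega> v))"
    by (simp add: has_bochner_integral_iff)
  have n0: "0 < real n" using n_pos by simp
  have pw: "real n powr (real l / 2 - 1) * sqrt n ^ l = real n ^ (l - 1)"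
  proof -
    have "sqrt n ^ l = real n powr (real l / 2)"
      using n0 by (simp add: powr_half_sqrt[symmetric] powr_powr flip: powr_realpow)
    then have "real n powr (real l / 2 - 1) * sqrt n ^ l = real n powr (real (l - 1))"
      using l_ge by (simp add: powr_add[symmetric] of_nat_diff)
    then show ?thesis using n0 by (simp add: powr_realpow)
  qed
  have "1 - (real l)\<^sup>2 / n \<le> real (card (rooted_paths n l u v)) / real n ^ (l - 1) * 1"
    using card_rooted_paths_ratio[OF l_ge assms(4,1,2,3)] by simp
  also have "\<dots> \<le> real (card (rooted_paths n l u v)) / real n ^ (l - 1) * (weight_sum / \<beta>)"
    using weight_sum_beta assms(5) by (intro mult_left_mono) auto
  also have "\<dots> = ?k * (real (card (rooted_paths n l u v)) * (1 / sqrt n) ^ l * weight_sum)"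
    unfolding pw[symmetric] by (simp add: power_one_over field_simps)
  finally show "1 - (real l)\<^sup>2 / n \<le> (\<integral>\<omega>. Phi u v \<omega> * (x_vec \<omega> u * x_vec \<omega> v) \<partial>PPn)"
    using hb by (simp add: has_bochner_integral_iff)
qed

end

subsection \<open>Correlation of the estimator\<close>

context spiked
begin

definition xhat :: "real \<Rightarrow> nat \<Rightarrow> sample \<Rightarrow> nat \<Rightarrow> real" where
  "xhat R w \<omega> u = (if \<bar>Phi w u \<omega>\<bar> \<le> R ^ 4 then Phi w u \<omega> else 0)"

lemma xhat_eq: "x_hat lam \<mu> \<rho> n l R w (X_mat lam n \<omega>) (Y_mat \<mu> n \<omega>) = xhat R w \<omega>"
  by (simp add: fun_eq_iff x_hat_def xhat_def Phi_def)

text \<open>Beyond the threshold \<open>\<bar>p\<bar>\<close> is at most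
  \<open>p\<^sup>2 / R ^ 4\<close>, and \<open>2 * \<bar>y\<bar> \<le> y\<^sup>2 + 1\<close> splits
  the loss into the two moments bounded by \<open>R\<close>. This is why both moments are
  controlled.\<close>

lemma truncation_le:
  fixes p y R :: real
  assumes "1 \<le> R"
  shows "p * y - (p\<^sup>2 * y\<^sup>2 + p\<^sup>2) / (2 * R ^ 4) \<le> (if \<bar>p\<bar> \<le> R ^ 4 then p else 0) * y"
proof (cases "\<bar>p\<bar> \<le> R ^ 4")
  case True
  have "0 \<le> (p\<^sup>2 * y\<^sup>2 + p\<^sup>2) / (2 * R ^ 4)" using assms by simp
  then show ?thesis using True by simp
next
  case False
  have R: "0 < R ^ 4" using assms by simp
  have "R ^ 4 * \<bar>p\<bar> * (2 * \<bar>y\<bar>) \<le> \<bar>p\<bar> * \<bar>p\<bar> * (y\<^sup>2 + 1)"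
  proof (intro mult_mono)
    show "2 * \<bar>y\<bar> \<le> y\<^sup>2 + 1" using zero_le_power2[of "\<bar>y\<bar> - 1"] by (simp add: power2_eq_square algebra_simps)
  qed (use False R in auto)
  then have "2 * R ^ 4 * \<bar>p * y\<bar> \<le> p\<^sup>2 * y\<^sup>2 + p\<^sup>2"
    by (simp add: abs_mult power2_eq_square algebra_simps)
  then have "\<bar>p * y\<bar> \<le> (p\<^sup>2 * y\<^sup>2 + p\<^sup>2) / (2 * R ^ 4)" using R by (simp add: field_simps)
  then show ?thesis using False by simp
qed

text \<open>Linearises the product of the cosine with the norm of \<open>b\<close> and
  \<open>z\<close>: it is separated by
  \<open>2 * Q * y \<le> \<alpha> * Q\<^sup>2 + y\<^sup>2 / \<alpha>\<close> and
  \<open>Q\<^sup>2 \<le> Q\<close>, so that expectations can be taken term by term without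
  independence.\<close>

lemma cosine_bound:
  fixes a b :: "nat \<Rightarrow> real" and T \<alpha> z :: real
  assumes T: "\<And>i. i \<in> {1..n} \<Longrightarrow> \<bar>a i\<bar> \<le> T" and "0 < \<alpha>" "0 \<le> T"
  shows "(\<Sum>i\<in>{1..n}. a i * b i) * z \<le>
    T * n / 2 * (\<alpha> * abs_cosine n a b + (\<Sum>i\<in>{1..n}. (b i ^ 4 + z ^ 4) / 2) / n / \<alpha>)"
    and "0 \<le> abs_cosine n a b" "abs_cosine n a b \<le> 1"
proof -
  define S where "S = \<bar>\<Sum>i\<in>{1..n}. a i * b i\<bar>"
  define N1 where "N1 = L2_set a {1..n}"
  define N2 where "N2 = L2_set b {1..n}"
  define Q where "Q = abs_cosine n a b"
  have n0: "0 < real n" using n_pos by simp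
  have N: "0 \<le> N1" "0 \<le> N2" by (simp_all add: N1_def N2_def)
  have "S \<le> (\<Sum>i\<in>{1..n}. \<bar>a i\<bar> * \<bar>b i\<bar>)"
    unfolding S_def using sum_abs[of "\<lambda>i. a i * b i" "{1..n}"] by (simp add: abs_mult)
  also have "\<dots> \<le> N1 * N2" unfolding N1_def N2_def by (rule L2_set_mult_ineq)
  finally have CS: "S \<le> N1 * N2" .
  have Q: "Q = S / (N1 * N2)" by (simp add: Q_def abs_cosine_def S_def N1_def N2_def)
  show Q0: "0 \<le> abs_cosine n a b" using N Q by (simp add: Q_def S_def)
  show Q1: "abs_cosine n a b \<le> 1"
    using CS N Q unfolding Q_def[symmetric] by (cases "N1 * N2 = 0") (auto simp: divide_le_eq)
  \<comment> \<open>Also valid if a norm vanishes: then \<open>S = 0\<close> by \<open>CS\<close>,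
    and \<open>Q\<close> is 0 by the convention for division.\<close>
  have SQ: "S = Q * (N1 * N2)"
    using CS N unfolding Q by (cases "N1 * N2 = 0") (auto simp: S_def)
  have N1: "N1 \<le> T * sqrt n"
  proof -
    have "(\<Sum>i\<in>{1..n}. (a i)\<^sup>2) \<le> (\<Sum>i\<in>{1..n}. T\<^sup>2)"
      using T assms(3) by (intro sum_mono) (simp add: abs_le_square_iff[symmetric])
    then have "N1 \<le> sqrt (n * T\<^sup>2)" unfolding N1_def L2_set_def by (intro real_sqrt_le_mono) simp
    then show ?thesis using assms(3) by (simp add: real_sqrt_mult mult.commute)
  qed
  define y where "y = N2 * \<bar>z\<bar> / sqrt n"
  have y2: "y\<^sup>2 = (\<Sum>i\<in>{1..n}. (b i)\<^sup>2 * z\<^sup>2) / n"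
    using n0 by (simp add: y_def power_mult_distrib power_divide N2_def L2_set_def sum_nonneg sum_distrib_right)
  also have "\<dots> \<le> (\<Sum>i\<in>{1..n}. (b i ^ 4 + z ^ 4) / 2) / n"
  proof (intro divide_right_mono sum_mono)
    fix i
    show "(b i)\<^sup>2 * z\<^sup>2 \<le> (b i ^ 4 + z ^ 4) / 2"
      using zero_le_power2[of "(b i)\<^sup>2 - z\<^sup>2"] by (simp add: power2_eq_square power4_eq_xxxx algebra_simps)
  qed simp
  finally have y4: "y\<^sup>2 \<le> (\<Sum>i\<in>{1..n}. (b i ^ 4 + z ^ 4) / 2) / n" .
  have "(\<Sum>i\<in>{1..n}. a i * b i) * z \<le> S * \<bar>z\<bar>"
    unfolding S_def abs_mult[symmetric] by simp
  also have "\<dots> = Q * (N1 * (N2 * \<bar>z\<bar>))" unfolding SQ by simp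
  also have "\<dots> \<le> Q * (T * sqrt n * (N2 * \<bar>z\<bar>))"
    using N1 N Q0 by (intro mult_left_mono mult_right_mono) (auto simp: Q_def)
  also have "\<dots> = T * n * (Q * y)"
    using n0 by (simp add: y_def field_simps)
  also have "\<dots> \<le> T * n * ((\<alpha> * Q + y\<^sup>2 / \<alpha>) / 2)"
  proof (intro mult_left_mono)
    have "2 * (Q * y) * \<alpha> \<le> (\<alpha> * Q)\<^sup>2 + y\<^sup>2"
      using zero_le_power2[of "\<alpha> * Q - y"] by (simp add: power2_eq_square algebra_simps)
    also have "(\<alpha> * Q)\<^sup>2 \<le> \<alpha>\<^sup>2 * Q"
    proof -
      have "Q\<^sup>2 \<le> Q" using mult_left_mono[OF Q1 Q0] by (simp add: Q_def power2_eq_square)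
      then show ?thesis unfolding power_mult_distrib by (intro mult_left_mono) auto
    qed
    finally show "Q * y \<le> (\<alpha> * Q + y\<^sup>2 / \<alpha>) / 2"
      using \<open>0 < \<alpha>\<close> by (simp add: field_simps power2_eq_square)
  qed (use assms n0 in auto)
  also have "\<dots> \<le> T * n * ((\<alpha> * Q + (\<Sum>i\<in>{1..n}. (b i ^ 4 + z ^ 4) / 2) / n / \<alpha>) / 2)"
    using y4 \<open>0 < \<alpha>\<close> assms(3) n0 by (intro mult_left_mono divide_right_mono add_left_mono) auto
  finally show "(\<Sum>i\<in>{1..n}. a i * b i) * z \<le>
    T * n / 2 * (\<alpha> * abs_cosine n a b + (\<Sum>i\<in>{1..n}. (b i ^ 4 + z ^ 4) / 2) / n / \<alpha>)"
    by (simp add: Q_def)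
qed

lemma expected_cosine_ge:
  assumes R: "2 \<le> R" and \<beta>: "0 < \<beta>" and w: "w \<in> {1..n}" and n2: "2 \<le> n" "l \<le> n" and l2: "(real l)\<^sup>2 / n \<le> 1 / 4"
    and mom: "\<And>u. u \<in> {1..n} \<Longrightarrow> u \<noteq> w \<Longrightarrow> integrable PPn (\<lambda>\<omega>. (Phi w u \<omega>)\<^sup>2)"
      "\<And>u. u \<in> {1..n} \<Longrightarrow> u \<noteq> w \<Longrightarrow> (\<integral>\<omega>. (Phi w u \<omega>)\<^sup>2 \<partial>PPn) \<le> R"
      "\<And>u. u \<in> {1..n} \<Longrightarrow> u \<noteq> w \<Longrightarrow> integrable PPn (\<lambda>\<omega>. (Phi w u \<omega>)\<^sup>2 * (x_vec \<omega> w)\<^sup>2 * (x_vec \<omega> u)\<^sup>2)"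
      "\<And>u. u \<in> {1..n} \<Longrightarrow> u \<noteq> w \<Longrightarrow> (\<integral>\<omega>. (Phi w u \<omega>)\<^sup>2 * (x_vec \<omega> w)\<^sup>2 * (x_vec \<omega> u)\<^sup>2 \<partial>PPn) \<le> R"
  shows "1 / (16 * R ^ 8 * (1 + \<bar>C\<bar>)) \<le> (\<integral>\<omega>. abs_cosine n (xhat R w \<omega>) (x_vec \<omega>) \<partial>PPn)"
proof -
  interpret P: prob_space PPn by (rule prob_space_PP)
  have n0: "0 < real n" using n_pos by simp
  have R4: "0 < R ^ 4" using R by simp
  have R3: "2 ^ 3 \<le> R ^ 3" using R by (intro power_mono) auto
  have xm [measurable]: "(\<lambda>\<omega>. xhat R w \<omega> u) \<in> borel_measurable PPn" for u
    unfolding xhat_def by measurable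
  let ?g = "\<lambda>u \<omega>. xhat R w \<omega> u * x_vec \<omega> u * x_vec \<omega> w"
  have each: "integrable PPn (?g u) \<and> 1 / 2 \<le> (\<integral>\<omega>. ?g u \<omega> \<partial>PPn)" if u: "u \<in> {1..n}" "u \<noteq> w" for u
  proof -
    note m = mom[OF u]
    have f: "integrable PPn (\<lambda>\<omega>. Phi w u \<omega> * (x_vec \<omega> w * x_vec \<omega> u))"
      "1 - (real l)\<^sup>2 / n \<le> (\<integral>\<omega>. Phi w u \<omega> * (x_vec \<omega> w * x_vec \<omega> u) \<partial>PPn)"
      using Phi_first_moment[OF w u(1) u(2)[symmetric] n2(2) \<beta>] by auto
    have int: "integrable PPn (?g u)"
    proof (rule Bochner_Integration.integrable_bound[OF f(1)])
      show "?g u \<in> borel_measurable PPn" using w u by measurable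
      show "AE \<omega> in PPn. norm (?g u \<omega>) \<le> norm (Phi w u \<omega> * (x_vec \<omega> w * x_vec \<omega> u))"
        by (intro AE_I2) (auto simp: xhat_def abs_mult)
    qed
    let ?t = "\<lambda>\<omega>. ((Phi w u \<omega>)\<^sup>2 * (x_vec \<omega> w)\<^sup>2 * (x_vec \<omega> u)\<^sup>2 + (Phi w u \<omega>)\<^sup>2) / (2 * R ^ 4)"
    have tint: "integrable PPn ?t" using m by (intro integrable_divide Bochner_Integration.integrable_add)
    have "(\<integral>\<omega>. ?t \<omega> \<partial>PPn) = ((\<integral>\<omega>. (Phi w u \<omega>)\<^sup>2 * (x_vec \<omega> w)\<^sup>2 * (x_vec \<omega> u)\<^sup>2 \<partial>PPn) + (\<integral>\<omega>. (Phi w u \<omega>)\<^sup>2 \<partial>PPn)) / (2 * R ^ 4)"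
      using m by simp
    also have "\<dots> \<le> (R + R) / (2 * R ^ 4)"
      using m R4 by (intro divide_right_mono add_mono) auto
    also have "\<dots> = 1 / R ^ 3" using R by (simp add: power_eq_if)
    also have "\<dots> \<le> 1 / 2 ^ 3" using R R3 by (intro divide_left_mono) auto
    finally have t: "(\<integral>\<omega>. ?t \<omega> \<partial>PPn) \<le> 1 / 8" by simp
    have "(\<integral>\<omega>. Phi w u \<omega> * (x_vec \<omega> w * x_vec \<omega> u) \<partial>PPn) - (\<integral>\<omega>. ?t \<omega> \<partial>PPn) =
        (\<integral>\<omega>. Phi w u \<omega> * (x_vec \<omega> w * x_vec \<omega> u) - ?t \<omega> \<partial>PPn)"
      using f(1) tint by simp
    also have "\<dots> \<le> (\<integral>\<omega>. ?g u \<omega> \<partial>PPn)"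
    proof (intro integral_mono Bochner_Integration.integrable_diff f(1) tint int)
      fix \<omega>
      show "Phi w u \<omega> * (x_vec \<omega> w * x_vec \<omega> u) - ?t \<omega> \<le> ?g u \<omega>"
        using truncation_le[of R "Phi w u \<omega>" "x_vec \<omega> w * x_vec \<omega> u"] R
        by (simp add: xhat_def power_mult_distrib ac_simps split: if_splits)
    qed
    \<comment> \<open>From 1, the count of paths takes at most 1/4 and the truncation at most 1/8,
      which leaves more than 1/2.\<close>
    finally show ?thesis using f(2) t l2 int by simp
  qed
  have selfg: "?g w \<omega> = 0" for \<omega> using R4 by (simp add: xhat_def Phi_self)
  have gint: "integrable PPn (?g u)" if "u \<in> {1..n}" for u
  proof (cases "u = w")
    case True
    then have "?g u = (\<lambda>_. 0)" using selfg by (intro ext) blast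
    then show ?thesis by simp
  qed (use each[OF that] in blast)
  let ?G = "\<lambda>\<omega>. (\<Sum>u\<in>{1..n}. xhat R w \<omega> u * x_vec \<omega> u) * x_vec \<omega> w"
  have G: "?G \<omega> = (\<Sum>u\<in>{1..n}. ?g u \<omega>)" for \<omega> by (simp add: sum_distrib_right)
  have Gint: "integrable PPn ?G" unfolding G using gint by (intro Bochner_Integration.integrable_sum)
  \<comment> \<open>The coordinate \<open>u = w\<close> contributes nothing, since the statistic
    vanishes there; \<open>2 \<le> n\<close> makes up for it.\<close>
  have "real n / 4 \<le> real (n - 1) * (1 / 2)" using n2 by (simp add: of_nat_diff)
  also have "\<dots> = (\<Sum>u\<in>{1..n} - {w}. 1 / 2)" using w by simp
  also have "\<dots> \<le> (\<Sum>u\<in>{1..n} - {w}. \<integral>\<omega>. ?g u \<omega> \<partial>PPn)" using each by (intro sum_mono) auto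
  also have "\<dots> = (\<Sum>u\<in>{1..n}. \<integral>\<omega>. ?g u \<omega> \<partial>PPn)"
  proof -
    have "(\<integral>\<omega>. ?g w \<omega> \<partial>PPn) = 0" unfolding selfg by simp
    then show ?thesis using sum.remove[OF finite_atLeastAtMost w, of "\<lambda>u. \<integral>\<omega>. ?g u \<omega> \<partial>PPn"] by simp
  qed
  also have "\<dots> = (\<integral>\<omega>. ?G \<omega> \<partial>PPn)"
    unfolding G using gint by (subst Bochner_Integration.integral_sum) auto
  finally have lower: "real n / 4 \<le> (\<integral>\<omega>. ?G \<omega> \<partial>PPn)" .
  define c1 where "c1 = 1 + \<bar>C\<bar>"
  \<comment> \<open>Chosen so that, per coordinate, the fourth-moment term becomes 1/8, half of the
    lower bound 1/4.\<close>
  define \<alpha> where "\<alpha> = 4 * R ^ 4 * c1"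
  have c1: "0 < c1" "C \<le> c1" by (auto simp: c1_def)
  have \<alpha>: "0 < \<alpha>" using R4 c1 by (simp add: \<alpha>_def)
  let ?Q = "\<lambda>\<omega>. abs_cosine n (xhat R w \<omega>) (x_vec \<omega>)"
  let ?Y = "\<lambda>\<omega>. (\<Sum>i\<in>{1..n}. (x_vec \<omega> i ^ 4 + x_vec \<omega> w ^ 4) / 2) / n"
  have T: "\<bar>xhat R w \<omega> i\<bar> \<le> R ^ 4" for \<omega> i using R4 by (auto simp: xhat_def)
  have pt: "?G \<omega> \<le> R ^ 4 * n / 2 * (\<alpha> * ?Q \<omega> + ?Y \<omega> / \<alpha>)" and Q01: "0 \<le> ?Q \<omega>" "?Q \<omega> \<le> 1" for \<omega>
    using cosine_bound(1)[where a = "xhat R w \<omega>" and T = "R ^ 4" and b = "x_vec \<omega>" and z = "x_vec \<omega> w", OF T \<alpha>]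
      cosine_bound(2,3)[where a = "xhat R w \<omega>" and T = "R ^ 4" and b = "x_vec \<omega>", OF T \<alpha>] R4 by auto
  have Qint: "integrable PPn ?Q"
  proof (rule P.integrable_const_bound[of _ 1])
    show "AE \<omega> in PPn. norm (?Q \<omega>) \<le> 1" using Q01 by auto
    show "?Q \<in> borel_measurable PPn"
      unfolding abs_cosine_def L2_set_def by measurable
  qed
  have Yint: "integrable PPn ?Y" and Yle: "(\<integral>\<omega>. ?Y \<omega> \<partial>PPn) \<le> c1"
  proof -
    note i4 = x_vec_fourth
    have i: "integrable PPn (\<lambda>\<omega>. (x_vec \<omega> i ^ 4 + x_vec \<omega> w ^ 4) / 2)" if "i \<in> {1..n}" for i
      using i4[OF that] i4[OF w] by simp
    show "integrable PPn ?Y" by (rule integrable_divide, rule Bochner_Integration.integrable_sum) (rule i)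
    have "(\<integral>\<omega>. ?Y \<omega> \<partial>PPn) = (\<Sum>i\<in>{1..n}. \<integral>\<omega>. (x_vec \<omega> i ^ 4 + x_vec \<omega> w ^ 4) / 2 \<partial>PPn) / n"
      using i by (simp add: Bochner_Integration.integral_sum)
    also have "\<dots> \<le> (\<Sum>i\<in>{1..n}. C) / n"
    proof (intro divide_right_mono sum_mono)
      fix i assume "i \<in> {1..n}"
      then show "(\<integral>\<omega>. (x_vec \<omega> i ^ 4 + x_vec \<omega> w ^ 4) / 2 \<partial>PPn) \<le> C"
        using i4[of i] i4[OF w] by simp
    qed simp
    also have "\<dots> = C" using n0 by simp
    finally show "(\<integral>\<omega>. ?Y \<omega> \<partial>PPn) \<le> c1" using c1 by simp
  qed
  have "real n / 4 \<le> (\<integral>\<omega>. R ^ 4 * n / 2 * (\<alpha> * ?Q \<omega> + ?Y \<omega> / \<alpha>) \<partial>PPn)"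
    using lower by (rule order_trans) (intro integral_mono Gint pt integrable_mult_right Bochner_Integration.integrable_add
        integrable_divide Qint Yint)
  also have "\<dots> = R ^ 4 * n / 2 * (\<alpha> * (\<integral>\<omega>. ?Q \<omega> \<partial>PPn) + (\<integral>\<omega>. ?Y \<omega> \<partial>PPn) / \<alpha>)"
  proof -
    have "(\<integral>\<omega>. k * (\<alpha> * f \<omega> + g \<omega> / \<alpha>) \<partial>PPn) = k * (\<alpha> * (\<integral>\<omega>. f \<omega> \<partial>PPn) + (\<integral>\<omega>. g \<omega> \<partial>PPn) / \<alpha>)"
      if "integrable PPn f" "integrable PPn g" for f g and k :: real
      using that by simp
    from this[OF Qint Yint] show ?thesis .
  qed
  also have "\<dots> \<le> R ^ 4 * n / 2 * (\<alpha> * (\<integral>\<omega>. ?Q \<omega> \<partial>PPn) + c1 / \<alpha>)"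
    using Yle R4 n0 \<alpha> by (intro mult_left_mono add_left_mono divide_right_mono) auto
  finally have "n * (1 / 4) \<le> n * (R ^ 4 / 2 * (\<alpha> * (\<integral>\<omega>. ?Q \<omega> \<partial>PPn) + c1 / \<alpha>))"
    by (simp add: ac_simps)
  then have "1 / 4 \<le> R ^ 4 / 2 * (\<alpha> * (\<integral>\<omega>. ?Q \<omega> \<partial>PPn) + c1 / \<alpha>)"
    by (rule mult_le_cancel_left_pos[OF n0, THEN iffD1])
  moreover have "R ^ 4 / 2 * (x + c1 / \<alpha>) = R ^ 4 / 2 * x + 1 / 8" for x
    using c1 R by (simp add: \<alpha>_def field_simps)
  ultimately have "1 / 4 \<le> R ^ 4 / 2 * (\<alpha> * (\<integral>\<omega>. ?Q \<omega> \<partial>PPn)) + 1 / 8" by (simp only:)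
  then have "1 / 8 \<le> R ^ 4 / 2 * (\<alpha> * (\<integral>\<omega>. ?Q \<omega> \<partial>PPn))" by linarith
  then have "1 \<le> 16 * (R ^ 4 * R ^ 4) * c1 * (\<integral>\<omega>. ?Q \<omega> \<partial>PPn)"
    by (simp add: \<alpha>_def ac_simps)
  moreover have "R ^ 4 * R ^ 4 = R ^ 8" by (simp flip: power_add)
  ultimately have "1 \<le> 16 * R ^ 8 * c1 * (\<integral>\<omega>. ?Q \<omega> \<partial>PPn)" by simp
  then show ?thesis unfolding c1_def[symmetric] using c1 R by (simp add: field_simps)
qed

end

theorem theorem2p12:
  fixes lam \<mu> \<rho> \<epsilon> \<delta> C K :: real
  assumes "0 \<le> lam" "lam \<le> 1" "0 \<le> \<mu>" "\<mu> \<le> 1" "0 < \<rho>" "\<rho> < 1"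
    and "\<epsilon> > 0" "F_fun lam \<mu> \<rho> 1 > 1 + \<epsilon>"
    and "0 < \<delta>" "\<delta> < 1 / 10" "A_plus lam \<mu> \<rho> > 1 + \<delta>"
  shows "\<exists>R>0. \<exists>c>0. \<forall>(\<pi> :: (real \<times> real) measure) (l :: nat \<Rightarrow> nat).
    correlated_prior \<rho> C \<pi> \<longrightarrow>
    (\<forall>n\<ge>2. real (l n) \<le> K * ln (real n) \<and> (1 + \<delta>) ^ l n \<ge> (real n)\<^sup>2) \<longrightarrow>
    (\<forall>n. \<forall>u\<in>{1..n}. \<forall>v\<in>{1..n}. u \<noteq> v \<longrightarrow>
      (let \<Phi> = (\<lambda>\<omega>. Phi_J lam \<mu> \<rho> n (l n) (X_mat lam n \<omega>) (Y_mat \<mu> n \<omega>) u v) in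
        integrable (PP \<pi> n) (\<lambda>\<omega>. (\<Phi> \<omega>)\<^sup>2) \<and>
        (\<integral>\<omega>. (\<Phi> \<omega>)\<^sup>2 \<partial>PP \<pi> n) \<le> R \<and>
        integrable (PP \<pi> n) (\<lambda>\<omega>. (\<Phi> \<omega>)\<^sup>2 * (x_vec \<omega> u)\<^sup>2 * (x_vec \<omega> v)\<^sup>2) \<and>
        (\<integral>\<omega>. (\<Phi> \<omega>)\<^sup>2 * (x_vec \<omega> u)\<^sup>2 * (x_vec \<omega> v)\<^sup>2 \<partial>PP \<pi> n) \<le> R)) \<and>
    (\<forall>\<^sub>F n in sequentially. \<forall>w\<in>{1..n}.
      (\<integral>\<omega>. abs_cosine n (x_hat lam \<mu> \<rho> n (l n) R w (X_mat lam n \<omega>) (Y_mat \<mu> n \<omega>)) (x_vec \<omega>)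
        \<partial>PP \<pi> n) \<ge> c)"
proof -
  let ?A = "A_plus lam \<mu> \<rho>"
  have A: "1 < ?A" using assms(9,11) by linarith
  have pos: "0 < lam" "0 < \<mu>" using A_plus_gt_1_pos[OF assms(1-4) A] .
  obtain h hm where h: "\<And>d. 1 \<le> h d" "\<And>d. h d \<le> hm"
    and eig: "\<And>d. (\<Sum>e\<in>UNIV. transfer \<rho> d e * (edge_weight lam \<mu> e)\<^sup>2 * h e) = ?A * h d"
    using transfer_eigenvector[OF pos(1) assms(2) pos(2) assms(4,5) A] by metis
  \<comment> \<open>This depends on the prior only through \<open>C\<close> and on the length only
    through \<open>K\<close>. The bound \<open>2 \<le> R\<close> makes the truncation loss at most
    1/8.\<close>
  define R where "R = max 2 (moment_const lam \<rho> C K ?A hm)"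
  define c where "c = 1 / (16 * R ^ 8 * (1 + \<bar>C\<bar>))"
  have R2: "2 \<le> R" by (simp add: R_def)
  have c0: "0 < c" using R2 by (simp add: c_def)
  show ?thesis
  proof (rule exI[of _ R], intro conjI exI[of _ c] allI impI)
    show "0 < R" using R2 by simp
    show "0 < c" by (rule c0)
  next
    fix \<pi> :: "(real \<times> real) measure" and l :: "nat \<Rightarrow> nat"
    assume prior: "correlated_prior \<rho> C \<pi>"
      and l: "\<forall>n\<ge>2. real (l n) \<le> K * ln (real n) \<and> (1 + \<delta>) ^ l n \<ge> (real n)\<^sup>2"
    have sp: "spiked \<rho> C \<pi> lam \<mu> n (l n)" if n: "2 \<le> n" for n
    proof -
      \<comment> \<open>Length 0 or 1 would give a power of at most \<open>1 + \<delta>\<close>,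
        which is less than 4, while \<open>n\<^sup>2\<close> is at least 4.\<close>
      have "2 \<le> l n"
      proof (rule ccontr)
        assume "\<not> 2 \<le> l n"
        then have "(1 + \<delta>) ^ l n \<le> (1 + \<delta>) ^ 1" using assms(9) by (intro power_increasing) auto
        moreover have "2\<^sup>2 \<le> (real n)\<^sup>2" using n by (intro power_mono) auto
        ultimately show False using l n assms(10) by fastforce
      qed
      then show ?thesis using prior pos assms n by unfold_locales auto
    qed
    have nA: "real n \<le> ?A ^ l n" if n: "2 \<le> n" for n
    proof -
      have "real n * 1 \<le> real n * real n" using n by (intro mult_left_mono) auto
      also have "\<dots> \<le> (1 + \<delta>) ^ l n" using l n by (simp add: power2_eq_square)
      also have "\<dots> \<le> ?A ^ l n" using assms(9,11) by (intro power_mono) auto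
      finally show ?thesis by simp
    qed
    have moments: "integrable (PP \<pi> n) (\<lambda>\<omega>. (Phi_J lam \<mu> \<rho> n (l n) (X_mat lam n \<omega>) (Y_mat \<mu> n \<omega>) u v)\<^sup>2) \<and>
        (\<integral>\<omega>. (Phi_J lam \<mu> \<rho> n (l n) (X_mat lam n \<omega>) (Y_mat \<mu> n \<omega>) u v)\<^sup>2 \<partial>PP \<pi> n) \<le> R \<and>
        integrable (PP \<pi> n) (\<lambda>\<omega>. (Phi_J lam \<mu> \<rho> n (l n) (X_mat lam n \<omega>) (Y_mat \<mu> n \<omega>) u v)\<^sup>2 * (x_vec \<omega> u)\<^sup>2 * (x_vec \<omega> v)\<^sup>2) \<and>
        (\<integral>\<omega>. (Phi_J lam \<mu> \<rho> n (l n) (X_mat lam n \<omega>) (Y_mat \<mu> n \<omega>) u v)\<^sup>2 * (x_vec \<omega> u)\<^sup>2 * (x_vec \<omega> v)\<^sup>2 \<partial>PP \<pi> n) \<le> R"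
      if uv: "u \<in> {1..n}" "v \<in> {1..n}" "u \<noteq> v" for n u v
    proof -
      \<comment> \<open>Two distinct indices exist, so the conditions on \<open>l\<close>, stated
        for \<open>2 \<le> n\<close>, apply. For smaller \<open>n\<close> there is nothing to
        show.\<close>
      have n: "2 \<le> n" using uv by auto
      interpret spiked \<rho> C \<pi> lam \<mu> n "l n" by (rule sp[OF n])
      have lK: "real (l n) \<le> K * ln (real n)" using l n by simp
      note P = Phi_moment_le(1,2)[OF A h eig nA[OF n] lK, where u = u and v = v]
      show ?thesis
        using P(1)[where b = True] P(2)[where b = True] P(1)[where b = False] P(2)[where b = False]
        unfolding end_weight_prod[OF uv] Phi_def R_def by (simp add: ac_simps max.coboundedI2)
    qed
    show "\<forall>u\<in>{1..n}. \<forall>v\<in>{1..n}. u \<noteq> v \<longrightarrow>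
      (let \<Phi> = (\<lambda>\<omega>. Phi_J lam \<mu> \<rho> n (l n) (X_mat lam n \<omega>) (Y_mat \<mu> n \<omega>) u v) in
        integrable (PP \<pi> n) (\<lambda>\<omega>. (\<Phi> \<omega>)\<^sup>2) \<and>
        (\<integral>\<omega>. (\<Phi> \<omega>)\<^sup>2 \<partial>PP \<pi> n) \<le> R \<and>
        integrable (PP \<pi> n) (\<lambda>\<omega>. (\<Phi> \<omega>)\<^sup>2 * (x_vec \<omega> u)\<^sup>2 * (x_vec \<omega> v)\<^sup>2) \<and>
        (\<integral>\<omega>. (\<Phi> \<omega>)\<^sup>2 * (x_vec \<omega> u)\<^sup>2 * (x_vec \<omega> v)\<^sup>2 \<partial>PP \<pi> n) \<le> R)" for n
      unfolding Let_def using moments by blast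
    \<comment> \<open>The logarithmic length makes l^2 / n tend to 0. Once it is at most 1/4, the
      path count is controlled and \<open>l n \<le> n\<close> follows.\<close>
    have "((\<lambda>n. K\<^sup>2 * (ln (real n) / real n powr (1 / 2))\<^sup>2) \<longlongrightarrow> K\<^sup>2 * 0\<^sup>2) sequentially"
      by (intro tendsto_mult tendsto_power tendsto_const lim_ln_over_power) simp
    moreover have "K\<^sup>2 * (ln (real n) / real n powr (1 / 2))\<^sup>2 = (K * ln (real n))\<^sup>2 / real n" for n
      by (simp add: powr_half_sqrt power_mult_distrib power_divide)
    ultimately have "((\<lambda>n. (K * ln (real n))\<^sup>2 / real n) \<longlongrightarrow> 0) sequentially" by simp
    then have "\<forall>\<^sub>F n in sequentially. (K * ln (real n))\<^sup>2 / real n < 1 / 4"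
      by (rule order_tendstoD) simp
    then show "\<forall>\<^sub>F n in sequentially. \<forall>w\<in>{1..n}.
      (\<integral>\<omega>. abs_cosine n (x_hat lam \<mu> \<rho> n (l n) R w (X_mat lam n \<omega>) (Y_mat \<mu> n \<omega>)) (x_vec \<omega>)
        \<partial>PP \<pi> n) \<ge> c"
      using eventually_ge_at_top[of 2]
    proof eventually_elim
      case (elim n)
      then have n: "2 \<le> n" by simp
      interpret spiked \<rho> C \<pi> lam \<mu> n "l n" by (rule sp[OF n])
      have lK: "real (l n) \<le> K * ln (real n)" using l n by simp
      have "(real (l n))\<^sup>2 \<le> (K * ln (real n))\<^sup>2" using lK by (intro power_mono) auto
      then have "(real (l n))\<^sup>2 / n \<le> (K * ln (real n))\<^sup>2 / n" by (intro divide_right_mono) auto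
      then have l2: "(real (l n))\<^sup>2 / n \<le> 1 / 4" using elim by linarith
      have "real (l n) * 1 \<le> real (l n) * real (l n)" using l_ge by (intro mult_left_mono) auto
      also have "\<dots> \<le> real n" using l2 n by (simp add: power2_eq_square divide_le_eq)
      finally have ln: "l n \<le> n" by simp
      have \<beta>0: "0 < beta_J lam \<mu> \<rho> (l n)" by (rule Phi_moment_le(3)[OF A h eig nA[OF n] lK])
      show ?case
      proof
        fix w assume w: "w \<in> {1..n}"
        have "c \<le> (\<integral>\<omega>. abs_cosine n (xhat R w \<omega>) (x_vec \<omega>) \<partial>PP \<pi> n)"
          unfolding c_def
          by (rule expected_cosine_ge[OF R2 \<beta>0 w n ln l2])
            (use moments[OF w] in \<open>auto simp: Phi_def\<close>)
        then show "c \<le> (\<integral>\<omega>. abs_cosine n (x_hat lam \<mu> \<rho> n (l n) R w (X_mat lam n \<omega>) (Y_mat \<mu> n \<omega>)) (x_vec \<omega>) \<partial>PP \<pi> n)"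
          unfolding xhat_eq .
      qed
    qed
  qed
qed

end
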